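(* Let $n\ge 1$, $0<\sigma_0<\sigma_1<1$, and let $$\mathcal{C}:=\{(t,x)\in\mathbb{R}\times\mathbb{R}^n \mid -1<t<0,\ |x|<\sigma_1|t|\}.$$ Let $1<p<1+\frac{4}{n-1}$, and let $V\in C^1(\overline{\mathcal{C}})$ satisfy $V\ge\epsilon$ on $\overline{\mathcal C}$ for some constant $\epsilon>0$. Then there exist $\gamma>1$ and $K>0$, depending only on $n,p,V,\sigma_0,\sigma_1$, such that the following holds for every $\delta>0$ and every (real-valued) $C^2$-solution $\phi$ on $\mathcal{C}$ of $$\Box\phi+V|\phi|^{p-1}\phi=0.$$ If $$0\le\limsup_{t\to0^-}|t|^{2-n+\frac{4}{p-1}}\int_{\mathcal{A}^{\sigma_0,\sigma_1}(t)}\left(|\nabla\phi|^2+|t|^{-2}|\phi|^2\right)<\delta,$$ then $$\limsup_{t\to0^-}|t|^{1-n+\frac{4}{p-1}}\int_{\mathcal{R}^{\sigma_0}_\gamma(t)}\left(|\nabla\phi|^2+|t|^{-2}\phi^2\right)\le K\delta.$$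
   Context: $\Box:=-\partial_t^2+\Delta_x$ is the wave operator on $\mathbb{R}^{n+1}=\mathbb{R}_t\times\mathbb{R}^n_x$. For a $C^1$ function $\phi$, $|\nabla\phi|^2:=(\partial_t\phi)^2+\sum_{i=1}^n(\partial_{x^i}\phi)^2$. For $n=1$, $\frac{4}{n-1}$ is read as $+\infty$. For $0<\sigma_0<\sigma_1<1$ and $t\in\mathbb{R}$, $\mathcal{A}^{\sigma_0,\sigma_1}(t):=\{(t,x)\mid \sigma_0|t|<|x|<\sigma_1|t|\}$; integrals over it are with respect to $n$-dimensional Lebesgue measure in $x$. For $0<\sigma<1$, $\gamma>1$ and $t_*<0$, $\mathcal{R}^\sigma_\gamma(t_* ):=\{(t,x)\mid \gamma t_*<t<\gamma^{-1}t_*,\ |x|<\sigma|t|\}$; integrals over it are with respect to $(n+1)$-dimensional Lebesgue measure. *)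

theory Defs
  imports "HOL-Analysis.Analysis"
begin

text \<open>
  Points of space-time \<open>\<real> \<times> \<real>\<^sup>n\<close> are pairs \<open>(t, x)\<close> of type \<open>real \<times> (real ^ 'n)\<close>, with \<open>n = CARD('n)\<close>.
\<close>

definition partial_deriv :: "'a::real_normed_vector \<Rightarrow> ('a \<Rightarrow> real) \<Rightarrow> 'a \<Rightarrow> real" where
  "partial_deriv v f z = deriv (\<lambda>s. f (z + s *\<^sub>R v)) 0"

definition time_deriv :: "(real \<times> (real ^ 'n) \<Rightarrow> real) \<Rightarrow> real \<times> (real ^ 'n) \<Rightarrow> real" where
  "time_deriv = partial_deriv (1, 0)"

definition space_deriv :: "'n \<Rightarrow> (real \<times> (real ^ 'n) \<Rightarrow> real) \<Rightarrow> real \<times> (real ^ 'n) \<Rightarrow> real" where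
  "space_deriv i = partial_deriv (0, axis i 1)"

definition wave_op :: "(real \<times> (real ^ 'n) \<Rightarrow> real) \<Rightarrow> real \<times> (real ^ 'n) \<Rightarrow> real" where
  "wave_op f z = - time_deriv (time_deriv f) z
     + (\<Sum>i\<in>UNIV. space_deriv i (space_deriv i f) z)"

definition grad_sq :: "(real \<times> (real ^ 'n) \<Rightarrow> real) \<Rightarrow> real \<times> (real ^ 'n) \<Rightarrow> real" where
  "grad_sq f z = (time_deriv f z)\<^sup>2 + (\<Sum>i\<in>UNIV. (space_deriv i f z)\<^sup>2)"

text \<open>
  The following three notions are meant for open \<open>S\<close>; values of \<open>f\<close> outside \<open>S\<close>
  (respectively \<open>closure S\<close>) are irrelevant.
\<close>

definition C1_on :: "'a::real_normed_vector set \<Rightarrow> ('a \<Rightarrow> 'b::real_normed_vector) \<Rightarrow> bool" where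
  "C1_on S f \<longleftrightarrow> (\<exists>f' :: 'a \<Rightarrow> 'a \<Rightarrow>\<^sub>L 'b.
     (\<forall>z\<in>S. (f has_derivative blinfun_apply (f' z)) (at z)) \<and> continuous_on S f')"

definition C2_on :: "'a::real_normed_vector set \<Rightarrow> ('a \<Rightarrow> 'b::real_normed_vector) \<Rightarrow> bool" where
  "C2_on S f \<longleftrightarrow> (\<exists>f' :: 'a \<Rightarrow> 'a \<Rightarrow>\<^sub>L 'b.
     (\<forall>z\<in>S. (f has_derivative blinfun_apply (f' z)) (at z)) \<and> C1_on S f')"

text \<open>
  \<open>C\<^sup>1\<close> up to the boundary: \<open>f\<close> is \<open>C\<^sup>1\<close> in \<open>S\<close>, and \<open>f\<close> and its derivative extend
  continuously to \<open>closure S\<close>, the values of \<open>f\<close> on the boundary being those of the extension.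
\<close>

definition C1_on_closure :: "'a::real_normed_vector set \<Rightarrow> ('a \<Rightarrow> 'b::real_normed_vector) \<Rightarrow> bool" where
  "C1_on_closure S f \<longleftrightarrow> continuous_on (closure S) f \<and> (\<exists>f' :: 'a \<Rightarrow> 'a \<Rightarrow>\<^sub>L 'b.
     (\<forall>z\<in>S. (f has_derivative blinfun_apply (f' z)) (at z)) \<and> continuous_on (closure S) f')"

definition past_cone :: "real \<Rightarrow> (real \<times> (real ^ 'n)) set" where
  "past_cone \<sigma>1 = {(t, x). -1 < t \<and> t < 0 \<and> norm x < \<sigma>1 * \<bar>t\<bar>}"

text \<open>A subset of the time slice at \<open>t\<close>; integrals over it are taken in \<open>x\<close> only.\<close>

definition annulus :: "real \<Rightarrow> real \<Rightarrow> real \<Rightarrow> (real \<times> (real ^ 'n)) set" where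
  "annulus \<sigma>0 \<sigma>1 t = {(t, x) | x. \<sigma>0 * \<bar>t\<bar> < norm x \<and> norm x < \<sigma>1 * \<bar>t\<bar>}"

definition slab :: "real \<Rightarrow> real \<Rightarrow> real \<Rightarrow> (real \<times> (real ^ 'n)) set" where
  "slab \<sigma> \<gamma> t\<^sub>s = {(t, x). \<gamma> * t\<^sub>s < t \<and> t < inverse \<gamma> * t\<^sub>s \<and> norm x < \<sigma> * \<bar>t\<bar>}"

text \<open>
  The solution need not be integrable up to the lateral boundary of the cone, so the
  energy integrals are nonnegative Lebesgue integrals with values in \<open>[0, \<infinity>]\<close>.
  The weight \<open>|t|\<^sup>-\<^sup>2\<close> in the slab energy uses the time \<open>t\<close> labelling the slab, not the time
  coordinate of the point of integration; the two differ by at most a factor \<open>\<gamma>\<^sup>2\<close>.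
\<close>

definition annulus_energy ::
    "real \<Rightarrow> real \<Rightarrow> (real \<times> (real ^ 'n) \<Rightarrow> real) \<Rightarrow> real \<Rightarrow> ennreal" where
  "annulus_energy \<sigma>0 \<sigma>1 \<phi> t =
     (\<integral>\<^sup>+x. ennreal (grad_sq \<phi> (t, x) + \<bar>t\<bar> powi (-2) * \<bar>\<phi> (t, x)\<bar>\<^sup>2)
           * indicator (annulus \<sigma>0 \<sigma>1 t) (t, x) \<partial>lborel)"

definition slab_energy ::
    "real \<Rightarrow> real \<Rightarrow> (real \<times> (real ^ 'n) \<Rightarrow> real) \<Rightarrow> real \<Rightarrow> ennreal" where
  "slab_energy \<sigma> \<gamma> \<phi> t =
     (\<integral>\<^sup>+z. ennreal (grad_sq \<phi> z + \<bar>t\<bar> powi (-2) * (\<phi> z)\<^sup>2)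
           * indicator (slab \<sigma> \<gamma> t) z \<partial>lborel)"

end

theory Submission
  imports Defs
begin

text \<open>
  The estimate is local: energy in a slab is bounded by energy in the annulus over a comparable time
  interval. Fix a centre \<open>P\<close> inside the cone, let \<open>s = z - P\<close>, \<open>f = |x - x\<^sub>P|\<^sup>2 - (t - t\<^sub>P)\<^sup>2\<close> and
  \<open>c = (n - 1) / 2 + k\<close>, and use the multiplier \<open>W(f) (s \<cdot> \<nabla>\<phi> + c \<phi>)\<close> on \<open>f > 0\<close> with \<open>W(f) = f\<^sup>k\<close>. The bulk term is then
  \<open>2 k f\<^bsup>k-1\<^esup> (s \<cdot> \<nabla>\<phi> + c \<phi>)\<^sup>2\<close> plus a multiple of \<open>f\<^sup>k V |\<phi>|\<^bsup>p+1\<^esup>\<close>, and this multiple is positive for small \<open>k > 0\<close>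
  exactly because \<open>p\<close> is subconformal. A cutoff in \<open>x\<close> produces
  error terms in the annulus only; there the term \<open>V |\<phi>|\<^bsup>p+1\<^esup>\<close>, which the annulus energy does not control directly,
  is bounded linearly in the energy by multiplying the equation with \<open>\<phi>\<close> times a second cutoff. Varying \<open>P\<close> recovers the full gradient,
  and rescaling makes the derivative of \<open>V\<close> negligible as \<open>t \<rightarrow> 0\<close>.
\<close>

section \<open>Functions of class \<open>C\<^sup>1\<close>\<close>

text \<open>The constant \<open>c\<close> is forced: it is the only value for which the indefinite
  form \<open>Q\<close> drops out of the bulk term when the weight is exactly f^k. No cutoff in time
  is needed: points of the cone that are spacelike to P have times in a compact interval away from
  0, and the weight vanishes at the light cone of P. For small k the derivative of f^k is singular
  there, so the weight is truncated at a level \<epsilon>. The truncation brings \<open>Q\<close>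
  back with a factor of size \<epsilon>, which costs \<epsilon> times the energy on a compact set
  inside the cone. That energy is finite for each solution but has no bound in terms of \<delta>.
  Hence all other constants have to be independent of \<epsilon>, and \<epsilon> tends to 0 with the
  solution held fixed; only after this limit is the estimate uniform in the solution. The square in
  the bulk term does not control \<phi>^2 by itself; a Hardy-type divergence of W(f) \<phi>^2 (z -
  P) supplies it.\<close>

lemma C1_on_iff:
  fixes f :: "'a::euclidean_space \<Rightarrow> 'b::real_normed_vector"
  shows "C1_on S f \<longleftrightarrow> (\<exists>f'. (\<forall>z\<in>S. (f has_derivative f' z) (at z)) \<and> (\<forall>h. continuous_on S (\<lambda>z. f' z h)))"
proof
  assume "C1_on S f"
  then obtain f' :: "'a \<Rightarrow> 'a \<Rightarrow>\<^sub>L 'b" where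
    "\<forall>z\<in>S. (f has_derivative blinfun_apply (f' z)) (at z)" "continuous_on S f'"
    unfolding C1_on_def by blast
  then show "\<exists>f'. (\<forall>z\<in>S. (f has_derivative f' z) (at z)) \<and> (\<forall>h. continuous_on S (\<lambda>z. f' z h))"
    by (intro exI[of _ "\<lambda>z. blinfun_apply (f' z)"]) (auto intro!: continuous_intros)
next
  assume "\<exists>f'. (\<forall>z\<in>S. (f has_derivative f' z) (at z)) \<and> (\<forall>h. continuous_on S (\<lambda>z. f' z h))"
  then obtain f' where f': "\<And>z. z \<in> S \<Longrightarrow> (f has_derivative f' z) (at z)"
    "\<And>h. continuous_on S (\<lambda>z. f' z h)" by blast
  have bl: "blinfun_apply (Blinfun (f' z)) = f' z" if "z \<in> S" for z
    using f'(1)[OF that] has_derivative_bounded_linear bounded_linear_Blinfun_apply by blast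
  \<comment> \<open>Finite dimension enters here: continuity of \<open>f' z h\<close> for each fixed
    \<open>h\<close> gives continuity in operator norm.\<close>
  have "continuous_on S (\<lambda>z. Blinfun (f' z))"
    by (rule continuous_on_blinfun_componentwise)
      (use f'(2) bl in \<open>auto cong: continuous_on_cong\<close>)
  then show "C1_on S f"
    unfolding C1_on_def using f'(1) bl by (intro exI[of _ "\<lambda>z. Blinfun (f' z)"]) auto
qed

lemma C1_onI:
  fixes f :: "'a::euclidean_space \<Rightarrow> 'b::real_normed_vector"
  assumes "\<And>z. z \<in> S \<Longrightarrow> (f has_derivative f' z) (at z)" "\<And>h. continuous_on S (\<lambda>z. f' z h)"
  shows "C1_on S f"
  using assms unfolding C1_on_iff by blast

lemma C1_onE:
  fixes f :: "'a::euclidean_space \<Rightarrow> 'b::real_normed_vector"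
  assumes "C1_on S f"
  obtains f' where "\<And>z. z \<in> S \<Longrightarrow> (f has_derivative f' z) (at z)" "\<And>h. continuous_on S (\<lambda>z. f' z h)"
  using assms unfolding C1_on_iff by blast

lemma C1_on_subset: "C1_on S f \<Longrightarrow> T \<subseteq> S \<Longrightarrow> C1_on T f"
  unfolding C1_on_def by (meson continuous_on_subset subsetD)

lemma C1_on_continuous: "C1_on S f \<Longrightarrow> continuous_on S f"
  unfolding C1_on_def
  by (meson continuous_at_imp_continuous_on has_derivative_continuous)

lemma C1_on_const: "C1_on S (\<lambda>z::'a::euclidean_space. c)"
  by (rule C1_onI[where f' = "\<lambda>_ _. 0"]) auto

lemma C1_on_linear:
  fixes f :: "'a::euclidean_space \<Rightarrow> 'b::real_normed_vector"
  shows "bounded_linear f \<Longrightarrow> C1_on S f"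
  by (rule C1_onI[where f' = "\<lambda>_. f"]) (auto intro: bounded_linear_imp_has_derivative)

lemma C1_on_add:
  fixes f g :: "'a::euclidean_space \<Rightarrow> 'b::real_normed_vector"
  assumes "C1_on S f" "C1_on S g"
  shows "C1_on S (\<lambda>z. f z + g z)"
proof -
  obtain f' g' where "\<And>z. z \<in> S \<Longrightarrow> (f has_derivative f' z) (at z)" "\<And>h. continuous_on S (\<lambda>z. f' z h)"
    "\<And>z. z \<in> S \<Longrightarrow> (g has_derivative g' z) (at z)" "\<And>h. continuous_on S (\<lambda>z. g' z h)"
    using assms by (auto elim!: C1_onE)
  then show ?thesis
    by (intro C1_onI[where f' = "\<lambda>z h. f' z h + g' z h"]) (auto intro!: derivative_intros continuous_intros)
qed

lemma (in bounded_linear) C1_on_compose: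
  fixes g :: "'c::euclidean_space \<Rightarrow> 'a"
  assumes "C1_on S g"
  shows "C1_on S (\<lambda>z. f (g z))"
proof -
  obtain g' where "\<And>z. z \<in> S \<Longrightarrow> (g has_derivative g' z) (at z)" "\<And>h. continuous_on S (\<lambda>z. g' z h)"
    using assms by (auto elim!: C1_onE)
  then show ?thesis
    by (intro C1_onI[where f' = "\<lambda>z h. f (g' z h)"]) (auto intro!: has_derivative continuous_on)
qed

lemma (in bounded_bilinear) C1_on_prod:
  fixes f :: "'d::euclidean_space \<Rightarrow> 'a"
  assumes "C1_on S f" "C1_on S g"
  shows "C1_on S (\<lambda>z. prod (f z) (g z))"
proof -
  obtain f' g' where fg: "\<And>z. z \<in> S \<Longrightarrow> (f has_derivative f' z) (at z)" "\<And>h. continuous_on S (\<lambda>z. f' z h)"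
    "\<And>z. z \<in> S \<Longrightarrow> (g has_derivative g' z) (at z)" "\<And>h. continuous_on S (\<lambda>z. g' z h)"
    using assms by (auto elim!: C1_onE)
  note fg' = assms[THEN C1_on_continuous]
  show ?thesis
    by (rule C1_onI[where f' = "\<lambda>z h. prod (f z) (g' z h) + prod (f' z h) (g z)"])
      (auto intro!: FDERIV fg fg' continuous_on_add continuous_on)
qed

lemmas C1_on_scaleR = bounded_bilinear.C1_on_prod[OF bounded_bilinear_scaleR]
lemmas C1_on_mult = bounded_bilinear.C1_on_prod[OF bounded_bilinear_mult]
lemmas C1_on_inner = bounded_bilinear.C1_on_prod[OF bounded_bilinear_inner]

lemma C1_on_diff:
  fixes f g :: "'a::euclidean_space \<Rightarrow> 'b::real_normed_vector"
  assumes "C1_on S f" "C1_on S g"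
  shows "C1_on S (\<lambda>z. f z - g z)"
  using C1_on_add[OF assms(1) C1_on_scaleR[OF C1_on_const assms(2), of "-1"]] by simp

lemma C1_on_sum:
  fixes f :: "'i \<Rightarrow> 'a::euclidean_space \<Rightarrow> 'b::real_normed_vector"
  assumes "\<And>i. i \<in> I \<Longrightarrow> C1_on S (f i)"
  shows "C1_on S (\<lambda>z. \<Sum>i\<in>I. f i z)"
  using assms by (induction I rule: infinite_finite_induct) (auto intro: C1_on_const C1_on_add)

lemma C1_on_compose_real:
  fixes g :: "'a::euclidean_space \<Rightarrow> real"
  assumes "C1_on S g" "\<And>y. y \<in> T \<Longrightarrow> (u has_real_derivative u' y) (at y)" "continuous_on T u'" "g ` S \<subseteq> T"
  shows "C1_on S (\<lambda>z. u (g z))"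
proof -
  obtain g' where g': "\<And>z. z \<in> S \<Longrightarrow> (g has_derivative g' z) (at z)" "\<And>h. continuous_on S (\<lambda>z. g' z h)"
    using assms(1) by (auto elim!: C1_onE)
  have "((\<lambda>z. u (g z)) has_derivative (\<lambda>h. u' (g z) * g' z h)) (at z)" if "z \<in> S" for z
  proof -
    have "(u has_derivative (*) (u' (g z))) (at (g z))"
      using assms(2)[of "g z"] that assms(4) by (auto simp: has_field_derivative_def)
    from has_derivative_compose[OF g'(1)[OF that] this] show ?thesis .
  qed
  then show ?thesis
    by (rule C1_onI[where f' = "\<lambda>z h. u' (g z) * g' z h"])
      (auto intro!: continuous_intros g'(2) continuous_on_compose2[OF assms(3) C1_on_continuous[OF assms(1)] assms(4)])
qed

section \<open>Cutoff functions of class C1\<close>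

lemma has_real_derivative_max_0_power:
  assumes "2 \<le> m"
  shows "((\<lambda>y::real. max 0 y ^ m) has_real_derivative (real m * max 0 y ^ (m - 1))) (at y)"
proof (cases "y = 0")
  case False
  show ?thesis
  proof (cases "y > 0")
    case True
    have "((\<lambda>y::real. y ^ m) has_real_derivative (real m * y ^ (m - 1))) (at y)"
      by (auto intro!: derivative_eq_intros)
    then show ?thesis
      using True by (rule_tac has_field_derivative_transform_within_open[of "\<lambda>y. y ^ m" _ _ "{0<..}"]) auto
  next
    case y: False
    have "((\<lambda>y::real. 0) has_real_derivative 0) (at y)" by auto
    then have "((\<lambda>y::real. max 0 y ^ m) has_real_derivative 0) (at y)"
      using y False assms by (rule_tac has_field_derivative_transform_within_open[of "\<lambda>y. 0" _ _ "{..<0}"]) auto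
    moreover have "real m * max 0 y ^ (m - 1) = 0" using y assms by (simp add: max_absorb1)
    ultimately show ?thesis by (simp only:)
  qed
next
  case True
  have "((\<lambda>h::real. max 0 h ^ m / h) \<longlongrightarrow> 0) (at 0)"
  proof (rule Lim_null_comparison)
    show "\<forall>\<^sub>F h in at (0::real). norm (max 0 h ^ m / h) \<le> \<bar>h\<bar> ^ (m - 1)"
    proof (intro always_eventually allI)
      fix h :: real
      obtain l where l: "m = Suc (Suc l)" using assms
        by (metis Suc_le_D numeral_2_eq_2 Suc_le_mono)
      show "norm (max 0 h ^ m / h) \<le> \<bar>h\<bar> ^ (m - 1)"
        by (cases "h > 0") (auto simp: l max_absorb1 max_absorb2 mult_nonpos_nonneg)
    qed
    show "((\<lambda>h::real. \<bar>h\<bar> ^ (m - 1)) \<longlongrightarrow> 0) (at 0)"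
      using assms by (auto intro!: tendsto_eq_intros)
  qed
  then show ?thesis
    using True assms by (simp add: DERIV_def power_0_left)
qed

lemma C1_on_max_0_power2:
  fixes g :: "'a::euclidean_space \<Rightarrow> real"
  assumes "C1_on S g"
  shows "C1_on S (\<lambda>z. (max 0 (g z))\<^sup>2)"
  by (rule C1_on_compose_real[OF assms has_real_derivative_max_0_power, where T = UNIV])
     (auto intro!: continuous_intros)

text \<open>The cutoff is a finite sum of the bumps \<open>(max 0 (r\<^sup>2 - \<bar>z - c\<bar>\<^sup>2))\<^sup>2\<close>, saturated at \<open>1\<close>.\<close>

lemma C1_cutoff_exists:
  fixes K U :: "'a::euclidean_space set"
  assumes "compact K" "open U" "K \<subseteq> U"
  obtains \<eta> :: "'a \<Rightarrow> real" and K' where "C1_on UNIV \<eta>" "\<And>z. 0 \<le> \<eta> z" "\<And>z. \<eta> z \<le> 1"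
    "\<And>z. z \<in> K \<Longrightarrow> \<eta> z = 1" "compact K'" "K' \<subseteq> U" "\<And>z. z \<notin> K' \<Longrightarrow> \<eta> z = 0"
proof -
  have "\<forall>c\<in>K. \<exists>r>0. cball c (2 * r) \<subseteq> U"
  proof
    fix c assume "c \<in> K"
    then obtain e where "e > 0" "cball c e \<subseteq> U"
      using assms open_contains_cball by blast
    then show "\<exists>r>0. cball c (2 * r) \<subseteq> U"
      by (intro exI[of _ "e / 2"]) auto
  qed
  then obtain r where r: "\<And>c. c \<in> K \<Longrightarrow> r c > 0" "\<And>c. c \<in> K \<Longrightarrow> cball c (2 * r c) \<subseteq> U" by metis
  obtain I where I: "I \<subseteq> K" "finite I" "K \<subseteq> (\<Union>c\<in>I. ball c (r c))"
    using compactE_image[OF assms(1), of K "\<lambda>c. ball c (r c)"] r(1)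
    by (metis (no_types, lifting) UN_I centre_in_ball open_ball subsetI)
  \<comment> \<open>On \<open>ball c (r c)\<close> the inner difference is at least 4 r^2 - r^2 = 3
    r^2, so with this denominator each bump is at least 1 there; it vanishes outside
    \<open>cball c (2 * r c)\<close>.\<close>
  define b where "b c z = (max 0 ((2 * r c)\<^sup>2 - (z - c) \<bullet> (z - c)))\<^sup>2 / (3 * (r c)\<^sup>2)\<^sup>2" for c z
  define B where "B z = (\<Sum>c\<in>I. b c z)" for z
  define \<eta> where "\<eta> z = 1 - (max 0 (1 - B z))\<^sup>2" for z
  define K' where "K' = (\<Union>c\<in>I. cball c (2 * r c))"
  have b_nonneg: "0 \<le> b c z" for c z by (simp add: b_def)
  then have B_nonneg: "0 \<le> B z" for z by (simp add: B_def sum_nonneg)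
  have lin: "C1_on UNIV (\<lambda>z::'a. z - c)" for c
    by (intro C1_on_diff C1_on_const C1_on_linear bounded_linear_ident)
  have bC: "C1_on UNIV (b c)" for c
    unfolding b_def divide_inverse
    by (intro C1_on_mult C1_on_max_0_power2 C1_on_diff C1_on_inner C1_on_const lin)
  have BC: "C1_on UNIV B"
    using C1_on_sum[of I UNIV b] bC unfolding B_def by auto
  have C: "C1_on UNIV \<eta>"
    unfolding \<eta>_def by (intro C1_on_diff C1_on_max_0_power2 C1_on_const BC)
  have "max 0 (1 - B z) \<le> 1" for z using B_nonneg by (simp add: max_def)
  then have "(max 0 (1 - B z))\<^sup>2 \<le> 1" for z by (simp add: power_le_one)
  then have 0: "0 \<le> \<eta> z" "\<eta> z \<le> 1" for z by (auto simp: \<eta>_def)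
  have 1: "\<eta> z = 1" if "z \<in> K" for z
  proof -
    have "z \<in> (\<Union>c\<in>I. ball c (r c))" using I(3) that by blast
    then obtain c where c: "c \<in> I" "dist c z < r c" by auto
    have "(z - c) \<bullet> (z - c) \<le> (r c)\<^sup>2"
      using c(2) by (simp add: power2_norm_eq_inner[symmetric] dist_norm norm_minus_commute power_mono)
    then have "3 * (r c)\<^sup>2 \<le> max 0 ((2 * r c)\<^sup>2 - (z - c) \<bullet> (z - c))" by (simp add: power2_eq_square)
    then have "(3 * (r c)\<^sup>2)\<^sup>2 \<le> (max 0 ((2 * r c)\<^sup>2 - (z - c) \<bullet> (z - c)))\<^sup>2"
      by (rule power_mono) simp
    moreover have "r c > 0" using r(1) c I by auto
    ultimately have "1 \<le> b c z" unfolding b_def by (subst le_divide_eq) (auto)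
    also have "b c z \<le> B z"
      unfolding B_def using c I b_nonneg by (intro member_le_sum) auto
    finally show ?thesis by (simp add: \<eta>_def)
  qed
  have 2: "\<eta> z = 0" if "z \<notin> K'" for z
  proof -
    have "b c z = 0" if c: "c \<in> I" for c
    proof -
      have "2 * r c < dist c z" using c \<open>z \<notin> K'\<close> by (auto simp: K'_def)
      moreover have "r c > 0" using r(1) c I by auto
      ultimately have "(2 * r c)\<^sup>2 \<le> (dist c z)\<^sup>2" by (intro power_mono) auto
      then have "(2 * r c)\<^sup>2 \<le> (z - c) \<bullet> (z - c)"
        by (simp add: power2_norm_eq_inner[symmetric] dist_norm norm_minus_commute)
      then show ?thesis by (simp add: b_def)
    qed
    then show ?thesis by (simp add: \<eta>_def B_def)
  qed
  have "compact K'" "K' \<subseteq> U" using I r(2) by (auto simp: K'_def intro!: compact_UN)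
  with C 0 1 2 that show thesis by blast
qed

section \<open>The divergence theorem for compactly supported fields\<close>

text \<open>Differentiability of \<open>D\<close> at the single point \<open>z\<close> suffices. The
  second difference \<open>\<Delta> h l s\<close> is symmetric in \<open>h\<close> and
  \<open>l\<close>, and equals s^2 (H l \<bullet> h) up to o(s^2); exchanging the directions
  identifies the two values. The symmetry is what turns the derivatives of
  \<open>D z \<bullet> (z - P)\<close> and of the Lorentzian square of \<open>D z\<close> into
  gradients.\<close>

lemma second_derivative_symmetric:
  fixes f :: "'a::real_inner \<Rightarrow> real"
  assumes "open S" "z \<in> S" and f: "\<And>w. w \<in> S \<Longrightarrow> (f has_derivative (\<lambda>h. D w \<bullet> h)) (at w)"
    and D: "(D has_derivative H) (at z)"
  shows "H h \<bullet> l = h \<bullet> H l"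
proof -
  interpret H: bounded_linear H using D by (rule has_derivative_bounded_linear)
  define \<Delta> where "\<Delta> h l s = f (z + s *\<^sub>R h + s *\<^sub>R l) - f (z + s *\<^sub>R h) - f (z + s *\<^sub>R l) + f z" for h l s
  define C where "C h l = (2 * norm h + norm l) * norm h" for h l :: 'a
  have C_nonneg: "0 \<le> C h l" for h l by (simp add: C_def)
  have *: "\<exists>d>0. \<forall>s. 0 < s \<and> s < d \<longrightarrow>
      \<bar>\<Delta> h l s - s\<^sup>2 * (H l \<bullet> h)\<bar> \<le> e * C h l * s\<^sup>2"
    if "e > 0" for e h l
  proof -
    from D \<open>e > 0\<close> obtain d1 where d1: "d1 > 0"
      "\<And>y. norm (y - z) < d1 \<Longrightarrow> norm (D y - D z - H (y - z)) \<le> e * norm (y - z)"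
      unfolding has_derivative_at_alt by blast
    obtain d2 where d2: "d2 > 0" "ball z d2 \<subseteq> S" using assms(1,2) open_contains_ball by blast
    define m where "m = norm h + norm l + 1"
    define d where "d = min d1 d2 / m"
    have m: "m > 0" by (simp add: m_def add_nonneg_pos)
    have "d > 0" using d1 d2 m by (simp add: d_def)
    moreover have "\<bar>\<Delta> h l s - s\<^sup>2 * (H l \<bullet> h)\<bar> \<le> e * C h l * s\<^sup>2"
      if s: "0 < s" "s < d" for s
    proof -
      have sm: "s * m < min d1 d2" using s m by (simp add: d_def pos_less_divide_eq)
      have near: "norm ((s * \<tau>) *\<^sub>R h + (s * \<mu>) *\<^sub>R l) < min d1 d2"
        if "0 \<le> \<tau>" "\<tau> \<le> 1" "0 \<le> \<mu>" "\<mu> \<le> 1" for \<tau> \<mu>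
      proof -
        have "norm ((s * \<tau>) *\<^sub>R h + (s * \<mu>) *\<^sub>R l) \<le> s * \<tau> * norm h + s * \<mu> * norm l"
          using norm_triangle_ineq[of "(s * \<tau>) *\<^sub>R h" "(s * \<mu>) *\<^sub>R l"] s that by simp
        also have "\<dots> \<le> s * 1 * norm h + s * 1 * norm l"
          using s that by (intro add_mono mult_right_mono mult_left_mono) auto
        also have "\<dots> \<le> s * m" using s by (simp add: m_def algebra_simps)
        finally show ?thesis using sm by linarith
      qed
      \<comment> \<open>The increment of \<open>f\<close> in direction \<open>l\<close>, followed
        along \<open>h\<close>. The mean value theorem expresses it by \<open>D\<close> at two
        points near \<open>z\<close>, and the linearisation of \<open>D\<close> at \<open>z\<close>
        applies to both.\<close>
      define g where "g \<tau> = f (z + (s * \<tau>) *\<^sub>R h + s *\<^sub>R l) - f (z + (s * \<tau>) *\<^sub>R h)" for \<tau>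
      have inS: "z + (s * \<tau>) *\<^sub>R h + (s * \<mu>) *\<^sub>R l \<in> S"
        if "0 \<le> \<tau>" "\<tau> \<le> 1" "0 \<le> \<mu>" "\<mu> \<le> 1" for \<tau> \<mu>
        using near[OF that] d2(2) by (auto simp: subset_iff dist_norm norm_minus_commute add.assoc)
      have g': "(g has_real_derivative
          s * (D (z + (s * \<tau>) *\<^sub>R h + s *\<^sub>R l) \<bullet> h - D (z + (s * \<tau>) *\<^sub>R h) \<bullet> h)) (at \<tau>)"
        if "0 \<le> \<tau>" "\<tau> \<le> 1" for \<tau>
      proof -
        have line: "((\<lambda>\<tau>. z + (s * \<tau>) *\<^sub>R h + w) has_derivative (\<lambda>t. (s * t) *\<^sub>R h)) (at \<tau>)" for w
          by (auto intro!: derivative_eq_intros)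
        have 1: "((\<lambda>\<tau>. f (z + (s * \<tau>) *\<^sub>R h + s *\<^sub>R l)) has_derivative
            (\<lambda>t. D (z + (s * \<tau>) *\<^sub>R h + s *\<^sub>R l) \<bullet> ((s * t) *\<^sub>R h))) (at \<tau>)"
          by (rule has_derivative_compose[OF line f]) (use inS[OF that, of 1] in simp)
        have 2: "((\<lambda>\<tau>. f (z + (s * \<tau>) *\<^sub>R h + 0)) has_derivative
            (\<lambda>t. D (z + (s * \<tau>) *\<^sub>R h + 0) \<bullet> ((s * t) *\<^sub>R h))) (at \<tau>)"
          by (rule has_derivative_compose[OF line f]) (use inS[OF that, of 0] in simp)
        show ?thesis
          using has_derivative_diff[OF 1 2] unfolding g_def[abs_def] has_field_derivative_def add_0_right
          by (rule has_derivative_eq_rhs) (simp_all add: algebra_simps fun_eq_iff)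
      qed
      obtain \<tau> where \<tau>: "0 < \<tau>" "\<tau> < 1"
        "g 1 - g 0 = s * (D (z + (s * \<tau>) *\<^sub>R h + s *\<^sub>R l) \<bullet> h - D (z + (s * \<tau>) *\<^sub>R h) \<bullet> h)"
        using MVT2[of 0 1 g, OF _ g'] by auto
      define y1 where "y1 = (s * \<tau>) *\<^sub>R h + s *\<^sub>R l"
      define y2 where "y2 = (s * \<tau>) *\<^sub>R h"
      have n1: "norm (D (z + y1) - D z - H y1) \<le> e * norm y1"
        using d1(2)[of "z + y1"] near[of \<tau> 1] \<tau> by (simp add: y1_def)
      have n2: "norm (D (z + y2) - D z - H y2) \<le> e * norm y2"
        using d1(2)[of "z + y2"] near[of \<tau> 0] \<tau> by (simp add: y2_def)
      have ny2: "norm y2 \<le> s * norm h"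
        using \<tau> s by (simp add: y2_def mult_left_le_one_le mult_right_mono mult_left_le)
      have ny1: "norm y1 \<le> s * norm h + s * norm l"
        using norm_triangle_ineq[of y2 "s *\<^sub>R l"] ny2 s by (simp add: y1_def y2_def)
      have lin: "H y1 - H y2 = s *\<^sub>R H l"
        by (simp add: y1_def y2_def H.add H.scaleR)
      have "\<Delta> h l s = g 1 - g 0"
        by (simp add: g_def \<Delta>_def)
      also have "\<dots> = s * (D (z + y1) \<bullet> h - D (z + y2) \<bullet> h)"
        using \<tau>(3) by (simp add: y1_def y2_def add.assoc)
      finally have "\<Delta> h l s - s\<^sup>2 * (H l \<bullet> h)
          = s * (((D (z + y1) - D z - H y1) - (D (z + y2) - D z - H y2) + (H y1 - H y2)) \<bullet> h - (s *\<^sub>R H l) \<bullet> h)"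
        by (simp add: inner_diff_left inner_add_left power2_eq_square algebra_simps)
      also have "\<dots> = s * (((D (z + y1) - D z - H y1) - (D (z + y2) - D z - H y2)) \<bullet> h)"
        by (simp add: lin inner_add_left)
      also have "\<bar>\<dots>\<bar> \<le> s * (norm ((D (z + y1) - D z - H y1) - (D (z + y2) - D z - H y2)) * norm h)"
        using s Cauchy_Schwarz_ineq2 by (simp add: abs_mult)
      also have "\<dots> \<le> s * ((e * norm y1 + e * norm y2) * norm h)"
        using s n1 n2 norm_triangle_ineq4[of "D (z + y1) - D z - H y1" "D (z + y2) - D z - H y2"]
        by (intro mult_left_mono mult_right_mono) auto
      also have "\<dots> \<le> s * ((e * (s * norm h + s * norm l) + e * (s * norm h)) * norm h)"
        using s ny1 ny2 \<open>e > 0\<close> by (intro mult_left_mono mult_right_mono add_mono) auto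
      also have "\<dots> = e * C h l * s\<^sup>2" by (simp add: C_def algebra_simps power2_eq_square)
      finally show ?thesis .
    qed
    ultimately show ?thesis by blast
  qed
  have "\<bar>H l \<bullet> h - H h \<bullet> l\<bar> \<le> e" if "e > 0" for e
  proof -
    define e' where "e' = e / (C h l + C l h + 1)"
    have pos: "C h l + C l h + 1 > 0" using C_nonneg[of h l] C_nonneg[of l h] by linarith
    have "e' > 0" using that pos by (simp add: e'_def)
    obtain d1 where d1: "d1 > 0" "\<forall>s. 0 < s \<and> s < d1 \<longrightarrow>
      \<bar>\<Delta> h l s - s\<^sup>2 * (H l \<bullet> h)\<bar> \<le> e' * C h l * s\<^sup>2"
      using *[OF \<open>e' > 0\<close>, of h l] by blast
    obtain d2 where d2: "d2 > 0" "\<forall>s. 0 < s \<and> s < d2 \<longrightarrow>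
      \<bar>\<Delta> l h s - s\<^sup>2 * (H h \<bullet> l)\<bar> \<le> e' * C l h * s\<^sup>2"
      using *[OF \<open>e' > 0\<close>, of l h] by blast
    define s where "s = min d1 d2 / 2"
    have s: "0 < s" "s < d1" "s < d2" using d1 d2 by (auto simp: s_def)
    have "\<Delta> l h s = \<Delta> h l s" by (simp add: \<Delta>_def algebra_simps)
    then have "\<bar>s\<^sup>2 * (H l \<bullet> h) - s\<^sup>2 * (H h \<bullet> l)\<bar> \<le> e' * C h l * s\<^sup>2 + e' * C l h * s\<^sup>2"
      using d1(2)[rule_format, of s] d2(2)[rule_format, of s] s by linarith
    then have "s\<^sup>2 * \<bar>H l \<bullet> h - H h \<bullet> l\<bar> \<le> s\<^sup>2 * (e' * (C h l + C l h))"
      by (simp add: abs_mult distrib_left mult.assoc mult.left_commute[of _ "s\<^sup>2"] mult.commute[of _ "s\<^sup>2"]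
          flip: right_diff_distrib)
    then have "\<bar>H l \<bullet> h - H h \<bullet> l\<bar> \<le> e' * (C h l + C l h)" using s by simp
    also have "\<dots> \<le> e' * (C h l + C l h + 1)" using \<open>e' > 0\<close> by simp
    also have "\<dots> = e" using pos by (simp add: e'_def)
    finally show ?thesis .
  qed
  then have "H l \<bullet> h = H h \<bullet> l" using field_le_epsilon[of "\<bar>H l \<bullet> h - H h \<bullet> l\<bar>" 0] by auto
  then show ?thesis by (simp add: inner_commute)
qed

section \<open>The divergence and its integral\<close>

definition divergence :: "('a::euclidean_space \<Rightarrow> 'a) \<Rightarrow> 'a \<Rightarrow> real" where
  "divergence X z = (\<Sum>b\<in>Basis. frechet_derivative X (at z) b \<bullet> b)"

lemma divergence_eq: "(X has_derivative X') (at z) \<Longrightarrow> divergence X z = (\<Sum>b\<in>Basis. X' b \<bullet> b)"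
  unfolding divergence_def using frechet_derivative_at by metis

lemma continuous_on_divergence: "C1_on S X \<Longrightarrow> continuous_on S (divergence X)"
  by (erule C1_onE, subst continuous_on_cong[OF refl divergence_eq])
    (auto intro!: continuous_on_sum continuous_on_inner)

text \<open>Difference quotients in direction \<open>b\<close> have integral 0 by translation
  invariance of Lebesgue measure. They are bounded by the maximum of the derivative and converge
  pointwise, so dominated convergence passes this to the limit.\<close>

lemma integral_directional_derivative_eq_0:
  fixes g :: "'a::euclidean_space \<Rightarrow> real"
  assumes g: "\<And>z. (g has_derivative g' z) (at z)" and cont: "continuous_on UNIV (\<lambda>z. g' z b)"
    and K: "compact K" "\<And>z. z \<notin> K \<Longrightarrow> g z = 0"
  shows "integrable lborel (\<lambda>z. g' z b)" "(LINT z|lborel. g' z b) = 0"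
proof -
  have out: "g' z b = 0" if "z \<notin> K" for z
  proof -
    have "(g has_derivative (\<lambda>_. 0)) (at z)"
      by (rule has_derivative_transform_within_open[of "\<lambda>_. 0" _ _ _ "- K"])
         (use K that compact_imp_closed in \<open>auto simp: open_Compl\<close>)
    then show ?thesis using has_derivative_unique[OF g] by metis
  qed
  have supp: "integrable lborel u" if "continuous_on UNIV u" "\<And>z. z \<notin> L \<Longrightarrow> u z = 0" "compact L"
    for u :: "'a \<Rightarrow> real" and L
  proof -
    have "integrable lborel (\<lambda>z. indicator L z *\<^sub>R u z)"
      using that by (intro borel_integrable_compact) (auto intro: continuous_on_subset)
    moreover have "(\<lambda>z. indicator L z *\<^sub>R u z) = u" using that by (auto simp: fun_eq_iff indicator_def)
    ultimately show ?thesis by simp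
  qed
  show "integrable lborel (\<lambda>z. g' z b)" by (rule supp[OF cont out K(1)])
  obtain M where M: "\<And>z. z \<in> K \<Longrightarrow> \<bar>g' z b\<bar> \<le> M" "M > 0"
    using compact_imp_bounded[OF compact_continuous_image[OF continuous_on_subset[OF cont subset_UNIV] K(1)]]
    by (auto simp: bounded_pos)
  have M': "\<bar>g' z b\<bar> \<le> M" for z using M out[of z] by (cases "z \<in> K") auto
  obtain R where R: "\<And>z. z \<in> K \<Longrightarrow> norm z \<le> R" using compact_imp_bounded[OF K(1)] by (auto simp: bounded_iff)
  \<comment> \<open>The steps 1 / (n + 1) are at most 1, so every difference quotient vanishes
    outside the ball enlarged by \<open>norm b\<close>.\<close>
  define L where "L = cball (0::'a) (R + norm b)"
  have gcont: "continuous_on UNIV g"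
    using g by (meson continuous_at_imp_continuous_on has_derivative_continuous)
  define s where "s n z = (g (z + (1 / real (Suc n)) *\<^sub>R b) - g z) * real (Suc n)" for n z
  have s_out: "s n z = 0" if "z \<notin> L" for n z
  proof -
    have "norm z > R + norm b" using that by (simp add: L_def)
    moreover have "norm z \<le> norm (z + (1 / real (Suc n)) *\<^sub>R b) + norm b"
    proof -
      have "norm z \<le> norm (z + (1 / real (Suc n)) *\<^sub>R b) + norm ((1 / real (Suc n)) *\<^sub>R b)"
        using norm_triangle_ineq4[of "z + (1 / real (Suc n)) *\<^sub>R b" "(1 / real (Suc n)) *\<^sub>R b"] by simp
      also have "norm ((1 / real (Suc n)) *\<^sub>R b) \<le> norm b"
        by (simp add: divide_le_eq algebra_simps)
      finally show ?thesis by simp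
    qed
    moreover have "norm z > R" using calculation(1) norm_ge_zero[of b] by linarith
    ultimately have "norm (z + (1 / real (Suc n)) *\<^sub>R b) > R" "norm z > R" by linarith+
    then have "z + (1 / real (Suc n)) *\<^sub>R b \<notin> K" "z \<notin> K" using R leD by blast+
    then show ?thesis using K(2) by (simp add: s_def)
  qed
  have s_cont: "continuous_on UNIV (s n)" for n
    unfolding s_def by (intro continuous_intros continuous_on_compose2[OF gcont]) auto
  have s_bound: "\<bar>s n z\<bar> \<le> M" for n z
  proof -
    define h where "h = 1 / real (Suc n)"
    have h: "h > 0" by (simp add: h_def)
    have "((\<lambda>t. g (z + t *\<^sub>R b)) has_real_derivative g' (z + t *\<^sub>R b) b) (at t)" for t
    proof -
      have "((\<lambda>t. z + t *\<^sub>R b) has_derivative (\<lambda>t. t *\<^sub>R b)) (at t)" by (auto intro!: derivative_eq_intros)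
      from has_derivative_compose[OF this g]
      have "((\<lambda>t. g (z + t *\<^sub>R b)) has_derivative (\<lambda>h. g' (z + t *\<^sub>R b) (h *\<^sub>R b))) (at t)" .
      then show ?thesis
        unfolding has_field_derivative_def
        by (rule has_derivative_eq_rhs)
          (auto simp: fun_eq_iff linear_scale[OF has_derivative_linear[OF g]])
    qed
    from MVT2[OF h this] obtain t where "g (z + h *\<^sub>R b) - g (z + 0 *\<^sub>R b) = (h - 0) * g' (z + t *\<^sub>R b) b" by blast
    then have "s n z = g' (z + t *\<^sub>R b) b" using h by (simp add: s_def h_def field_simps)
    then show ?thesis using M' by simp
  qed
  have s_lim: "(\<lambda>n. s n z) \<longlonglongrightarrow> g' z b" for z
  proof -
    have "((\<lambda>t. z + t *\<^sub>R b) has_derivative (\<lambda>t. t *\<^sub>R b)) (at 0)" by (auto intro!: derivative_eq_intros)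
    from has_derivative_compose[OF this g]
    have "((\<lambda>t. g (z + t *\<^sub>R b)) has_derivative (\<lambda>h. g' z (h *\<^sub>R b))) (at 0)" by simp
    then have "((\<lambda>t. g (z + t *\<^sub>R b)) has_real_derivative g' z b) (at 0)"
      unfolding has_field_derivative_def
      by (rule has_derivative_eq_rhs) (auto simp: fun_eq_iff linear_scale[OF has_derivative_linear[OF g]])
    then have "((\<lambda>h. (g (z + h *\<^sub>R b) - g z) / h) \<longlongrightarrow> g' z b) (at 0)" by (simp add: DERIV_def)
    moreover have "filterlim (\<lambda>n. 1 / real (Suc n)) (at 0) sequentially"
      using LIMSEQ_inverse_real_of_nat
      by (auto simp: filterlim_at divide_inverse)
    ultimately have "(\<lambda>n. (g (z + (1 / real (Suc n)) *\<^sub>R b) - g z) / (1 / real (Suc n))) \<longlonglongrightarrow> g' z b"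
      by (rule filterlim_compose)
    then show ?thesis by (simp add: s_def)
  qed
  have L: "compact L" by (simp add: L_def)
  have "(\<lambda>n. integral\<^sup>L lborel (s n)) \<longlonglongrightarrow> (LINT z|lborel. g' z b)"
  proof (rule integral_dominated_convergence[where w = "\<lambda>z. M * indicator L z"])
    show "integrable lborel (\<lambda>z. M * indicator L z)"
      using emeasure_bounded_finite[OF compact_imp_bounded[OF L]] L
      by (auto simp: integrable_indicator_iff borel_compact)
    show "AE x in lborel. (\<lambda>n. s n x) \<longlonglongrightarrow> g' x b" using s_lim by simp
    show "AE x in lborel. norm (s n x) \<le> M * indicator L x" for n
      using s_bound s_out M by (auto simp: indicator_def)
  qed (use supp[OF cont out K(1)] supp[OF s_cont s_out L] in \<open>auto intro: borel_measurable_integrable\<close>)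
  moreover have "integral\<^sup>L lborel (s n) = 0" for n
  proof -
    have int_g: "integrable lborel g" by (rule supp[OF gcont K(2) K(1)])
    have "integrable (distr lborel borel ((+) ((1 / real (Suc n)) *\<^sub>R b))) g"
      using int_g by (simp add: lborel_distr_plus)
    then have int_s: "integrable lborel (\<lambda>z. g ((1 / real (Suc n)) *\<^sub>R b + z))"
      using borel_measurable_continuous_onI[OF gcont] by (subst (asm) integrable_distr_eq) auto
    have "(LINT z|lborel. g ((1 / real (Suc n)) *\<^sub>R b + z)) = integral\<^sup>L (distr lborel borel ((+) ((1 / real (Suc n)) *\<^sub>R b))) g"
      using borel_measurable_continuous_onI[OF gcont] by (subst integral_distr) auto
    also have "\<dots> = integral\<^sup>L lborel g" by (simp add: lborel_distr_plus)
    finally show ?thesis using int_g int_s by (simp add: s_def[abs_def] add.commute)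
  qed
  ultimately show "(LINT z|lborel. g' z b) = 0" by (simp add: LIMSEQ_const_iff)
qed

text \<open>The field is extended by zero from \<open>K\<close>. It vanishes on
  \<open>S - K\<close>, so the extension agrees with \<open>X\<close> on all of \<open>S\<close> and
  with 0 on the complement of \<open>K\<close>; these two open sets cover the space, and the
  extension is C1 on both. Nothing is asked of \<open>X\<close> at the boundary of \<open>S\<close>,
  which later contains part of a light cone.\<close>

theorem divergence_integral_eq_0:
  fixes X :: "'a::euclidean_space \<Rightarrow> 'a"
  assumes "open S" "C1_on S X" "compact K" "K \<subseteq> S" "\<And>z. z \<in> S \<Longrightarrow> z \<notin> K \<Longrightarrow> X z = 0"
  shows "(LINT z:K|lborel. divergence X z) = 0"
proof -
  obtain X' where X': "\<And>z. z \<in> S \<Longrightarrow> (X has_derivative X' z) (at z)" "\<And>h. continuous_on S (\<lambda>z. X' z h)"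
    using C1_onE[OF assms(2)] by blast
  have opK: "open (- K)" using assms(3) by (simp add: compact_imp_closed open_Compl)
  have out: "X' z = (\<lambda>_. 0)" if "z \<in> S" "z \<notin> K" for z
  proof -
    have "(X has_derivative (\<lambda>_. 0)) (at z)"
      by (rule has_derivative_transform_within_open[of "\<lambda>_. 0" _ _ _ "S - K"])
         (use assms that compact_imp_closed in \<open>auto simp: open_Diff\<close>)
    then show ?thesis using has_derivative_unique[OF X'(1)[OF that(1)]] by metis
  qed
  define Y where "Y z = (if z \<in> K then X z else 0)" for z
  define Y' where "Y' z = (if z \<in> K then X' z else (\<lambda>_. 0))" for z
  have Y': "(Y has_derivative Y' z) (at z)" for z
  proof (cases "z \<in> K")
    case True
    then have zS: "z \<in> S" using assms by auto
    have "(X has_derivative Y' z) (at z)" using X'(1)[OF zS] True by (simp add: Y'_def)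
    then show ?thesis
      by (rule has_derivative_transform_within_open[OF _ assms(1) zS]) (auto simp: Y_def assms(5))
  next
    case False
    then have "z \<in> - K" by simp
    moreover have "((\<lambda>_. 0) has_derivative Y' z) (at z)" using False by (simp add: Y'_def)
    ultimately show ?thesis
      by (rule_tac has_derivative_transform_within_open[OF _ opK]) (auto simp: Y_def)
  qed
  have Y'_cont: "continuous_on UNIV (\<lambda>z. Y' z h)" for h
  proof -
    have "continuous_on S (\<lambda>z. Y' z h)"
      using X'(2)[of h] by (rule continuous_on_eq) (auto simp: Y'_def out)
    moreover have "continuous_on (- K) (\<lambda>z. Y' z h)"
      by (rule continuous_on_eq[OF continuous_on_const[of _ 0]]) (auto simp: Y'_def)
    ultimately have "continuous_on (S \<union> - K) (\<lambda>z. Y' z h)"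
      using continuous_on_open_Un assms(1) opK by blast
    then show ?thesis using assms(4) by (simp add: Un_commute sup_absorb1 Compl_partition2 subset_Un_eq)
       (metis (no_types, lifting) Compl_partition2 sup.absorb_iff2 sup_left_commute sup_top_left Un_commute)
  qed
  have Yb: "((\<lambda>z. Y z \<bullet> b) has_derivative (\<lambda>h. Y' z h \<bullet> b)) (at z)" for b z
    using Y' by (auto intro!: derivative_eq_intros)
  note D = integral_directional_derivative_eq_0[OF Yb continuous_on_inner[OF Y'_cont continuous_on_const] assms(3)]
  have "(LINT z|lborel. (\<Sum>b\<in>Basis. Y' z b \<bullet> b)) = (\<Sum>b\<in>Basis. (LINT z|lborel. Y' z b \<bullet> b))"
    by (rule Bochner_Integration.integral_sum) (rule D(1), simp add: Y_def)
  also have "\<dots> = 0"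
    by (rule sum.neutral) (auto intro!: D(2) simp: Y_def)
  also have "(\<lambda>z. \<Sum>b\<in>Basis. Y' z b \<bullet> b) = (\<lambda>z. indicator K z *\<^sub>R divergence X z)"
    using assms(4) by (auto simp: Y'_def fun_eq_iff indicator_def divergence_eq[OF X'(1)] subset_iff)
  finally show ?thesis by (simp add: set_lebesgue_integral_def)
qed

section \<open>The weight\<close>

text \<open>
  A \<open>C\<^sup>2\<close> substitute \<open>W\<close> for \<open>r\<^sup>k\<close>, with \<open>G = W'\<close> and \<open>H = W''\<close>, that vanishes near \<open>r = 0\<close>: with \<open>u = r\<^sup>k\<close> and
  \<open>v = max 0 (1 - \<epsilon> / u)\<close> it is \<open>W = u v\<^sup>3\<close>. All the signs needed later come from the convexity of \<open>u \<mapsto> u v\<^sup>3\<close>.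
\<close>

lemma weight_exists:
  fixes k \<epsilon> :: real
  assumes "k > 0" "\<epsilon> > 0"
  obtains W G H :: "real \<Rightarrow> real" and r0 :: real
  where "\<And>r. r > 0 \<Longrightarrow> (W has_real_derivative G r) (at r)"
    "\<And>r. r > 0 \<Longrightarrow> (G has_real_derivative H r) (at r)" "continuous_on {0<..} H"
    "r0 > 0" "\<And>r. 0 < r \<Longrightarrow> r < r0 \<Longrightarrow> W r = 0" "\<And>r. 0 < r \<Longrightarrow> r < r0 \<Longrightarrow> G r = 0"
    "\<And>r. r > 0 \<Longrightarrow> 0 \<le> W r" "\<And>r. r > 0 \<Longrightarrow> W r \<le> r powr k"
    "\<And>r. r > 0 \<Longrightarrow> 0 \<le> G r" "\<And>r. r > 0 \<Longrightarrow> 0 \<le> (1 - k) * G r + r * H r"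
    "\<And>r. r > 0 \<Longrightarrow> 0 \<le> r * G r - k * W r" "\<And>r. r > 0 \<Longrightarrow> r * G r - k * W r \<le> 3 * k * \<epsilon>"
    "\<And>r. r > 0 \<Longrightarrow> 2 * \<epsilon> \<le> r powr k \<Longrightarrow> r powr k / 8 \<le> W r"
proof -
  define v where "v r = max 0 (1 - \<epsilon> * r powr (- k))" for r
  define W where "W r = r powr k * v r ^ 3" for r
  \<comment> \<open>With \<Phi>(u) = u v^3 one has \<Phi>' = 3 v^2 - 2 v^3 and u \<Phi>'' = 6 v (1 -
    v)^2, and \<open>G\<close> and \<open>H\<close> follow by the chain rule. The cube is the lowest
    integer power of \<open>v\<close> for which \<open>H\<close> stays continuous where
    \<open>v\<close> reaches 0.\<close>
  define G where "G r = k * r powr (k - 1) * (3 * v r ^ 2 - 2 * v r ^ 3)" for r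
  define H where "H r = k * (k - 1) * r powr (k - 2) * (3 * v r ^ 2 - 2 * v r ^ 3)
    + 6 * k\<^sup>2 * r powr (k - 2) * (v r * (1 - v r)\<^sup>2)" for r
  define r0 where "r0 = \<epsilon> powr (1 / k)"
  have v01: "0 \<le> v r" "v r \<le> 1" if "r > 0" for r using assms that by (auto simp: v_def)
  \<comment> \<open>The equation \<epsilon> r^(-k) = 1 - v holds only where \<open>v\<close> is
    positive; one factor \<open>v\<close> makes it valid everywhere.\<close>
  have v_eq: "v r ^ Suc m * (\<epsilon> * r powr (- k)) = v r ^ Suc m * (1 - v r)" for r m
    by (cases "1 - \<epsilon> * r powr (- k) > 0") (auto simp: v_def max_absorb1 max_absorb2)
  have dv: "((\<lambda>r. v r ^ Suc (Suc m)) has_real_derivative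
      real (Suc (Suc m)) * (k * (v r ^ Suc m * (1 - v r)) / r)) (at r)" if r: "r > 0" for r m
  proof -
    have "((\<lambda>r. 1 - \<epsilon> * r powr (- k)) has_real_derivative (\<epsilon> * k * r powr (- k - 1))) (at r)"
      using r by (auto intro!: derivative_eq_intros)
    from DERIV_chain2[OF has_real_derivative_max_0_power[of "Suc (Suc m)"] this]
    have "((\<lambda>r. v r ^ Suc (Suc m)) has_real_derivative
        real (Suc (Suc m)) * v r ^ Suc m * (\<epsilon> * k * r powr (- k - 1))) (at r)"
      by (simp add: v_def)
    also have "r powr (- k - 1) = r powr (- k) / r" using r by (simp add: powr_diff)
    also have "real (Suc (Suc m)) * v r ^ Suc m * (\<epsilon> * k * (r powr (- k) / r))
        = real (Suc (Suc m)) * (k * (v r ^ Suc m * (\<epsilon> * r powr (- k))) / r)" by simp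
    finally show ?thesis by (simp only: v_eq)
  qed
  have v2: "((\<lambda>r. v r ^ 2) has_real_derivative 2 * (k * (v r * (1 - v r)) / r)) (at r)" if "r > 0" for r
    using dv[OF that, of 0] by (simp add: numeral_2_eq_2)
  have v3: "((\<lambda>r. v r ^ 3) has_real_derivative 3 * (k * (v r ^ 2 * (1 - v r)) / r)) (at r)" if "r > 0" for r
    using dv[OF that, of 1] by (simp add: numeral_3_eq_3 numeral_2_eq_2)
  have pw: "r powr (k - 1) = r powr k / r" "r powr (k - 2) = r powr k / r\<^sup>2" "r powr (k - 1 - 1) = r powr k / r\<^sup>2"
    if "r > 0" for r
    using that by (simp_all add: powr_diff power2_eq_square)
  have W: "(W has_real_derivative G r) (at r)" if r: "r > 0" for r
  proof -
    have "((\<lambda>r. r powr k * v r ^ 3) has_real_derivative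
        k * r powr (k - 1) * v r ^ 3 + 3 * (k * (v r ^ 2 * (1 - v r)) / r) * r powr k) (at r)"
      by (rule DERIV_mult'[THEN DERIV_cong, OF has_real_derivative_powr[OF r] v3[OF r]]) simp
    also have "k * r powr (k - 1) * v r ^ 3 + 3 * (k * (v r ^ 2 * (1 - v r)) / r) * r powr k = G r"
      using r by (simp add: G_def pw[OF r] field_simps power2_eq_square power3_eq_cube)
    finally show ?thesis by (simp add: W_def[abs_def])
  qed
  have G: "(G has_real_derivative H r) (at r)" if r: "r > 0" for r
  proof -
    have "((\<lambda>r. k * r powr (k - 1) * (3 * v r ^ 2 - 2 * v r ^ 3)) has_real_derivative
        k * ((k - 1) * r powr (k - 1 - 1)) * (3 * v r ^ 2 - 2 * v r ^ 3)
        + k * r powr (k - 1) * (3 * (2 * (k * (v r * (1 - v r)) / r)) - 2 * (3 * (k * (v r ^ 2 * (1 - v r)) / r)))) (at r)"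
      by (rule DERIV_mult'[THEN DERIV_cong, OF DERIV_cmult[OF has_real_derivative_powr[OF r]]
            DERIV_diff[OF DERIV_cmult[OF v2[OF r]] DERIV_cmult[OF v3[OF r]]]]) simp
    also have "k * ((k - 1) * r powr (k - 1 - 1)) * (3 * v r ^ 2 - 2 * v r ^ 3)
        + k * r powr (k - 1) * (3 * (2 * (k * (v r * (1 - v r)) / r)) - 2 * (3 * (k * (v r ^ 2 * (1 - v r)) / r))) = H r"
      unfolding H_def pw[OF r] using r by (simp add: field_simps power2_eq_square power3_eq_cube)
    finally show ?thesis by (simp add: G_def[abs_def])
  qed
  have Hc: "continuous_on {0<..} H"
    unfolding H_def v_def by (auto intro!: continuous_intros)
  have r0: "r0 > 0" using assms by (simp add: r0_def)
  have v0: "v r = 0" if "0 < r" "r < r0" for r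
  proof -
    have "r powr k \<le> r0 powr k" using that assms by (intro powr_mono2) auto
    then have "r powr k \<le> \<epsilon>" using assms by (simp add: r0_def powr_powr)
    then have "1 - \<epsilon> * r powr (- k) \<le> 0" using that by (simp add: powr_minus field_simps)
    then show ?thesis by (simp add: v_def)
  qed
  have sm: "0 \<le> 3 * v r ^ 2 - 2 * v r ^ 3" if "r > 0" for r
  proof -
    have "3 * v r ^ 2 - 2 * v r ^ 3 = v r ^ 2 * (1 + 2 * (1 - v r))"
      by (simp add: power2_eq_square power3_eq_cube algebra_simps)
    then show ?thesis using v01[OF that] by simp
  qed
  have rG: "r * G r - k * W r = 3 * k * (r powr k * (v r ^ 2 * (1 - v r)))" if r: "r > 0" for r
    using r by (simp add: G_def W_def pw[OF r] field_simps power2_eq_square power3_eq_cube)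
  \<comment> \<open>Where v > 0 the product u (1 - v) is exactly \<epsilon>. Thus r G - k W, which
    measures how far \<open>W\<close> is from being homogeneous of degree k, is of size \<epsilon>
    uniformly in \<open>r\<close>.\<close>
  have rG': "r powr k * (v r ^ 2 * (1 - v r)) = \<epsilon> * v r ^ 2" if r: "r > 0" for r
  proof -
    have "v r ^ 2 * (\<epsilon> * r powr (- k)) = v r ^ 2 * (1 - v r)" using v_eq[of r 1] by (simp only: Suc_1)
    then have "r powr k * (v r ^ 2 * (1 - v r)) = r powr k * (v r ^ 2 * (\<epsilon> * r powr (- k)))" by (simp only:)
    moreover have "r powr k * r powr (- k) = 1" using r by (simp flip: powr_add)
    then have "r powr k * (v r ^ 2 * (\<epsilon> * r powr (- k))) = \<epsilon> * v r ^ 2"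
      by (metis mult.assoc mult.commute mult.right_neutral)
    ultimately show ?thesis by (simp only:)
  qed
  show thesis
  proof (rule that[OF W G Hc r0])
    show "W r = 0" "G r = 0" if "0 < r" "r < r0" for r using v0[OF that] by (simp_all add: W_def G_def)
    fix r :: real assume r: "r > 0"
    show "0 \<le> W r" using v01[OF r] by (simp add: W_def)
    show "W r \<le> r powr k" using v01[OF r] by (simp add: W_def mult_left_le power_le_one)
    show "0 \<le> G r" using sm[OF r] assms by (simp add: G_def)
    \<comment> \<open>The left side is k^2 r^(2k-1) \<Phi>''(u), so convexity of \<Phi> gives its
      sign.\<close>
    have "(1 - k) * G r + r * H r = 6 * k\<^sup>2 * r powr (k - 1) * (v r * (1 - v r)\<^sup>2)"
      using r by (simp add: G_def H_def pw[OF r] field_simps power2_eq_square power3_eq_cube)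
    then show "0 \<le> (1 - k) * G r + r * H r" using v01[OF r] by simp
    show "0 \<le> r * G r - k * W r" using rG[OF r] v01[OF r] assms by simp
    show "r * G r - k * W r \<le> 3 * k * \<epsilon>"
      using rG[OF r] rG'[OF r] v01[OF r] assms by (simp add: power_le_one mult_left_le)
    show "r powr k / 8 \<le> W r" if "2 * \<epsilon> \<le> r powr k"
    proof -
      have "1 / 2 \<le> 1 - \<epsilon> * r powr (- k)" using that r by (simp add: powr_minus field_simps)
      then have "1 / 2 \<le> v r" by (simp add: v_def)
      then have "(1 / 2) ^ 3 \<le> v r ^ 3" by (intro power_mono) auto
      then have "r powr k * (1 / 8) \<le> r powr k * v r ^ 3" by (intro mult_left_mono) (auto simp: power3_eq_cube)
      then show ?thesis by (simp add: W_def)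
    qed
  qed (use W G in auto)
qed

section \<open>Calculus of the power nonlinearity\<close>

lemma has_real_derivative_abs_powr:
  fixes p y :: real
  assumes "p > 0"
  shows "((\<lambda>y. \<bar>y\<bar> powr (p + 1) / (p + 1)) has_real_derivative \<bar>y\<bar> powr (p - 1) * y) (at y)"
proof -
  consider "y > 0" | "y < 0" | "y = 0" by linarith
  then show ?thesis
  proof cases
    case 1
    have "((\<lambda>y. y powr (p + 1) / (p + 1)) has_real_derivative \<bar>y\<bar> powr (p - 1) * y) (at y)"
      using 1 assms by (auto intro!: derivative_eq_intros simp: powr_diff)
    then show ?thesis
      by (rule has_field_derivative_transform_within_open[of _ _ _ "{0<..}"]) (use 1 in auto)
  next
    case 2
    have "((\<lambda>y. (- y) powr (p + 1) / (p + 1)) has_real_derivative \<bar>y\<bar> powr (p - 1) * y) (at y)"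
      using 2 assms by (auto intro!: derivative_eq_intros simp: powr_diff)
    then show ?thesis
      by (rule has_field_derivative_transform_within_open[of _ _ _ "{..<0}"]) (use 2 in auto)
  next
    case 3
    have "((\<lambda>h. \<bar>h\<bar> powr (p + 1) / (p + 1) / h) \<longlongrightarrow> 0) (at 0)"
    proof (rule Lim_null_comparison)
      show "\<forall>\<^sub>F h in at (0::real). norm (\<bar>h\<bar> powr (p + 1) / (p + 1) / h) \<le> \<bar>h\<bar> powr p / (p + 1)"
        using assms by (intro always_eventually allI) (auto simp: abs_mult powr_add)
      show "((\<lambda>h::real. \<bar>h\<bar> powr p / (p + 1)) \<longlongrightarrow> 0) (at 0)"
        using assms by (auto intro!: tendsto_eq_intros)
    qed
    then show ?thesis using 3 assms by (simp add: DERIV_def)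
  qed
qed

lemma continuous_on_abs_powr_mult:
  fixes p :: real
  assumes "p > 1"
  shows "continuous_on S (\<lambda>y::real. \<bar>y\<bar> powr (p - 1) * y)"
  using assms by (auto intro!: continuous_intros continuous_on_powr')

section \<open>Product rules for the divergence, and the Minkowski metric\<close>

lemma divergence_scaleR:
  assumes "GDERIV g z :> a" "(X has_derivative X') (at z)"
  shows "divergence (\<lambda>z. g z *\<^sub>R X z) z = a \<bullet> X z + g z * divergence X z"
proof -
  have "((\<lambda>z. g z *\<^sub>R X z) has_derivative (\<lambda>h. g z *\<^sub>R X' h + (h \<bullet> a) *\<^sub>R X z)) (at z)"
    using has_derivative_scaleR[OF assms(1)[unfolded gderiv_def] assms(2)] .
  then have "divergence (\<lambda>z. g z *\<^sub>R X z) z = (\<Sum>b\<in>Basis. (g z *\<^sub>R X' b + (b \<bullet> a) *\<^sub>R X z) \<bullet> b)"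
    by (rule divergence_eq)
  also have "\<dots> = g z * (\<Sum>b\<in>Basis. X' b \<bullet> b) + (\<Sum>b\<in>Basis. (a \<bullet> b) * (X z \<bullet> b))"
    by (simp add: inner_add_left sum.distrib sum_distrib_left inner_commute[of a])
  also have "(\<Sum>b\<in>Basis. (a \<bullet> b) * (X z \<bullet> b)) = a \<bullet> X z" by (rule euclidean_inner[symmetric])
  finally show ?thesis by (simp add: divergence_eq[OF assms(2)])
qed

lemma divergence_add:
  assumes "(X has_derivative X') (at z)" "(Y has_derivative Y') (at z)"
  shows "divergence (\<lambda>z. X z + Y z) z = divergence X z + divergence Y z"
  using has_derivative_add[OF assms]
  by (simp add: divergence_eq[OF assms(1)] divergence_eq[OF assms(2)] divergence_eq inner_add_left sum.distrib)

text \<open>The Minkowski metric diag(-1, 1, ..., 1) as a linear map. Applied to a Euclidean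
  gradient it gives the Lorentzian gradient, whose ordinary divergence is the wave operator;
  \<open>z \<bullet> time_reflection z\<close> is the Lorentzian square, positive on spacelike
  vectors.\<close>

definition time_reflection :: "real \<times> 'b::euclidean_space \<Rightarrow> real \<times> 'b" where
  "time_reflection z = (- fst z, snd z)"

lemma bounded_linear_time_reflection: "bounded_linear time_reflection"
  unfolding time_reflection_def
  by (intro bounded_linear_Pair bounded_linear_minus bounded_linear_fst bounded_linear_snd)

lemma time_reflection_simps [simp]:
  "time_reflection (time_reflection z) = z" "norm (time_reflection z) = norm z"
  "time_reflection z \<bullet> time_reflection w = z \<bullet> w"
  by (auto simp: time_reflection_def norm_Pair inner_prod_def norm_prod_def)

lemma inner_time_reflection: "time_reflection z \<bullet> w = z \<bullet> time_reflection w"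
  by (simp add: time_reflection_def inner_prod_def)

section \<open>Divergence identities for solutions of the wave equation\<close>

abbreviation quadrance :: "real \<times> 'b::euclidean_space \<Rightarrow> real" where
  "quadrance z \<equiv> z \<bullet> time_reflection z"

lemma abs_inner_time_reflection_le: "\<bar>z \<bullet> time_reflection w\<bar> \<le> norm z * norm w"
  using Cauchy_Schwarz_ineq2[of z "time_reflection w"] by simp

lemma divergence_diff_const:
  "divergence (\<lambda>z::'a::euclidean_space. z - c) z = real DIM('a)"
proof -
  have "((\<lambda>z::'a. z - c) has_derivative (\<lambda>h. h)) (at z)" by (auto intro!: derivative_eq_intros)
  from divergence_eq[OF this] show ?thesis by simp
qed

lemma sum_Basis_prod:
  fixes g :: "'a::euclidean_space \<times> 'b::euclidean_space \<Rightarrow> 'c::comm_monoid_add"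
  shows "(\<Sum>b\<in>Basis. g b) = (\<Sum>i\<in>Basis. g (i, 0)) + (\<Sum>i\<in>Basis. g (0, i))"
proof -
  have "inj_on (\<lambda>u. (u::'a, 0::'b)) Basis" "inj_on (\<lambda>u. (0::'a, u::'b)) Basis"
    by (auto intro!: inj_onI)
  then show ?thesis
    unfolding Basis_prod_def by (subst sum.union_disjoint) (auto simp: sum.reindex)
qed

lemma GDERIV_quadrance: "GDERIV (\<lambda>z. quadrance (z - c)) z :> 2 *\<^sub>R time_reflection (z - c)"
proof -
  interpret bounded_linear time_reflection by (rule bounded_linear_time_reflection)
  have "((\<lambda>z. quadrance (z - c)) has_derivative (\<lambda>h. (z - c) \<bullet> time_reflection h + h \<bullet> time_reflection (z - c))) (at z)"
    by (auto intro!: derivative_eq_intros has_derivative)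
  then show ?thesis
    unfolding gderiv_def
    by (rule has_derivative_eq_rhs) (auto simp: fun_eq_iff inner_time_reflection inner_commute[of "z - c"])
qed

text \<open>The equation in terms of a gradient \<open>D\<close> and Hessian \<open>D2\<close>, over
  an arbitrary open set. Arbitrary \<open>S\<close> matters because the estimate is proved on a
  fixed bounded piece of the cone and applied there to rescaled solutions.\<close>

locale wave_solution =
  fixes S :: "(real \<times> 'b::euclidean_space) set" and \<phi> V :: "real \<times> 'b \<Rightarrow> real"
    and D DV :: "real \<times> 'b \<Rightarrow> real \<times> 'b" and D2 :: "real \<times> 'b \<Rightarrow> real \<times> 'b \<Rightarrow> real \<times> 'b" and p :: real
  assumes open_S: "open S"
    and \<phi>_deriv: "z \<in> S \<Longrightarrow> GDERIV \<phi> z :> D z"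
    and D_deriv: "z \<in> S \<Longrightarrow> (D has_derivative D2 z) (at z)"
    and D2_cont: "continuous_on S (\<lambda>z. D2 z h)"
    and V_deriv: "z \<in> S \<Longrightarrow> GDERIV V z :> DV z"
    and DV_cont: "continuous_on S DV"
    and V_pos: "z \<in> S \<Longrightarrow> 0 < V z"
    and p: "p > 1"
    and wave_eq: "z \<in> S \<Longrightarrow> (\<Sum>b\<in>Basis. time_reflection (D2 z b) \<bullet> b) + V z * (\<bar>\<phi> z\<bar> powr (p - 1) * \<phi> z) = 0"
begin

text \<open>\<open>F\<close> is the primitive of the nonlinearity, \<open>Q\<close> the Lorentzian
  square of the gradient (the Lagrangian density up to a factor), and \<open>N\<close> the Euclidean
  energy density at unit scale.\<close>

definition "F z = \<bar>\<phi> z\<bar> powr (p + 1) / (p + 1)"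
definition "Q z = quadrance (D z)"
definition "N z = (norm (D z))\<^sup>2 + (\<phi> z)\<^sup>2"

lemma D_C1: "C1_on S D"
  by (rule C1_onI[OF D_deriv D2_cont])

lemma D_cont: "continuous_on S D"
  by (rule C1_on_continuous[OF D_C1])

lemma RD_C1: "C1_on S (\<lambda>z. time_reflection (D z))"
  by (rule bounded_linear.C1_on_compose[OF bounded_linear_time_reflection D_C1])

lemma \<phi>_C1: "C1_on S \<phi>"
  by (rule C1_onI[OF \<phi>_deriv[unfolded gderiv_def]]) (auto intro!: continuous_intros D_cont)

lemma V_C1: "C1_on S V"
  by (rule C1_onI[OF V_deriv[unfolded gderiv_def]]) (auto intro!: continuous_intros DV_cont)

lemma F_C1: "C1_on S F"
  unfolding F_def using p
  by (intro C1_on_compose_real[OF \<phi>_C1 has_real_derivative_abs_powr, of UNIV])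
     (auto intro: continuous_on_abs_powr_mult)

lemma Q_C1: "C1_on S Q"
  unfolding Q_def by (intro C1_on_inner D_C1 RD_C1)

lemma N_cont: "continuous_on S N"
  unfolding N_def by (intro continuous_intros D_cont C1_on_continuous[OF \<phi>_C1])

lemma F_deriv: "z \<in> S \<Longrightarrow> GDERIV F z :> (\<bar>\<phi> z\<bar> powr (p - 1) * \<phi> z) *\<^sub>R D z"
  unfolding F_def using GDERIV_DERIV_compose[OF \<phi>_deriv has_real_derivative_abs_powr] p by simp

lemma F_nonneg: "0 \<le> F z"
  using p by (simp add: F_def)

lemma power_nonlinearity: "\<bar>\<phi> z\<bar> powr (p - 1) * \<phi> z * \<phi> z = (p + 1) * F z"
proof -
  have "\<bar>\<phi> z\<bar> powr (p + 1) = \<bar>\<phi> z\<bar> powr (p - 1) * (\<bar>\<phi> z\<bar> powr 2)"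
    unfolding powr_add[symmetric] by (simp add: add.commute)
  also have "\<dots> = \<bar>\<phi> z\<bar> powr (p - 1) * \<phi> z * \<phi> z"
    by (cases "\<phi> z = 0") (simp_all add: power2_eq_square)
  finally show ?thesis using p by (simp add: F_def)
qed

lemma Q_le: "\<bar>Q z\<bar> \<le> N z"
  using abs_inner_time_reflection_le[of "D z" "D z"] by (simp add: Q_def N_def power2_eq_square add_increasing2)

lemma D2_symmetric: "z \<in> S \<Longrightarrow> D2 z h \<bullet> l = h \<bullet> D2 z l"
  by (rule second_derivative_symmetric[OF open_S _ _ D_deriv, of z \<phi>])
     (use \<phi>_deriv in \<open>auto simp: gderiv_def inner_commute\<close>)

lemma RD_deriv: "z \<in> S \<Longrightarrow> ((\<lambda>z. time_reflection (D z)) has_derivative (\<lambda>h. time_reflection (D2 z h))) (at z)"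
  by (intro bounded_linear.has_derivative[OF bounded_linear_time_reflection] D_deriv)

lemma divergence_RD: "z \<in> S \<Longrightarrow> divergence (\<lambda>z. time_reflection (D z)) z = - (V z * (\<bar>\<phi> z\<bar> powr (p - 1) * \<phi> z))"
  using wave_eq[of z] by (simp add: divergence_eq[OF RD_deriv])

lemma Q_deriv: "z \<in> S \<Longrightarrow> GDERIV Q z :> 2 *\<^sub>R D2 z (time_reflection (D z))"
proof -
  assume z: "z \<in> S"
  have "(Q has_derivative (\<lambda>h. D z \<bullet> time_reflection (D2 z h) + D2 z h \<bullet> time_reflection (D z))) (at z)"
    unfolding Q_def[abs_def] by (intro has_derivative_inner D_deriv RD_deriv z)
  then show ?thesis
    unfolding gderiv_def
    by (rule has_derivative_eq_rhs)
       (auto simp: fun_eq_iff D2_symmetric[OF z] inner_commute[of "D z"] inner_time_reflection)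
qed

text \<open>The equation multiplied by \<zeta> \<phi>. As |Q| is at most \<open>N\<close>, the
  integrated identity bounds the potential energy \<open>V z * F z\<close> linearly by the energy on
  the support of \<zeta>, which the cutoff errors require.\<close>

lemma divergence_virial:
  assumes z: "z \<in> S" and a: "GDERIV \<zeta> z :> a"
  shows "divergence (\<lambda>z. (\<zeta> z * \<phi> z) *\<^sub>R time_reflection (D z)) z
    = \<phi> z * (a \<bullet> time_reflection (D z)) + \<zeta> z * (Q z - (p + 1) * (V z * F z))"
proof -
  have "divergence (\<lambda>z. (\<zeta> z * \<phi> z) *\<^sub>R time_reflection (D z)) z
      = \<zeta> z * Q z + \<phi> z * (a \<bullet> time_reflection (D z))
        - \<zeta> z * \<phi> z * (V z * (\<bar>\<phi> z\<bar> powr (p - 1) * \<phi> z))"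
    by (subst divergence_scaleR[OF GDERIV_mult[OF a \<phi>_deriv[OF z]] RD_deriv[OF z]])
       (simp add: divergence_RD[OF z] inner_add_left Q_def)
  also have "\<zeta> z * \<phi> z * (V z * (\<bar>\<phi> z\<bar> powr (p - 1) * \<phi> z)) = \<zeta> z * (V z * (\<bar>\<phi> z\<bar> powr (p - 1) * \<phi> z * \<phi> z))"
    by simp
  finally show ?thesis unfolding power_nonlinearity by (simp add: algebra_simps)
qed

end

section \<open>Weighted currents attached to a centre \<open>P\<close>\<close>

locale weighted_wave_solution = wave_solution S \<phi> V D DV D2 p
  for S :: "(real \<times> 'b::euclidean_space) set" and \<phi> V D DV D2 p +
  fixes P :: "real \<times> 'b" and k \<epsilon> r0 :: real and W G H :: "real \<Rightarrow> real"
  assumes k: "k > 0"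
    and W_deriv: "r > 0 \<Longrightarrow> (W has_real_derivative G r) (at r)"
    and G_deriv: "r > 0 \<Longrightarrow> (G has_real_derivative H r) (at r)"
    and H_cont: "continuous_on {0<..} H"
    and r0: "r0 > 0" "0 < r \<Longrightarrow> r < r0 \<Longrightarrow> W r = 0" "0 < r \<Longrightarrow> r < r0 \<Longrightarrow> G r = 0"
    and W_nonneg: "r > 0 \<Longrightarrow> 0 \<le> W r" and W_le: "r > 0 \<Longrightarrow> W r \<le> r powr k"
    and G_nonneg: "r > 0 \<Longrightarrow> 0 \<le> G r" and GH: "r > 0 \<Longrightarrow> 0 \<le> (1 - k) * G r + r * H r"
    and GW: "r > 0 \<Longrightarrow> 0 \<le> r * G r - k * W r" "r > 0 \<Longrightarrow> r * G r - k * W r \<le> 3 * k * \<epsilon>"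
begin

text \<open>\<open>SF\<close> is the derivative of \<phi> along the scaling field z - P. The part of
  \<open>J\<close> with W(f), apart from the term with \<open>c\<close>, is the stress-energy tensor
  contracted with that field. The term c W \<phi> in \<open>A\<close> makes the multiplier
  \<open>SF z + c * \<phi> z\<close>, and the term c G \<phi>^2 in \<open>B\<close> is the
  correction that completes the square. Everything is restricted to f > 0, where the weight is
  defined and smooth enough.\<close>

definition "f z = quadrance (z - P)"
definition "S' = {z \<in> S. f z > 0}"
definition "c = (real DIM('b) - 1) / 2 + k"
definition "SF z = D z \<bullet> (z - P)"
definition "A z = W (f z) * SF z + c * W (f z) * \<phi> z"
definition "B z = W (f z) * (V z * F z) - W (f z) * Q z / 2 + c * G (f z) * (\<phi> z)\<^sup>2"
definition "J z = A z *\<^sub>R time_reflection (D z) + B z *\<^sub>R (z - P)"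

lemma f_cont: "continuous_on T f"
  unfolding f_def
  by (intro continuous_intros bounded_linear.continuous_on[OF bounded_linear_time_reflection])

lemma open_S': "open S'"
proof -
  have "S' = S \<inter> f -` {0<..}" by (auto simp: S'_def)
  then show ?thesis using open_S f_cont by (simp add: continuous_on_open_vimage open_Int open_vimage)
qed

lemma f_deriv: "GDERIV f z :> 2 *\<^sub>R time_reflection (z - P)"
  unfolding f_def by (rule GDERIV_quadrance)

lemma minus_P_C1: "C1_on T (\<lambda>z. z - P)"
  by (intro C1_on_diff C1_on_linear C1_on_const bounded_linear_ident)

lemma f_C1: "C1_on T f"
  unfolding f_def
  by (intro C1_on_inner minus_P_C1 bounded_linear.C1_on_compose[OF bounded_linear_time_reflection])

lemma Wf_C1: "C1_on S' (\<lambda>z. W (f z))"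
  by (rule C1_on_compose_real[OF f_C1 W_deriv, where T = "{0<..}"])
     (auto simp: S'_def intro!: DERIV_continuous_on[of _ _ H] has_field_derivative_at_within G_deriv)

lemma Gf_C1: "C1_on S' (\<lambda>z. G (f z))"
  by (rule C1_on_compose_real[OF f_C1 G_deriv, where T = "{0<..}"]) (auto simp: S'_def H_cont)

lemma S'_S: "S' \<subseteq> S" "z \<in> S' \<Longrightarrow> z \<in> S" "z \<in> S' \<Longrightarrow> f z > 0"
  by (auto simp: S'_def)

lemmas C1_S' = C1_on_subset[OF _ S'_S(1)]

lemma SF_C1: "C1_on S SF"
  unfolding SF_def by (intro C1_on_inner D_C1 minus_P_C1)

lemma A_C1: "C1_on S' A"
  unfolding A_def
  by (intro C1_on_add C1_on_mult C1_on_const Wf_C1 SF_C1[THEN C1_S'] \<phi>_C1[THEN C1_S'])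

lemma B_C1: "C1_on S' B"
  unfolding B_def divide_inverse power2_eq_square
  by (intro C1_on_add C1_on_diff C1_on_mult C1_on_const Wf_C1 Gf_C1 V_C1[THEN C1_S'] F_C1[THEN C1_S']
      Q_C1[THEN C1_S'] \<phi>_C1[THEN C1_S'])

lemma J_C1: "C1_on S' J"
  unfolding J_def by (intro C1_on_add C1_on_scaleR A_C1 B_C1 RD_C1[THEN C1_S'] minus_P_C1)

lemma Wf_deriv: "z \<in> S' \<Longrightarrow> GDERIV (\<lambda>z. W (f z)) z :> G (f z) *\<^sub>R (2 *\<^sub>R time_reflection (z - P))"
  by (rule GDERIV_DERIV_compose[OF f_deriv W_deriv]) (simp add: S'_S)

lemma Gf_deriv: "z \<in> S' \<Longrightarrow> GDERIV (\<lambda>z. G (f z)) z :> H (f z) *\<^sub>R (2 *\<^sub>R time_reflection (z - P))"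
  by (rule GDERIV_DERIV_compose[OF f_deriv G_deriv]) (simp add: S'_S)

lemma SF_deriv: "z \<in> S \<Longrightarrow> GDERIV SF z :> D2 z (z - P) + D z"
proof -
  assume z: "z \<in> S"
  have "(SF has_derivative (\<lambda>h. D z \<bullet> h + D2 z h \<bullet> (z - P))) (at z)"
    unfolding SF_def[abs_def] by (rule derivative_eq_intros D_deriv z refl)+ simp
  then show ?thesis
    unfolding gderiv_def
    by (rule has_derivative_eq_rhs) (auto simp: fun_eq_iff D2_symmetric[OF z] inner_add_right inner_commute)
qed

lemma minus_P_deriv: "((\<lambda>z. z - P) has_derivative (\<lambda>h. h)) (at z)"
  by (auto intro!: derivative_eq_intros)

lemma divergence_minus_P: "divergence (\<lambda>z. z - P) z = real DIM('b) + 1"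
  by (simp add: divergence_diff_const)

lemma power2_deriv: "GDERIV g z :> a \<Longrightarrow> GDERIV (\<lambda>z. (g z)\<^sup>2) z :> (2 * g z) *\<^sub>R a"
  by (erule GDERIV_DERIV_compose[where g = "\<lambda>y. y\<^sup>2"]) (auto intro!: derivative_eq_intros)

text \<open>Writing the trace of the scaling field as 2 c - 2 k + 2 and \<open>SF\<close> as (SF + c
  \<phi>) - c \<phi> leaves 2 W \<phi>^2 with a positive sign; the square already controlled then
  bounds the mixed term.\<close>

lemma divergence_hardy:
  assumes z: "z \<in> S'" and a: "GDERIV \<eta> z :> a"
  shows "divergence (\<lambda>z. (\<eta> z * (W (f z) * (\<phi> z)\<^sup>2)) *\<^sub>R (z - P)) z
    = W (f z) * (\<phi> z)\<^sup>2 * (a \<bullet> (z - P)) + \<eta> z * (2 * (f z * G (f z) - k * W (f z)) * (\<phi> z)\<^sup>2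
       + 2 * W (f z) * (\<phi> z)\<^sup>2 + 2 * W (f z) * \<phi> z * (SF z + c * \<phi> z))"
proof -
  note z' = S'_S(2)[OF z]
  note d = GDERIV_mult[OF a GDERIV_mult[OF Wf_deriv[OF z] power2_deriv[OF \<phi>_deriv[OF z']]]]
  define s where "s = z - P"
  have ff: "time_reflection s \<bullet> s = f z" by (simp add: f_def s_def inner_time_reflection)
  have n: "real DIM('b) = 2 * c - 2 * k + 1" by (simp add: c_def field_simps)
  show ?thesis
    unfolding divergence_scaleR[OF d minus_P_deriv] divergence_minus_P SF_def s_def[symmetric]
    by (simp add: inner_add_left ff n power2_eq_square algebra_simps)
qed

text \<open>Along the spatial field the derivative of \<open>f\<close> is 2 |x - x_P|^2, which is
  positive on the light cone away from P, whereas along z - P it is 2 f and degenerates there. This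
  is how G \<phi>^2 appears with a coefficient bounded below.\<close>

lemma divergence_radial:
  assumes z: "z \<in> S'" and a: "GDERIV \<zeta> z :> a"
  shows "divergence (\<lambda>z. (\<zeta> z * (W (f z) * (\<phi> z)\<^sup>2)) *\<^sub>R (0, snd (z - P))) z
    = W (f z) * (\<phi> z)\<^sup>2 * (a \<bullet> (0, snd (z - P))) + \<zeta> z * (2 * (norm (snd (z - P)))\<^sup>2 * G (f z) * (\<phi> z)\<^sup>2
       + 2 * W (f z) * \<phi> z * (D z \<bullet> (0, snd (z - P))) + real DIM('b) * W (f z) * (\<phi> z)\<^sup>2)"
proof -
  note z' = S'_S(2)[OF z]
  note d = GDERIV_mult[OF a GDERIV_mult[OF Wf_deriv[OF z] power2_deriv[OF \<phi>_deriv[OF z']]]]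
  define s where "s = (0::real, snd (z - P))"
  have Y: "((\<lambda>z. (0, snd (z - P))) has_derivative (\<lambda>h. (0, snd h))) (at z)"
    by (auto intro!: derivative_eq_intros)
  have divY: "divergence (\<lambda>z. (0::real, snd (z - P))) z = real DIM('b)"
    unfolding divergence_eq[OF Y] by (simp add: sum_Basis_prod)
  have ff: "time_reflection (z - P) \<bullet> s = (norm (snd (z - P)))\<^sup>2"
    by (simp add: s_def time_reflection_def inner_prod_def power2_norm_eq_inner)
  show ?thesis
    unfolding divergence_scaleR[OF d Y] divY s_def[symmetric]
    by (simp only: inner_add_left inner_scaleR_left ff) (simp add: power2_eq_square algebra_simps)
qed

text \<open>Second derivatives of \<phi> cancel between the two parts of \<open>J\<close>, and so do
  the first derivatives of \<open>F\<close>. The first and third terms vanish for the pure power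
  f^k; the truncated weight was designed so that they stay small and nonnegative,
  respectively.\<close>

lemma divergence_J:
  assumes z: "z \<in> S'"
  shows "divergence J z = - (f z * G (f z) - k * W (f z)) * Q z
      + 2 * G (f z) * (SF z + c * \<phi> z)\<^sup>2
      + 2 * c * ((1 - k) * G (f z) + f z * H (f z)) * (\<phi> z)\<^sup>2
      + V z * F z * (((real DIM('b) + 1) - (p + 1) * c) * W (f z) + 2 * f z * G (f z))
      + W (f z) * F z * (DV z \<bullet> (z - P))"
proof -
  note z' = S'_S(2)[OF z]
  define w g h where "w = W (f z)" and "g = G (f z)" and "h = H (f z)"
  define s where "s = z - P"
  define d where "d = D z"
  define nl where "nl = \<bar>\<phi> z\<bar> powr (p - 1) * \<phi> z"
  define b where "b = D2 z s \<bullet> time_reflection d"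
  have dA: "GDERIV A z :> w *\<^sub>R (D2 z s + d) + SF z *\<^sub>R (g *\<^sub>R (2 *\<^sub>R time_reflection s))
      + ((c * w) *\<^sub>R d + \<phi> z *\<^sub>R (c *\<^sub>R (g *\<^sub>R (2 *\<^sub>R time_reflection s))))"
    unfolding A_def[abs_def] w_def g_def s_def d_def
    by (rule GDERIV_subst[OF GDERIV_add[OF GDERIV_mult[OF Wf_deriv[OF z] SF_deriv[OF z']]
        GDERIV_mult[OF GDERIV_mult[OF GDERIV_const[of c] Wf_deriv[OF z]] \<phi>_deriv[OF z']]]]) simp
  have dB: "GDERIV B z :> (w *\<^sub>R (V z *\<^sub>R (nl *\<^sub>R d) + F z *\<^sub>R DV z) + (V z * F z) *\<^sub>R (g *\<^sub>R (2 *\<^sub>R time_reflection s)))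
     - (1/2) *\<^sub>R (w *\<^sub>R (2 *\<^sub>R D2 z (time_reflection d)) + Q z *\<^sub>R (g *\<^sub>R (2 *\<^sub>R time_reflection s)))
     + c *\<^sub>R (g *\<^sub>R ((2 * \<phi> z) *\<^sub>R d) + (\<phi> z)\<^sup>2 *\<^sub>R (h *\<^sub>R (2 *\<^sub>R time_reflection s)))"
  proof -
    have "B = (\<lambda>z. W (f z) * (V z * F z) - 1/2 * (W (f z) * Q z) + c * (G (f z) * (\<phi> z)\<^sup>2))"
      by (simp add: B_def fun_eq_iff)
    then show ?thesis
      unfolding w_def g_def h_def s_def d_def nl_def
      by (simp only:, intro GDERIV_subst[OF GDERIV_add[OF GDERIV_diff[OF
            GDERIV_mult[OF Wf_deriv[OF z] GDERIV_mult[OF V_deriv[OF z'] F_deriv[OF z']]]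
            GDERIV_mult[OF GDERIV_const[of "1/2"] GDERIV_mult[OF Wf_deriv[OF z] Q_deriv[OF z']]]]
          GDERIV_mult[OF GDERIV_const[of c] GDERIV_mult[OF Gf_deriv[OF z] power2_deriv[OF \<phi>_deriv[OF z']]]]]])
        (simp only: scaleR_zero_right add_0_right)
  qed
  obtain X1 where X1: "((\<lambda>z. A z *\<^sub>R time_reflection (D z)) has_derivative X1) (at z)"
    using has_derivative_scaleR[OF dA[unfolded gderiv_def] RD_deriv[OF z']] by blast
  obtain X2 where X2: "((\<lambda>z. B z *\<^sub>R (z - P)) has_derivative X2) (at z)"
    using has_derivative_scaleR[OF dB[unfolded gderiv_def] minus_P_deriv] by blast
  \<comment> \<open>The value of \<open>c\<close> acts here twice: the coefficient of
    \<open>Q\<close> collapses to k W - f G, and the trace times c G \<phi>^2 splits off exactly the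
    2 c^2 G \<phi>^2 that completes the square.\<close>
  have n: "real DIM('b) = 2 * c - 2 * k + 1" by (simp add: c_def field_simps)
  have ff: "time_reflection s \<bullet> s = f z" "d \<bullet> s = SF z" "s \<bullet> d = SF z" "d \<bullet> time_reflection d = Q z"
    "time_reflection s \<bullet> time_reflection d = SF z"
    by (simp_all add: f_def inner_time_reflection s_def d_def SF_def Q_def inner_commute)
  have bb: "D2 z (time_reflection d) \<bullet> s = b"
    using D2_symmetric[OF z', of "time_reflection d" s] by (simp add: b_def inner_commute)
  have "divergence J z = divergence (\<lambda>z. A z *\<^sub>R time_reflection (D z)) z + divergence (\<lambda>z. B z *\<^sub>R (z - P)) z"
    unfolding J_def[abs_def] by (rule divergence_add[OF X1 X2])
  also have "divergence (\<lambda>z. A z *\<^sub>R time_reflection (D z)) z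
     = w * (b + Q z) + SF z * (g * (2 * SF z)) + (c * w * Q z + \<phi> z * (c * (g * (2 * SF z))))
       - (w * SF z + c * w * \<phi> z) * (V z * nl)"
    by (subst divergence_scaleR[OF dA RD_deriv[OF z']])
       (simp add: divergence_RD[OF z'] inner_add_left ff A_def d_def[symmetric] w_def[symmetric] nl_def[symmetric] b_def[symmetric])
  also have "divergence (\<lambda>z. B z *\<^sub>R (z - P)) z
     = w * (V z * (nl * SF z) + F z * (DV z \<bullet> s)) + V z * F z * (g * (2 * f z))
       - (w * (2 * b) + Q z * (g * (2 * f z))) / 2 + c * (g * (2 * \<phi> z * SF z) + (\<phi> z)\<^sup>2 * (h * (2 * f z)))
       + (w * (V z * F z) - w * Q z / 2 + c * g * (\<phi> z)\<^sup>2) * (real DIM('b) + 1)"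
    by (subst divergence_scaleR[OF dB minus_P_deriv])
       (simp add: divergence_minus_P inner_add_left inner_diff_left ff bb B_def mult.assoc s_def[symmetric] w_def[symmetric] g_def[symmetric] h_def[symmetric])
  also have "(w * SF z + c * w * \<phi> z) * (V z * nl) = w * SF z * (V z * nl) + c * w * V z * (nl * \<phi> z)"
    by (simp add: algebra_simps)
  also have "nl * \<phi> z = (p + 1) * F z" by (simp add: nl_def power_nonlinearity)
  finally show ?thesis
    unfolding w_def[symmetric] g_def[symmetric] h_def[symmetric] s_def[symmetric]
    unfolding n by (simp add: algebra_simps add_divide_distrib power2_eq_square)
qed

lemma divergence_cutoff_J:
  assumes z: "z \<in> S'" and a: "GDERIV \<eta> z :> a"
  shows "divergence (\<lambda>z. \<eta> z *\<^sub>R J z) z = a \<bullet> J z + \<eta> z * divergence J z"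
proof -
  obtain J' where "\<And>z. z \<in> S' \<Longrightarrow> (J has_derivative J' z) (at z)" by (rule C1_onE[OF J_C1]) metis
  from divergence_scaleR[OF a this[OF z]] show ?thesis .
qed

end

section \<open>The Carleman estimate\<close>

text \<open>The cutoff \<eta> selects the interior and \<zeta> the annulus; on f > 0, \<zeta> is 1
  wherever the gradient of \<eta> is nonzero. A single \<open>M\<close> bounds the distances to
  \<open>P\<close> on both supports and the cutoff gradients there. The factor in
  \<open>DV_small\<close> is the least coefficient of W V F in the divergence of \<open>J\<close>,
  obtained from f G \<ge> k W; the hypothesis says that the variation of \<open>V\<close> does not
  outweigh it.\<close>

locale carleman = weighted_wave_solution S \<phi> V D DV D2 p P k \<epsilon> r0 W G H
  for S :: "(real \<times> 'b::euclidean_space) set" and \<phi> V D DV D2 p P k \<epsilon> r0 W G H +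
  fixes \<eta> \<zeta> :: "real \<times> 'b \<Rightarrow> real" and D\<eta> D\<zeta> :: "real \<times> 'b \<Rightarrow> real \<times> 'b"
    and K\<eta> K\<zeta> :: "(real \<times> 'b) set" and M \<rho> :: real
  assumes W_ge: "r > 0 \<Longrightarrow> 2 * \<epsilon> \<le> r powr k \<Longrightarrow> r powr k / 8 \<le> W r" and eps: "\<epsilon> > 0"
    and \<eta>_deriv: "GDERIV \<eta> z :> D\<eta> z" and D\<eta>_cont: "continuous_on UNIV D\<eta>"
    and \<eta>_range: "0 \<le> \<eta> z" "\<eta> z \<le> 1" and K\<eta>: "compact K\<eta>" "K\<eta> \<subseteq> S" "z \<notin> K\<eta> \<Longrightarrow> \<eta> z = 0"
    and \<zeta>_deriv: "GDERIV \<zeta> z :> D\<zeta> z" and D\<zeta>_cont: "continuous_on UNIV D\<zeta>"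
    and \<zeta>_range: "0 \<le> \<zeta> z" "\<zeta> z \<le> 1" and K\<zeta>: "compact K\<zeta>" "K\<zeta> \<subseteq> S" "z \<notin> K\<zeta> \<Longrightarrow> \<zeta> z = 0"
    and \<zeta>_eq_1: "z \<in> S' \<Longrightarrow> D\<eta> z \<noteq> 0 \<Longrightarrow> \<zeta> z = 1"
    and M: "z \<in> K\<eta> \<union> K\<zeta> \<Longrightarrow> norm (z - P) \<le> M" "norm (D\<eta> z) \<le> M" "norm (D\<zeta> z) \<le> M" "M \<ge> 1"
    and \<rho>: "z \<in> K\<zeta> \<Longrightarrow> z \<in> S' \<Longrightarrow> \<rho> \<le> (norm (snd (z - P)))\<^sup>2" "\<rho> > 0"
    and DV_small: "z \<in> K\<eta> \<Longrightarrow> \<bar>DV z \<bullet> (z - P)\<bar> \<le> (real DIM('b) + 1 - (p + 1) * c + 2 * k) * V z"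
begin

text \<open>
  The weight \<open>G (f z)\<close> is singular at the light cone as \<open>\<epsilon> \<rightarrow> 0\<close>, so the cutoff term \<open>G (f z) (\<phi> z)\<^sup>2\<close> is not
  bounded by the energy pointwise; the field \<open>X_radial\<close>, transversal to the light cone, controls it after integration.
\<close>

abbreviation "X_main \<equiv> \<lambda>z. \<eta> z *\<^sub>R J z"
abbreviation "X_hardy \<equiv> \<lambda>z. (\<eta> z * (W (f z) * (\<phi> z)\<^sup>2)) *\<^sub>R (z - P)"
abbreviation "X_radial \<equiv> \<lambda>z. (\<zeta> z * (W (f z) * (\<phi> z)\<^sup>2)) *\<^sub>R (0 :: real, snd (z - P))"
abbreviation "X_virial \<equiv> \<lambda>z. (\<zeta> z * \<phi> z) *\<^sub>R time_reflection (D z)"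

section \<open>Pointwise bounds for the four divergences\<close>

lemma c_nonneg: "c \<ge> 0"
proof -
  have "1 \<le> real DIM('b)" using of_nat_mono[OF DIM_ge_Suc0, where 'a = real] by simp
  then show ?thesis using k unfolding c_def by (intro add_nonneg_nonneg divide_nonneg_pos) auto
qed

text \<open>\<open>w\<close> bounds the weight on the supports. The multipliers are matched to the
  errors: c2 times 2 \<rho> is the coefficient M^2 c of G \<phi>^2, and c3 times p + 1 the
  coefficient M^2 w of V F, in the bound for \<open>J\<close>; c4 is such that c4 W \<le> G.
  \<open>C0\<close> collects the coefficients of \<open>N\<close>. None of them involves
  \<epsilon>.\<close>

definition "w = (M\<^sup>2) powr k"
definition "c2 = M\<^sup>2 * c / (2 * \<rho>)"
definition "c3 = M\<^sup>2 * w / (p + 1)"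
definition "c4 = k / M\<^sup>2"
definition "C0 = w * M * (M + c) + M\<^sup>2 * w / 2 + c4 * (w * M\<^sup>2)
  + c2 * (w * M\<^sup>2 + 2 * w * M + real DIM('b) * w) + c3 * (1 + M)"
text \<open>Below \<open>r0\<close> both the weight and its derivative vanish, so these compact
  parts of the supports carry the weighted fields while staying away from the light cone of
  \<open>P\<close>.\<close>

definition "K\<eta>' = {z \<in> K\<eta>. r0 \<le> f z}"
definition "K\<zeta>' = {z \<in> K\<zeta>. r0 \<le> f z}"

lemma constants_pos: "w > 0" "c2 \<ge> 0" "c3 \<ge> 0" "c4 > 0"
  using M(4) c_nonneg \<rho>(2) p k by (auto simp: w_def c2_def c3_def c4_def)

lemma compact_K': "compact K\<eta>'" "compact K\<zeta>'"
proof -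
  have "closed {z. r0 \<le> f z}" by (intro closed_Collect_le continuous_on_const f_cont)
  moreover have "K\<eta>' = K\<eta> \<inter> {z. r0 \<le> f z}" "K\<zeta>' = K\<zeta> \<inter> {z. r0 \<le> f z}"
    by (auto simp: K\<eta>'_def K\<zeta>'_def)
  ultimately show "compact K\<eta>'" "compact K\<zeta>'"
    using K\<eta>(1) K\<zeta>(1) by (simp_all add: compact_Int_closed)
qed

lemma K'_subset: "K\<eta>' \<subseteq> S'" "K\<zeta>' \<subseteq> S'"
  using K\<eta>(2) K\<zeta>(2) r0(1) by (auto simp: K\<eta>'_def K\<zeta>'_def S'_def)

lemma f_le: "norm (z - P) \<le> M \<Longrightarrow> f z \<le> M\<^sup>2"
  using abs_inner_time_reflection_le[of "z - P" "z - P"] M(4) mult_mono[of "norm (z - P)" M "norm (z - P)" M]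
  by (simp add: f_def power2_eq_square)

lemma W_le_w: "f z > 0 \<Longrightarrow> norm (z - P) \<le> M \<Longrightarrow> W (f z) \<le> w"
  unfolding w_def using order_trans[OF W_le powr_mono2[OF _ _ f_le]] k by simp

lemma product_le_N: "norm (D z) * \<bar>\<phi> z\<bar> \<le> N z" "(norm (D z))\<^sup>2 \<le> N z" "(\<phi> z)\<^sup>2 \<le> N z" "0 \<le> N z"
proof -
  have "2 * (norm (D z) * \<bar>\<phi> z\<bar>) \<le> N z"
    using sum_squares_bound[of "norm (D z)" "\<bar>\<phi> z\<bar>"] by (simp add: N_def mult.assoc)
  moreover have "0 \<le> norm (D z) * \<bar>\<phi> z\<bar>" by simp
  ultimately show "norm (D z) * \<bar>\<phi> z\<bar> \<le> N z" by linarith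
qed (auto simp: N_def)

text \<open>V F and G \<phi>^2 are kept apart from \<open>N\<close>, because neither is controlled
  by it pointwise; the virial and the radial field absorb them after integration.\<close>

lemma J_bound:
  assumes "z \<in> S'" "norm (z - P) \<le> M" "norm a \<le> M"
  shows "\<bar>a \<bullet> J z\<bar> \<le> (w * M * (M + c) + M\<^sup>2 * w / 2) * N z + M\<^sup>2 * w * (V z * F z) + M\<^sup>2 * c * (G (f z) * (\<phi> z)\<^sup>2)"
proof -
  note f0 = S'_S(3)[OF assms(1)]
  have W: "0 \<le> W (f z)" "W (f z) \<le> w" using W_nonneg[OF f0] W_le_w[OF f0 assms(2)] by auto
  have VF: "0 \<le> V z * F z" using F_nonneg V_pos[OF S'_S(2)[OF assms(1)]] by simp
  have "\<bar>SF z\<bar> \<le> norm (D z) * M"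
    unfolding SF_def using order_trans[OF Cauchy_Schwarz_ineq2 mult_left_mono[OF assms(2)]] by simp
  then have "\<bar>W (f z) * SF z\<bar> \<le> w * (norm (D z) * M)"
    unfolding abs_mult using W by (intro mult_mono) auto
  moreover have "\<bar>c * W (f z) * \<phi> z\<bar> \<le> c * w * \<bar>\<phi> z\<bar>"
    unfolding abs_mult using W c_nonneg by (intro mult_mono) auto
  ultimately have A: "\<bar>A z\<bar> \<le> w * (norm (D z) * M) + c * w * \<bar>\<phi> z\<bar>"
    unfolding A_def by linarith
  have "\<bar>a \<bullet> time_reflection (D z)\<bar> \<le> M * norm (D z)"
    using order_trans[OF abs_inner_time_reflection_le mult_right_mono[OF assms(3)]] by simp
  with A have "\<bar>A z * (a \<bullet> time_reflection (D z))\<bar> \<le> (w * (norm (D z) * M) + c * w * \<bar>\<phi> z\<bar>) * (M * norm (D z))"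
    unfolding abs_mult by (intro mult_mono) auto
  also have "\<dots> = w * M * M * (norm (D z))\<^sup>2 + w * M * c * (norm (D z) * \<bar>\<phi> z\<bar>)"
    by (simp add: algebra_simps power2_eq_square)
  also have "\<dots> \<le> w * M * M * N z + w * M * c * N z"
    using product_le_N[of z] constants_pos c_nonneg M(4) by (intro add_mono mult_left_mono) auto
  finally have 1: "\<bar>A z * (a \<bullet> time_reflection (D z))\<bar> \<le> w * M * (M + c) * N z" by (simp add: algebra_simps)
  have "\<bar>W (f z) * (V z * F z)\<bar> \<le> w * (V z * F z)"
    unfolding abs_mult using W VF F_nonneg V_pos[OF S'_S(2)[OF assms(1)]] by (intro mult_mono) auto
  moreover have "\<bar>W (f z) * Q z\<bar> \<le> w * N z"
    unfolding abs_mult using W Q_le by (intro mult_mono) auto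
  moreover have "\<bar>c * G (f z) * (\<phi> z)\<^sup>2\<bar> = c * (G (f z) * (\<phi> z)\<^sup>2)"
    using c_nonneg G_nonneg[OF f0] by simp
  ultimately have B: "\<bar>B z\<bar> \<le> w * (V z * F z) + w * N z / 2 + c * (G (f z) * (\<phi> z)\<^sup>2)"
    unfolding B_def by linarith
  have "\<bar>a \<bullet> (z - P)\<bar> \<le> M * M"
    using order_trans[OF Cauchy_Schwarz_ineq2 mult_mono[OF assms(3,2)]] M(4) by simp
  with B have "\<bar>B z * (a \<bullet> (z - P))\<bar> \<le> (w * (V z * F z) + w * N z / 2 + c * (G (f z) * (\<phi> z)\<^sup>2)) * (M * M)"
    unfolding abs_mult by (intro mult_mono) auto
  moreover have "a \<bullet> J z = A z * (a \<bullet> time_reflection (D z)) + B z * (a \<bullet> (z - P))"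
    by (simp add: J_def inner_add_right)
  ultimately show ?thesis using 1 by (simp add: algebra_simps power2_eq_square)
qed

text \<open>The term with H is nonnegative by convexity of the weight. The term with
  \<open>Q\<close> costs at most 3 k \<epsilon> N. The nonlinear terms together are nonnegative
  because f G \<ge> k W and the derivative of \<open>V\<close> is small.\<close>

lemma divergence_J_bound:
  assumes "z \<in> K\<eta>'"
  shows "divergence X_main z \<ge> D\<eta> z \<bullet> J z + \<eta> z * (2 * G (f z) * (SF z + c * \<phi> z)\<^sup>2) - 3 * k * \<epsilon> * N z"
proof -
  have z: "z \<in> S'" "z \<in> S" "z \<in> K\<eta>" using assms K'_subset S'_S by (auto simp: K\<eta>'_def)
  note f0 = S'_S(3)[OF z(1)]
  have FV: "0 \<le> F z" "0 \<le> V z" "0 \<le> V z * F z" using F_nonneg V_pos[OF z(2)] by auto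
  define \<kappa> where "\<kappa> = real DIM('b) + 1 - (p + 1) * c + 2 * k"
  have "0 \<le> c * ((1 - k) * G (f z) + f z * H (f z)) * (\<phi> z)\<^sup>2"
    using GH[OF f0] c_nonneg by simp
  moreover have "- (3 * k * \<epsilon> * N z) \<le> - (f z * G (f z) - k * W (f z)) * Q z"
  proof -
    have "\<bar>(f z * G (f z) - k * W (f z)) * Q z\<bar> \<le> (3 * k * \<epsilon>) * N z"
      unfolding abs_mult using GW[OF f0] Q_le[of z] k eps by (intro mult_mono) auto
    then show ?thesis by linarith
  qed
  moreover have "0 \<le> V z * F z * ((real DIM('b) + 1 - (p + 1) * c) * W (f z) + 2 * f z * G (f z)) + W (f z) * F z * (DV z \<bullet> (z - P))"
  proof -
    have "- (\<kappa> * V z) \<le> DV z \<bullet> (z - P)" using DV_small[OF z(3)] by (simp add: \<kappa>_def abs_le_iff)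
    then have "W (f z) * F z * (- (\<kappa> * V z)) \<le> W (f z) * F z * (DV z \<bullet> (z - P))"
      using FV W_nonneg[OF f0] by (intro mult_left_mono) auto
    moreover have "0 \<le> V z * F z * (2 * (f z * G (f z) - k * W (f z)))"
      using FV GW(1)[OF f0] by (intro mult_nonneg_nonneg) auto
    ultimately show ?thesis by (simp add: \<kappa>_def algebra_simps)
  qed
  ultimately have "divergence J z \<ge> 2 * G (f z) * (SF z + c * \<phi> z)\<^sup>2 - 3 * k * \<epsilon> * N z"
    unfolding divergence_J[OF z(1)] by linarith
  then have "\<eta> z * divergence J z \<ge> \<eta> z * (2 * G (f z) * (SF z + c * \<phi> z)\<^sup>2 - 3 * k * \<epsilon> * N z)"
    using \<eta>_range by (intro mult_left_mono) auto
  moreover have "\<eta> z * (3 * k * \<epsilon> * N z) \<le> 3 * k * \<epsilon> * N z"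
    using \<eta>_range product_le_N[of z] k eps by (intro mult_left_le_one_le) auto
  ultimately show ?thesis
    unfolding divergence_cutoff_J[OF z(1) \<eta>_deriv] by (simp add: algebra_simps)
qed

text \<open>With y = SF + c \<phi>, completing the square gives 2 W \<phi> y \<ge> - W \<phi>^2 - W
  y^2, so half of the term 2 W \<phi>^2 survives at the price of W y^2.\<close>

lemma divergence_hardy_bound:
  assumes "z \<in> K\<eta>'"
  shows "divergence X_hardy z
    \<ge> W (f z) * (\<phi> z)\<^sup>2 * (D\<eta> z \<bullet> (z - P)) + \<eta> z * (W (f z) * (\<phi> z)\<^sup>2) - \<eta> z * (W (f z) * (SF z + c * \<phi> z)\<^sup>2)"
proof -
  have z: "z \<in> S'" using assms K'_subset by auto
  note f0 = S'_S(3)[OF z]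
  have "0 \<le> W (f z) * (\<phi> z + (SF z + c * \<phi> z))\<^sup>2" using W_nonneg[OF f0] by simp
  then have "- (W (f z) * (\<phi> z)\<^sup>2) - W (f z) * (SF z + c * \<phi> z)\<^sup>2 \<le> 2 * W (f z) * \<phi> z * (SF z + c * \<phi> z)"
    by (simp add: power2_sum[of "\<phi> z"] algebra_simps)
  moreover have "0 \<le> (f z * G (f z) - k * W (f z)) * (\<phi> z)\<^sup>2" using GW[OF f0] by simp
  ultimately have "W (f z) * (\<phi> z)\<^sup>2 - W (f z) * (SF z + c * \<phi> z)\<^sup>2
      \<le> 2 * (f z * G (f z) - k * W (f z)) * (\<phi> z)\<^sup>2 + 2 * W (f z) * (\<phi> z)\<^sup>2 + 2 * W (f z) * \<phi> z * (SF z + c * \<phi> z)"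
    by linarith
  from mult_left_mono[OF this \<eta>_range(1)[of z]] show ?thesis
    unfolding divergence_hardy[OF z \<eta>_deriv] by (simp add: right_diff_distrib)
qed

text \<open>Only the leading term contains the singular factor \<open>G\<close>; the other terms
  contain W, which is at most \<open>w\<close>, and are bounded by the energy.\<close>

lemma divergence_radial_bound:
  assumes "z \<in> K\<zeta>'"
  shows "divergence X_radial z
    \<ge> 2 * \<rho> * (\<zeta> z * (G (f z) * (\<phi> z)\<^sup>2)) - (w * M\<^sup>2 + 2 * w * M + real DIM('b) * w) * N z"
proof -
  have z: "z \<in> S'" "z \<in> K\<zeta>" using assms K'_subset by (auto simp: K\<zeta>'_def)
  note f0 = S'_S(3)[OF z(1)]
  have sM: "norm (z - P) \<le> M" using M(1) z by simp
  have W: "0 \<le> W (f z)" "W (f z) \<le> w" using W_nonneg[OF f0] W_le_w[OF f0 sM] by auto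
  define Y where "Y = (0::real, snd (z - P))"
  have "norm Y \<le> norm (z - P)" by (simp add: Y_def norm_prod_def)
  then have Y: "norm Y \<le> M" using sM by simp
  have "\<bar>D\<zeta> z \<bullet> Y\<bar> \<le> M * M"
    using order_trans[OF Cauchy_Schwarz_ineq2 mult_mono[OF M(3) Y]] M(4) by simp
  then have "\<bar>W (f z) * (\<phi> z)\<^sup>2 * (D\<zeta> z \<bullet> Y)\<bar> \<le> w * N z * (M * M)"
    unfolding abs_mult using W product_le_N[of z] constants_pos by (intro mult_mono) auto
  then have 1: "W (f z) * (\<phi> z)\<^sup>2 * (D\<zeta> z \<bullet> Y) \<ge> - (w * N z * (M * M))" by linarith
  have "\<bar>\<phi> z * (D z \<bullet> Y)\<bar> \<le> \<bar>\<phi> z\<bar> * (norm (D z) * M)"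
    unfolding abs_mult
    using order_trans[OF Cauchy_Schwarz_ineq2 mult_left_mono[OF Y]] by (intro mult_left_mono) auto
  also have "\<dots> = (norm (D z) * \<bar>\<phi> z\<bar>) * M" by simp
  also have "\<dots> \<le> N z * M" using product_le_N(1)[of z] M(4) by (intro mult_right_mono) auto
  finally have "\<bar>2 * W (f z) * (\<phi> z * (D z \<bullet> Y))\<bar> \<le> 2 * w * (N z * M)"
    unfolding abs_mult[of "2 * W (f z)"] using W by (intro mult_mono) auto
  then have "2 * W (f z) * (\<phi> z * (D z \<bullet> Y)) \<ge> - (2 * w * (N z * M))" by linarith
  moreover have "0 \<le> real DIM('b) * W (f z) * (\<phi> z)\<^sup>2" using W by simp
  moreover have "2 * \<rho> * (G (f z) * (\<phi> z)\<^sup>2) \<le> 2 * (norm (snd (z - P)))\<^sup>2 * G (f z) * (\<phi> z)\<^sup>2"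
    using mult_right_mono[OF \<rho>(1)[OF z(2,1)], of "G (f z) * (\<phi> z)\<^sup>2"] G_nonneg[OF f0] by (simp add: mult.assoc)
  ultimately have "2 * \<rho> * (G (f z) * (\<phi> z)\<^sup>2) - 2 * w * (N z * M)
      \<le> 2 * (norm (snd (z - P)))\<^sup>2 * G (f z) * (\<phi> z)\<^sup>2 + 2 * W (f z) * \<phi> z * (D z \<bullet> Y) + real DIM('b) * W (f z) * (\<phi> z)\<^sup>2"
    by linarith
  from mult_left_mono[OF this \<zeta>_range(1)[of z]]
  have "\<zeta> z * (2 * \<rho> * (G (f z) * (\<phi> z)\<^sup>2)) - \<zeta> z * (2 * w * (N z * M))
      \<le> \<zeta> z * (2 * (norm (snd (z - P)))\<^sup>2 * G (f z) * (\<phi> z)\<^sup>2 + 2 * W (f z) * \<phi> z * (D z \<bullet> Y) + real DIM('b) * W (f z) * (\<phi> z)\<^sup>2)"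
    by (simp add: right_diff_distrib)
  moreover have "\<zeta> z * (2 * w * (N z * M)) \<le> 2 * w * (N z * M)"
    using \<zeta>_range product_le_N[of z] constants_pos M(4) by (intro mult_left_le_one_le) auto
  moreover have "0 \<le> real DIM('b) * w * N z" using constants_pos product_le_N(4) by simp
  ultimately show ?thesis
    unfolding divergence_radial[OF z(1) \<zeta>_deriv] Y_def[symmetric]
    using 1 by (simp add: algebra_simps power2_eq_square)
qed

lemma divergence_virial_bound:
  assumes "z \<in> K\<zeta>"
  shows "divergence X_virial z
    \<le> (1 + M) * N z - (p + 1) * (\<zeta> z * (V z * F z))"
proof -
  have z: "z \<in> S" using assms K\<zeta> by auto
  have "\<bar>\<phi> z * (D\<zeta> z \<bullet> time_reflection (D z))\<bar> \<le> \<bar>\<phi> z\<bar> * (M * norm (D z))"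
    unfolding abs_mult
    using order_trans[OF abs_inner_time_reflection_le mult_right_mono[OF M(3)]] by (intro mult_left_mono) auto
  also have "\<dots> = M * (norm (D z) * \<bar>\<phi> z\<bar>)" by simp
  also have "\<dots> \<le> M * N z" using product_le_N(1)[of z] M(4) by (intro mult_left_mono) auto
  finally have "\<phi> z * (D\<zeta> z \<bullet> time_reflection (D z)) \<le> M * N z" by linarith
  moreover have "\<bar>\<zeta> z * Q z\<bar> \<le> 1 * N z"
    unfolding abs_mult using Q_le[of z] \<zeta>_range by (intro mult_mono) auto
  then have "\<zeta> z * Q z \<le> N z" by linarith
  ultimately show ?thesis
    unfolding divergence_virial[OF z \<zeta>_deriv] by (simp add: algebra_simps)
qed

end

section \<open>Combination of the four divergences into one estimate\<close>

context carleman
begin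

text \<open>r^k / 8 is the lower bound of the weight on f \<ge> r, and 2 + 2 c^2 the loss in passing
  from SF + c \<phi> and \<phi> to \<open>SF\<close> and \<phi>. The value does not depend on
  \<epsilon>.\<close>

definition "m r = c4 * (r powr k / 8) / (2 + 2 * c\<^sup>2)"

lemma W_le_G:
  assumes "z \<in> S'" "norm (z - P) \<le> M"
  shows "c4 * W (f z) \<le> G (f z)"
proof -
  note f0 = S'_S(3)[OF assms(1)]
  have "k * W (f z) \<le> f z * G (f z)" using GW[OF f0] by simp
  also have "\<dots> \<le> M\<^sup>2 * G (f z)" using f_le[OF assms(2)] G_nonneg[OF f0] by (intro mult_right_mono) auto
  finally show ?thesis using M(4) by (simp add: c4_def field_simps)
qed

lemma good_terms_bound:
  assumes z: "z \<in> S'" "norm (z - P) \<le> M" and r: "0 < r" "r \<le> f z" "2 * \<epsilon> \<le> r powr k"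
  shows "m r * ((SF z)\<^sup>2 + (\<phi> z)\<^sup>2) \<le> G (f z) * (SF z + c * \<phi> z)\<^sup>2 + c4 * W (f z) * (\<phi> z)\<^sup>2"
proof -
  note f0 = S'_S(3)[OF z(1)]
  define y where "y = SF z + c * \<phi> z"
  have SFy: "SF z = y - c * \<phi> z" by (simp add: y_def)
  have "(2 + 2 * c\<^sup>2) * (y\<^sup>2 + (\<phi> z)\<^sup>2) - ((SF z)\<^sup>2 + (\<phi> z)\<^sup>2) = (y + c * \<phi> z)\<^sup>2 + (\<phi> z)\<^sup>2 + 2 * (c\<^sup>2 * y\<^sup>2)"
    unfolding SFy by (simp add: power2_eq_square algebra_simps)
  moreover have "0 \<le> (y + c * \<phi> z)\<^sup>2 + (\<phi> z)\<^sup>2 + 2 * (c\<^sup>2 * y\<^sup>2)" by simp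
  ultimately have "(SF z)\<^sup>2 + (\<phi> z)\<^sup>2 \<le> (2 + 2 * c\<^sup>2) * (y\<^sup>2 + (\<phi> z)\<^sup>2)" by linarith
  moreover have c2: "0 < 2 + 2 * c\<^sup>2" by (simp add: add_pos_nonneg)
  ultimately have 1: "((SF z)\<^sup>2 + (\<phi> z)\<^sup>2) / (2 + 2 * c\<^sup>2) \<le> y\<^sup>2 + (\<phi> z)\<^sup>2"
    by (simp add: pos_divide_le_eq mult.commute)
  have "r powr k \<le> f z powr k" using r k by (intro powr_mono2) auto
  then have W: "r powr k / 8 \<le> W (f z)" using W_ge[OF f0] r by auto
  have "m r * ((SF z)\<^sup>2 + (\<phi> z)\<^sup>2) = c4 * (r powr k / 8) * (((SF z)\<^sup>2 + (\<phi> z)\<^sup>2) / (2 + 2 * c\<^sup>2))"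
    by (simp add: m_def)
  also have "\<dots> \<le> c4 * W (f z) * (y\<^sup>2 + (\<phi> z)\<^sup>2)"
    using 1 W constants_pos(4) W_nonneg[OF f0] c2
    by (intro mult_mono mult_left_mono mult_nonneg_nonneg divide_nonneg_pos) auto
  also have "\<dots> \<le> G (f z) * y\<^sup>2 + c4 * W (f z) * (\<phi> z)\<^sup>2"
    using mult_right_mono[OF W_le_G[OF z], of "y\<^sup>2"] by (simp add: algebra_simps)
  finally show "m r * ((SF z)\<^sup>2 + (\<phi> z)\<^sup>2) \<le> G (f z) * (SF z + c * \<phi> z)\<^sup>2 + c4 * W (f z) * (\<phi> z)\<^sup>2"
    by (simp add: y_def)
qed

text \<open>The main field yields 2 G (SF + c \<phi>)^2. One copy pays for the negative square in
  the Hardy term, because c4 W \<le> G; the other copy remains.\<close>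

lemma interior_bound:
  assumes "z \<in> K\<eta>'"
  shows "divergence X_main z + c4 * divergence X_hardy z
    \<ge> D\<eta> z \<bullet> J z + c4 * (W (f z) * (\<phi> z)\<^sup>2 * (D\<eta> z \<bullet> (z - P)))
      + \<eta> z * (G (f z) * (SF z + c * \<phi> z)\<^sup>2 + c4 * W (f z) * (\<phi> z)\<^sup>2) - 3 * k * \<epsilon> * N z"
proof -
  have z: "z \<in> S'" "norm (z - P) \<le> M" using assms K'_subset M(1)[of z] by (auto simp: K\<eta>'_def)
  have "c4 * W (f z) \<le> G (f z)" by (rule W_le_G[OF z])
  then have "\<eta> z * (c4 * W (f z) * (SF z + c * \<phi> z)\<^sup>2) \<le> \<eta> z * (G (f z) * (SF z + c * \<phi> z)\<^sup>2)"
    using \<eta>_range by (intro mult_left_mono mult_right_mono) auto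
  moreover have "c4 * (W (f z) * (\<phi> z)\<^sup>2 * (D\<eta> z \<bullet> (z - P)) + \<eta> z * (W (f z) * (\<phi> z)\<^sup>2) - \<eta> z * (W (f z) * (SF z + c * \<phi> z)\<^sup>2))
      \<le> c4 * divergence X_hardy z"
    using divergence_hardy_bound[OF assms] constants_pos(4) by (intro mult_left_mono) auto
  ultimately show ?thesis
    using divergence_J_bound[OF assms] by (simp add: algebra_simps)
qed

text \<open>Where the gradient of \<eta> is nonzero, \<zeta> is 1, so factors \<zeta> can be
  inserted; the result then has the form of the terms supplied by the radial and virial
  fields.\<close>

lemma cutoff_terms_bound:
  assumes "z \<in> K\<eta>'" "D\<eta> z \<noteq> 0"
  shows "D\<eta> z \<bullet> J z + c4 * (W (f z) * (\<phi> z)\<^sup>2 * (D\<eta> z \<bullet> (z - P))) \<ge>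
    - (w * M * (M + c) + M\<^sup>2 * w / 2 + c4 * (w * M\<^sup>2)) * N z
    - M\<^sup>2 * w * (\<zeta> z * (V z * F z)) - M\<^sup>2 * c * (\<zeta> z * (G (f z) * (\<phi> z)\<^sup>2))"
    and "z \<in> K\<zeta>'"
proof -
  have z: "z \<in> S'" "norm (z - P) \<le> M" using assms K'_subset M(1)[of z] by (auto simp: K\<eta>'_def)
  have \<zeta>1: "\<zeta> z = 1" using \<zeta>_eq_1[OF z(1) assms(2)] .
  then have "z \<in> K\<zeta>" using K\<zeta>(3)[of z] by auto
  then show "z \<in> K\<zeta>'" using assms by (simp add: K\<eta>'_def K\<zeta>'_def)
  note f0 = S'_S(3)[OF z(1)]
  have W: "0 \<le> W (f z)" "W (f z) \<le> w" using W_nonneg[OF f0] W_le_w[OF f0 z(2)] by auto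
  have "\<bar>D\<eta> z \<bullet> (z - P)\<bar> \<le> M * M"
    using order_trans[OF Cauchy_Schwarz_ineq2 mult_mono[OF M(2) z(2)]] M(4) by simp
  then have "\<bar>W (f z) * (\<phi> z)\<^sup>2 * (D\<eta> z \<bullet> (z - P))\<bar> \<le> w * N z * (M * M)"
    unfolding abs_mult using W product_le_N[of z] constants_pos by (intro mult_mono) auto
  then have "- (w * M\<^sup>2 * N z) \<le> W (f z) * (\<phi> z)\<^sup>2 * (D\<eta> z \<bullet> (z - P))"
    by (simp add: power2_eq_square mult_ac abs_le_iff)
  from mult_left_mono[OF this, of c4]
  have "- (c4 * (w * M\<^sup>2 * N z)) \<le> c4 * (W (f z) * (\<phi> z)\<^sup>2 * (D\<eta> z \<bullet> (z - P)))" using constants_pos(4) by simp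
  then show "D\<eta> z \<bullet> J z + c4 * (W (f z) * (\<phi> z)\<^sup>2 * (D\<eta> z \<bullet> (z - P))) \<ge>
    - (w * M * (M + c) + M\<^sup>2 * w / 2 + c4 * (w * M\<^sup>2)) * N z
    - M\<^sup>2 * w * (\<zeta> z * (V z * F z)) - M\<^sup>2 * c * (\<zeta> z * (G (f z) * (\<phi> z)\<^sup>2))"
    using J_bound[OF z M(2)[of z]] by (simp add: \<zeta>1 algebra_simps abs_le_iff)
qed

text \<open>The virial field enters with a minus sign because its divergence is bounded from above,
  with - (p + 1) \<zeta> V F on the right. It carries no weight and therefore lives on all of
  \<open>K\<zeta>\<close>; on the part near or inside the light cone its contribution from V F is
  nonnegative and is dropped.\<close>

lemma annulus_bound:
  "indicator K\<zeta>' z * (c2 * divergence X_radial z)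
     - indicator K\<zeta> z * (c3 * divergence X_virial z)
   \<ge> indicator K\<zeta>' z * (M\<^sup>2 * c * (\<zeta> z * (G (f z) * (\<phi> z)\<^sup>2)) + M\<^sup>2 * w * (\<zeta> z * (V z * F z)))
     - indicator K\<zeta> z * ((c2 * (w * M\<^sup>2 + 2 * w * M + real DIM('b) * w) + c3 * (1 + M)) * N z)" (is "?L \<ge> ?R")
proof (cases "z \<in> K\<zeta>")
  case True
  have VF: "0 \<le> \<zeta> z * (V z * F z)" using True K\<zeta>(2)
    by (intro mult_nonneg_nonneg \<zeta>_range(1) F_nonneg less_imp_le[OF V_pos]) auto
  have "c3 * divergence X_virial z \<le> c3 * ((1 + M) * N z - (p + 1) * (\<zeta> z * (V z * F z)))"
    using divergence_virial_bound[OF True] constants_pos(3) by (intro mult_left_mono)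
  also have "\<dots> = c3 * (1 + M) * N z - (c3 * (p + 1)) * (\<zeta> z * (V z * F z))"
    by (simp add: algebra_simps)
  also have "c3 * (p + 1) = M\<^sup>2 * w" using p by (simp add: c3_def)
  finally have 3: "c3 * divergence X_virial z
      \<le> c3 * (1 + M) * N z - M\<^sup>2 * w * (\<zeta> z * (V z * F z))" .
  show ?thesis
  proof (cases "z \<in> K\<zeta>'")
    case True2: True
    have "c2 * (2 * \<rho> * (\<zeta> z * (G (f z) * (\<phi> z)\<^sup>2)) - (w * M\<^sup>2 + 2 * w * M + real DIM('b) * w) * N z)
       \<le> c2 * divergence X_radial z"
      using divergence_radial_bound[OF True2] constants_pos(2) by (intro mult_left_mono)
    moreover have "c2 * (2 * \<rho>) = M\<^sup>2 * c" using \<rho>(2) by (simp add: c2_def)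
    then have eq: "c2 * (2 * \<rho> * (\<zeta> z * (G (f z) * (\<phi> z)\<^sup>2))) = M\<^sup>2 * c * (\<zeta> z * (G (f z) * (\<phi> z)\<^sup>2))"
      by (metis mult.assoc)
    ultimately have 2: "M\<^sup>2 * c * (\<zeta> z * (G (f z) * (\<phi> z)\<^sup>2)) - c2 * (w * M\<^sup>2 + 2 * w * M + real DIM('b) * w) * N z
       \<le> c2 * divergence X_radial z"
      by (simp only: right_diff_distrib mult.assoc)
    have "z \<in> K\<zeta>" "z \<in> K\<zeta>'" by fact+
    then have "indicator K\<zeta> z = (1::real)" "indicator K\<zeta>' z = (1::real)" by simp_all
    then show ?thesis using 2 3 by (simp only: mult_1 distrib_right)
  next
    case False
    have "0 \<le> M\<^sup>2 * w * (\<zeta> z * (V z * F z))" using VF constants_pos by simp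
    moreover have "0 \<le> c2 * (w * M\<^sup>2 + 2 * w * M + real DIM('b) * w) * N z"
      using constants_pos M(4) product_le_N(4) by simp
    ultimately show ?thesis using 3 True False by (simp add: algebra_simps)
  qed
next
  case False
  then have "z \<notin> K\<zeta>'" by (simp add: K\<zeta>'_def)
  then show ?thesis using False by simp
qed

text \<open>A statement about integrands valid at every point of space-time, so that one integration
  finishes the argument: each summand on the left integrates to 0.\<close>

lemma pointwise_estimate:
  assumes r: "0 < r" "2 * \<epsilon> \<le> r powr k" and L: "\<And>z. z \<in> L \<Longrightarrow> r \<le> f z" "\<And>z. z \<in> L \<Longrightarrow> \<eta> z = 1"
  shows "indicator K\<eta>' z * divergence X_main z
     + c4 * (indicator K\<eta>' z * divergence X_hardy z)
     + c2 * (indicator K\<zeta>' z * divergence X_radial z)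
     - c3 * (indicator K\<zeta> z * divergence X_virial z)
   \<ge> m r * (indicator L z * ((SF z)\<^sup>2 + (\<phi> z)\<^sup>2)) - C0 * (indicator K\<zeta> z * N z) - 3 * k * \<epsilon> * (indicator K\<eta> z * N z)"
proof -
  define good where "good = G (f z) * (SF z + c * \<phi> z)\<^sup>2 + c4 * W (f z) * (\<phi> z)\<^sup>2"
  define bad where "bad = M\<^sup>2 * c * (\<zeta> z * (G (f z) * (\<phi> z)\<^sup>2)) + M\<^sup>2 * w * (\<zeta> z * (V z * F z))"
  define C1 where "C1 = w * M * (M + c) + M\<^sup>2 * w / 2 + c4 * (w * M\<^sup>2)"
  define dJ where "dJ = divergence X_main z"
  define dH where "dH = divergence X_hardy z"
  have C1: "0 \<le> C1" using constants_pos c_nonneg M(4) by (simp add: C1_def)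
  have eN: "0 \<le> 3 * k * \<epsilon> * N z" using k eps product_le_N(4) by simp
  have bad: "0 \<le> indicator K\<zeta>' z * bad"
  proof (cases "z \<in> K\<zeta>'")
    case True
    then have "z \<in> S'" "z \<in> S" using K'_subset S'_S by auto
    then show ?thesis
      unfolding bad_def using \<zeta>_range(1)[of z] F_nonneg[of z] V_pos[of z] G_nonneg[OF S'_S(3)] constants_pos c_nonneg
      by simp
  qed simp
  \<comment> \<open>On \<open>L\<close> the weight is positive, by its lower bound at f \<ge> r, so
    f cannot lie below \<open>r0\<close>.\<close>
  have LK: "z \<in> K\<eta>'" if "z \<in> L"
  proof -
    have "z \<in> K\<eta>" using K\<eta>(3)[of z] L(2)[OF that] by auto
    moreover have "r0 \<le> f z"
    proof (rule ccontr)
      assume *: "\<not> r0 \<le> f z"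
      have fz: "r \<le> f z" "0 < f z" using L(1)[OF that] r by auto
      have "0 < r powr k" using r by simp
      also have "r powr k \<le> f z powr k" using fz r k by (intro powr_mono2) auto
      finally have "0 < f z powr k" .
      moreover have "2 * \<epsilon> \<le> f z powr k" using \<open>r powr k \<le> f z powr k\<close> r by simp
      ultimately have "0 < W (f z)" using W_ge[of "f z"] fz by linarith
      then show False using r0(2)[of "f z"] * fz by simp
    qed
    ultimately show ?thesis by (simp add: K\<eta>'_def)
  qed
  have "m r * (indicator L z * ((SF z)\<^sup>2 + (\<phi> z)\<^sup>2)) \<le> indicator K\<eta>' z * (\<eta> z * good)"
  proof (cases "z \<in> L")
    case True
    have "z \<in> S'" "norm (z - P) \<le> M" using LK[OF True] K'_subset M(1)[of z] by (auto simp: K\<eta>'_def)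
    from good_terms_bound[OF this r(1) L(1)[OF True] r(2)] True LK[OF True] L(2)[OF True]
    show ?thesis by (simp add: good_def)
  next
    case False
    have "0 \<le> good" if "z \<in> K\<eta>'"
      using that K'_subset(1) W_nonneg[OF S'_S(3)[of z]] G_nonneg[OF S'_S(3)[of z]] constants_pos
      unfolding good_def by (intro add_nonneg_nonneg mult_nonneg_nonneg) auto
    then show ?thesis using False \<eta>_range(1)[of z] by (auto simp: indicator_def)
  qed
  moreover have "indicator K\<eta>' z * dJ + c4 * (indicator K\<eta>' z * dH) \<ge>
     indicator K\<eta>' z * (\<eta> z * good) - indicator K\<eta> z * (3 * k * \<epsilon> * N z) - indicator K\<zeta> z * (C1 * N z) - indicator K\<zeta>' z * bad"
  proof (cases "z \<in> K\<eta>'")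
    case True
    then have "z \<in> K\<eta>" by (simp add: K\<eta>'_def)
    note ib = interior_bound[OF True, folded good_def dJ_def dH_def]
    show ?thesis
    proof (cases "D\<eta> z = 0")
      case True2: True
      have "0 \<le> indicator K\<zeta> z * (C1 * N z)" using C1 product_le_N(4)[of z] by simp
      then show ?thesis using ib bad True \<open>z \<in> K\<eta>\<close> by (simp add: True2)
    next
      case False
      note cb = cutoff_terms_bound[OF True False]
      have "z \<in> K\<zeta>" using cb(2) by (simp add: K\<zeta>'_def)
      show ?thesis using ib cb(1) True \<open>z \<in> K\<eta>\<close> cb(2) \<open>z \<in> K\<zeta>\<close> by (simp add: C1_def bad_def algebra_simps)
    qed
  next
    case False
    have "0 \<le> indicator K\<zeta> z * (C1 * N z)" "0 \<le> indicator K\<eta> z * (3 * k * \<epsilon> * N z)"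
      using C1 product_le_N(4)[of z] eN by simp_all
    moreover have "indicator K\<eta>' z = (0::real)" using False by simp
    ultimately show ?thesis using bad by (simp only: mult_zero_left mult_zero_right)
  qed
  moreover have "C0 = C1 + (c2 * (w * M\<^sup>2 + 2 * w * M + real DIM('b) * w) + c3 * (1 + M))"
    by (simp add: C0_def C1_def)
  ultimately show ?thesis
    using annulus_bound[of z, folded bad_def] unfolding dJ_def[symmetric] dH_def[symmetric]
    by (simp add: algebra_simps)
qed

lemma set_integrable_compact:
  fixes g :: "real \<times> 'b \<Rightarrow> real"
  assumes "compact K" "continuous_on K g"
  shows "integrable lborel (\<lambda>z. indicator K z * g z)"
  using borel_integrable_compact[OF assms] by simp

lemma \<eta>_C1: "C1_on T \<eta>" and \<zeta>_C1: "C1_on T \<zeta>"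
  by (rule C1_onI[OF \<eta>_deriv[unfolded gderiv_def]], intro continuous_intros continuous_on_subset[OF D\<eta>_cont] subset_UNIV)
     (rule C1_onI[OF \<zeta>_deriv[unfolded gderiv_def]], intro continuous_intros continuous_on_subset[OF D\<zeta>_cont] subset_UNIV)

text \<open>The parameter \<epsilon> appears only in front of the last integral, which runs over the
  support of \<eta> including the interior. The main error integral runs over the annulus
  alone.\<close>

theorem carleman_estimate:
  assumes r: "0 < r" "2 * \<epsilon> \<le> r powr k"
    and L: "compact L" "\<And>z. z \<in> L \<Longrightarrow> r \<le> f z" "\<And>z. z \<in> L \<Longrightarrow> \<eta> z = 1"
  shows "m r * (LINT z:L|lborel. (SF z)\<^sup>2 + (\<phi> z)\<^sup>2)
    \<le> C0 * (LINT z:K\<zeta>|lborel. N z) + 3 * k * \<epsilon> * (LINT z:K\<eta>|lborel. N z)"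
proof -
  have low: "W (f z) = 0 \<and> G (f z) = 0" if "z \<in> S'" "f z < r0" for z
    using r0(2,3)[of "f z"] S'_S(3)[OF that(1)] that(2) by simp
  \<comment> \<open>Within f > 0 each weighted field vanishes off its compact set, through the
    cutoff or through the weight; this permits the divergence theorem without boundary
    terms.\<close>
  have out: "\<eta> z = 0 \<or> W (f z) = 0 \<and> G (f z) = 0" if "z \<in> S'" "z \<notin> K\<eta>'" for z
    using that low[of z] K\<eta>(3)[of z] by (auto simp: K\<eta>'_def)
  have out': "\<zeta> z = 0 \<or> W (f z) = 0 \<and> G (f z) = 0" if "z \<in> S'" "z \<notin> K\<zeta>'" for z
    using that low[of z] K\<zeta>(3)[of z] by (auto simp: K\<zeta>'_def)
  have field1: "C1_on S' X_main" by (intro C1_on_scaleR \<eta>_C1 J_C1)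
  have field2: "C1_on S' X_hardy"
    unfolding power2_eq_square by (intro C1_on_scaleR C1_on_mult \<eta>_C1 Wf_C1 \<phi>_C1[THEN C1_S'] minus_P_C1)
  have "bounded_linear (\<lambda>z::real \<times> 'b. (0::real, snd z))" by (intro bounded_linear_Pair bounded_linear_zero bounded_linear_snd)
  note radial_C1 = bounded_linear.C1_on_compose[OF this minus_P_C1]
  have field3: "C1_on S' X_radial"
    unfolding power2_eq_square by (intro C1_on_scaleR C1_on_mult \<zeta>_C1 Wf_C1 \<phi>_C1[THEN C1_S'] radial_C1)
  have field4: "C1_on S X_virial"
    by (intro C1_on_scaleR C1_on_mult \<zeta>_C1 \<phi>_C1 RD_C1)
  note cont = field1[THEN continuous_on_divergence, THEN continuous_on_subset, OF K'_subset(1)]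
    field2[THEN continuous_on_divergence, THEN continuous_on_subset, OF K'_subset(1)]
    field3[THEN continuous_on_divergence, THEN continuous_on_subset, OF K'_subset(2)]
    field4[THEN continuous_on_divergence, THEN continuous_on_subset, OF K\<zeta>(2)]
  note int = set_integrable_compact[OF compact_K'(1) cont(1)] set_integrable_compact[OF compact_K'(1) cont(2)]
    set_integrable_compact[OF compact_K'(2) cont(3)] set_integrable_compact[OF K\<zeta>(1) cont(4)]
  have J0: "J z = 0" if "z \<in> S'" "W (f z) = 0" "G (f z) = 0" for z
    using that by (simp add: J_def A_def B_def)
  have zero1: "(LINT z|lborel. indicator K\<eta>' z * divergence X_main z) = 0"
    using divergence_integral_eq_0[OF open_S' field1 compact_K'(1) K'_subset(1)] out J0
    by (fastforce simp: set_lebesgue_integral_def)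
  have zero2: "(LINT z|lborel. indicator K\<eta>' z * divergence X_hardy z) = 0"
    using divergence_integral_eq_0[OF open_S' field2 compact_K'(1) K'_subset(1)] out
    by (fastforce simp: set_lebesgue_integral_def)
  have zero3: "(LINT z|lborel. indicator K\<zeta>' z * divergence X_radial z) = 0"
  proof -
    have "X_radial z = 0" if "z \<in> S'" "z \<notin> K\<zeta>'" for z
      using out'[OF that] by (auto simp: zero_prod_def)
    from divergence_integral_eq_0[OF open_S' field3 compact_K'(2) K'_subset(2) this] show ?thesis
      unfolding set_lebesgue_integral_def real_scaleR_def .
  qed
  have zero4: "(LINT z|lborel. indicator K\<zeta> z * divergence X_virial z) = 0"
    using divergence_integral_eq_0[OF open_S field4 K\<zeta>(1,2)] K\<zeta>(3)
    by (fastforce simp: set_lebesgue_integral_def)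
  have LS: "L \<subseteq> S" using L(3) K\<eta>(2,3) by fastforce
  have intL: "integrable lborel (\<lambda>z. indicator L z * ((SF z)\<^sup>2 + (\<phi> z)\<^sup>2))"
    using LS by (intro set_integrable_compact L(1) continuous_intros C1_on_continuous[OF SF_C1, THEN continuous_on_subset]
        C1_on_continuous[OF \<phi>_C1, THEN continuous_on_subset])
  note intN = set_integrable_compact[OF K\<zeta>(1) continuous_on_subset[OF N_cont K\<zeta>(2)]]
    set_integrable_compact[OF K\<eta>(1) continuous_on_subset[OF N_cont K\<eta>(2)]]
  have "(LINT z|lborel. m r * (indicator L z * ((SF z)\<^sup>2 + (\<phi> z)\<^sup>2)) - C0 * (indicator K\<zeta> z * N z) - 3 * k * \<epsilon> * (indicator K\<eta> z * N z))
     \<le> (LINT z|lborel. indicator K\<eta>' z * divergence X_main z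
     + c4 * (indicator K\<eta>' z * divergence X_hardy z)
     + c2 * (indicator K\<zeta>' z * divergence X_radial z)
     - c3 * (indicator K\<zeta> z * divergence X_virial z))"
    by (rule integral_mono[OF _ _ pointwise_estimate[OF r L(2,3)]])
       (intro Bochner_Integration.integrable_diff Bochner_Integration.integrable_add integrable_mult_right intL intN int)+
  also have "\<dots> = 0"
    using int by (simp add: zero1 zero2 zero3 zero4 del: snd_diff scaleR_Pair)
  finally show ?thesis
    using intL intN by (simp add: set_lebesgue_integral_def)
qed

end

section \<open>Estimates in the cone\<close>

lemma bounded_linear_functional_inner:
  fixes g :: "'a::euclidean_space \<Rightarrow> real"
  assumes "bounded_linear g"
  shows "g = (\<lambda>h. h \<bullet> (\<Sum>b\<in>Basis. g b *\<^sub>R b))"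
proof
  interpret bounded_linear g by fact
  fix h
  have "g h = g (\<Sum>b\<in>Basis. (h \<bullet> b) *\<^sub>R b)" by (simp add: euclidean_representation)
  also have "\<dots> = (\<Sum>b\<in>Basis. (h \<bullet> b) * g b)" by (simp add: sum scaleR)
  finally show "g h = h \<bullet> (\<Sum>b\<in>Basis. g b *\<^sub>R b)" by (simp add: inner_sum_right mult.commute)
qed

lemma C1_on_gradientE:
  fixes g :: "'a::euclidean_space \<Rightarrow> real"
  assumes "C1_on S g"
  obtains Dg where "\<And>z. z \<in> S \<Longrightarrow> GDERIV g z :> Dg z" "continuous_on S Dg"
proof -
  obtain g' where g': "\<And>z. z \<in> S \<Longrightarrow> (g has_derivative g' z) (at z)" "\<And>h. continuous_on S (\<lambda>z. g' z h)"
    by (rule C1_onE[OF assms]) metis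
  define Dg where "Dg z = (\<Sum>b\<in>Basis. g' z b *\<^sub>R b)" for z
  have "GDERIV g z :> Dg z" if "z \<in> S" for z
    unfolding gderiv_def Dg_def
    by (rule has_derivative_eq_rhs[OF g'(1)[OF that] bounded_linear_functional_inner])
       (rule has_derivative_bounded_linear[OF g'(1)[OF that]])
  moreover have "continuous_on S Dg"
    unfolding Dg_def by (intro continuous_intros g'(2))
  ultimately show thesis by (rule that)
qed

lemma GDERIV_locally_const:
  assumes "GDERIV g z :> a" "open T" "z \<in> T" "\<And>w. w \<in> T \<Longrightarrow> g w = C"
  shows "a = 0"
proof -
  have "(g has_derivative (\<lambda>_. 0)) (at z)"
    by (rule has_derivative_transform_within_open[of "\<lambda>_. C" _ _ _ T]) (use assms in auto)
  from has_derivative_unique[OF assms(1)[unfolded gderiv_def] this] have "a \<bullet> a = 0" by metis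
  then show ?thesis by simp
qed

lemma C1_cutoff_gradient:
  fixes K U :: "'a::euclidean_space set"
  assumes "compact K" "open U" "K \<subseteq> U"
  obtains \<eta> D\<eta> K' M where "\<And>z. GDERIV \<eta> z :> D\<eta> z" "continuous_on UNIV D\<eta>" "\<And>z. 0 \<le> \<eta> z" "\<And>z. \<eta> z \<le> 1"
    "\<And>z. z \<in> K \<Longrightarrow> \<eta> z = 1" "compact K'" "K' \<subseteq> U" "\<And>z. z \<notin> K' \<Longrightarrow> \<eta> z = 0" "\<And>z. norm (D\<eta> z) \<le> M"
proof -
  obtain \<eta> :: "'a \<Rightarrow> real" and K' where \<eta>: "C1_on UNIV \<eta>" "\<And>z. 0 \<le> \<eta> z" "\<And>z. \<eta> z \<le> 1"
    "\<And>z. z \<in> K \<Longrightarrow> \<eta> z = 1" "compact K'" "K' \<subseteq> U" "\<And>z. z \<notin> K' \<Longrightarrow> \<eta> z = 0"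
    using C1_cutoff_exists[OF assms] by metis
  obtain D\<eta> where D\<eta>: "\<And>z. GDERIV \<eta> z :> D\<eta> z" "continuous_on UNIV D\<eta>"
    using C1_on_gradientE[OF \<eta>(1)] by (metis UNIV_I)
  have "bounded (D\<eta> ` K')"
    by (intro compact_imp_bounded compact_continuous_image continuous_on_subset[OF D\<eta>(2)] \<eta>(5)) auto
  then obtain M where M: "\<And>z. z \<in> K' \<Longrightarrow> norm (D\<eta> z) \<le> M" "M > 0" by (auto simp: bounded_pos)
  have "norm (D\<eta> z) \<le> M" for z
  proof (cases "z \<in> K'")
    case False
    then have "D\<eta> z = 0"
      using \<eta>(5,7) by (intro GDERIV_locally_const[OF D\<eta>(1), where T = "- K'"]) (auto simp: compact_imp_closed open_Compl)
    then show ?thesis using M(2) by simp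
  qed (rule M(1))
  with D\<eta> \<eta> that show thesis by blast
qed

text \<open>The portion of the cone used after rescaling to unit scale. The time bounds are T and 1
  / T with T = 8 / (1 - \<sigma>), strictly beyond the times that points spacelike to the centres
  can have, so that the cutoffs fit inside.\<close>

definition cone_section :: "real \<Rightarrow> (real \<times> 'b::euclidean_space) set" where
  "cone_section \<sigma> = {z. - (8 / (1 - \<sigma>)) < fst z \<and> fst z < - ((1 - \<sigma>) / 8) \<and> norm (snd z) < \<sigma> * \<bar>fst z\<bar>}"

lemma open_cone_section: "open (cone_section \<sigma> :: (real \<times> 'b::euclidean_space) set)"
  unfolding cone_section_def
  by (intro open_Collect_conj open_Collect_less continuous_intros)

lemma mem_cone_section:
  assumes "0 < \<sigma>0" "\<sigma>0 < \<sigma>1" "\<sigma>1 < 1" "\<bar>fst z + 1\<bar> \<le> 1 / 16" "norm (snd z) \<le> \<sigma>0 * \<bar>fst z\<bar>"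
  shows "z \<in> cone_section \<sigma>1"
proof -
  have "0 < \<bar>fst z\<bar>" using assms(4) by linarith
  then have "\<sigma>0 * \<bar>fst z\<bar> < \<sigma>1 * \<bar>fst z\<bar>" using assms by (intro mult_strict_right_mono)
  moreover have "8 \<le> 8 / (1 - \<sigma>1)" "(1 - \<sigma>1) / 8 \<le> 1 / 8" using assms by (simp_all add: field_simps)
  ultimately show ?thesis unfolding cone_section_def mem_Collect_eq using assms(4,5) by (intro conjI; linarith)
qed

lemma quadrance_eq: "quadrance z = (norm (snd z))\<^sup>2 - (fst z)\<^sup>2"
  unfolding power2_norm_eq_inner by (simp add: time_reflection_def inner_prod_def power2_eq_square)

lemma spacelike_separation:
  assumes "quadrance (z - P) > 0"
  shows "\<bar>fst z - fst P\<bar> < norm (snd z - snd P)"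
proof -
  have "(fst z - fst P)\<^sup>2 < (norm (snd z - snd P))\<^sup>2" using assms by (simp add: quadrance_eq)
  then show ?thesis by (metis abs_le_square_iff abs_norm_cancel linorder_not_le)
qed

text \<open>Spacelike separation gives |t - t_P| < \<sigma> |t| + 1/2. Since \<sigma> < 1, this
  bounds |t| from above; since |t_P| is at least 7/8, it also bounds |t| from below. These bounds
  replace a cutoff in time.\<close>

lemma time_bounds:
  fixes z P :: "real \<times> 'b::euclidean_space"
  assumes "0 < \<sigma>" "\<sigma> < 1" "fst z < 0" "norm (snd z) < \<sigma> * \<bar>fst z\<bar>" "quadrance (z - P) > 0"
    and P: "\<bar>fst P + 1\<bar> \<le> 1 / 8" "norm (snd P) \<le> 1 / 2"
  shows "- (2 / (1 - \<sigma>)) < fst z" "fst z < - (3 / 16)"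
proof -
  have "\<bar>fst z - fst P\<bar> < norm (snd z - snd P)" using assms(5) by (rule spacelike_separation)
  also have "\<dots> \<le> norm (snd z) + norm (snd P)" by (rule norm_triangle_ineq4)
  also have "\<dots> < \<sigma> * \<bar>fst z\<bar> + 1 / 2" using assms by simp
  finally have *: "\<bar>fst z - fst P\<bar> < \<sigma> * \<bar>fst z\<bar> + 1 / 2" .
  then have "\<bar>fst z\<bar> - \<sigma> * \<bar>fst z\<bar> < 2" using P assms(3) by linarith
  then have "\<bar>fst z\<bar> * (1 - \<sigma>) < 2" by (simp add: algebra_simps)
  then show "- (2 / (1 - \<sigma>)) < fst z" using assms(2,3) by (simp add: field_simps)
  have "3 / 8 < \<bar>fst z\<bar> + \<sigma> * \<bar>fst z\<bar>" using * P assms(3) by linarith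
  also have "\<sigma> * \<bar>fst z\<bar> \<le> 1 * \<bar>fst z\<bar>" using assms(2) by (intro mult_right_mono) auto
  finally show "fst z < - (3 / 16)" using assms(3) by simp
qed

lemma compact_cone_part:
  assumes "0 \<le> \<sigma>"
  shows "compact {z :: real \<times> 'b::euclidean_space. a \<le> fst z \<and> fst z \<le> b \<and> \<mu> * \<bar>fst z\<bar> \<le> norm (snd z) \<and> norm (snd z) \<le> \<sigma> * \<bar>fst z\<bar>}"
    (is "compact ?K")
proof -
  have "closed ?K" by (intro closed_Collect_conj closed_Collect_le continuous_intros)
  moreover have "bounded ?K"
  proof (rule bounded_subset)
    show "bounded (cbox a b \<times> cball (0::'b) (\<sigma> * max \<bar>a\<bar> \<bar>b\<bar>))" by (intro bounded_Times) auto
    show "?K \<subseteq> cbox a b \<times> cball (0::'b) (\<sigma> * max \<bar>a\<bar> \<bar>b\<bar>)"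
    proof
      fix z assume z: "z \<in> ?K"
      then have "\<bar>fst z\<bar> \<le> max \<bar>a\<bar> \<bar>b\<bar>" by auto
      then have "\<sigma> * \<bar>fst z\<bar> \<le> \<sigma> * max \<bar>a\<bar> \<bar>b\<bar>" using assms by (intro mult_left_mono)
      then show "z \<in> cbox a b \<times> cball (0::'b) (\<sigma> * max \<bar>a\<bar> \<bar>b\<bar>)" using z by (cases z) auto
    qed
  qed
  ultimately show ?thesis by (simp add: compact_eq_bounded_closed)
qed

section \<open>Measurability and integrals of continuous functions on subsets\<close>

lemma borel_measurable_ennreal_indicator:
  fixes f :: "'a::topological_space \<Rightarrow> real"
  assumes "A \<in> sets borel" "continuous_on A f"
  shows "(\<lambda>z. ennreal (f z) * indicator A z) \<in> borel_measurable borel"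
proof -
  have "(\<lambda>z. ennreal (indicator A z *\<^sub>R f z)) \<in> borel_measurable borel"
    using borel_measurable_continuous_on_indicator[OF assms] by simp
  moreover have "(\<lambda>z. ennreal (indicator A z *\<^sub>R f z)) = (\<lambda>z. ennreal (f z) * indicator A z)"
    by (auto simp: indicator_def fun_eq_iff)
  ultimately show ?thesis by simp
qed

lemma nn_integral_compact_eq:
  fixes g :: "'a::euclidean_space \<Rightarrow> real"
  assumes "compact K" "continuous_on K g" "\<And>z. z \<in> K \<Longrightarrow> 0 \<le> g z"
  shows "(\<integral>\<^sup>+z. ennreal (g z) * indicator K z \<partial>lborel) = ennreal (LINT z:K|lborel. g z)"
proof -
  have "(\<integral>\<^sup>+z. ennreal (g z) * indicator K z \<partial>lborel) = (\<integral>\<^sup>+z. ennreal (indicator K z *\<^sub>R g z) \<partial>lborel)"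
    by (intro nn_integral_cong) (auto simp: indicator_def)
  also have "\<dots> = ennreal (LINT z|lborel. indicator K z *\<^sub>R g z)"
    using assms by (intro nn_integral_eq_integral borel_integrable_compact) (auto simp: indicator_def)
  finally show ?thesis by (simp add: set_lebesgue_integral_def)
qed

section \<open>The estimate for a single centre\<close>

abbreviation outer_energy :: "real \<Rightarrow> real \<Rightarrow> (real \<times> 'b::euclidean_space \<Rightarrow> real \<times> 'b) \<Rightarrow> (real \<times> 'b \<Rightarrow> real) \<Rightarrow> ennreal" where
  "outer_energy \<sigma>0 \<sigma>1 D \<phi> \<equiv> \<integral>\<^sup>+z. ennreal ((norm (D z))\<^sup>2 + (\<phi> z)\<^sup>2) * indicator {z \<in> cone_section \<sigma>1. \<sigma>0 * \<bar>fst z\<bar> < norm (snd z)} z \<partial>lborel"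

abbreviation core_energy :: "real \<Rightarrow> real \<Rightarrow> (real \<times> 'b::euclidean_space \<Rightarrow> real \<times> 'b) \<Rightarrow> (real \<times> 'b \<Rightarrow> real) \<Rightarrow> ennreal" where
  "core_energy \<sigma>0 h D \<phi> \<equiv> \<integral>\<^sup>+z. ennreal ((norm (D z))\<^sup>2 + (\<phi> z)\<^sup>2) * indicator {z. \<bar>fst z + 1\<bar> \<le> h \<and> norm (snd z) \<le> \<sigma>0 * \<bar>fst z\<bar>} z \<partial>lborel"

text \<open>\<kappa> and C have to be fixed before the solution is given: the cutoffs, M, \<rho> and
  k are built from the geometry and p alone. The truncated weight is chosen only afterwards, for
  each \<epsilon>, and disappears in the limit.\<close>

lemma center_estimate:
  fixes \<sigma>0 \<sigma>1 p r :: real and P :: "real \<times> 'b::euclidean_space"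
  assumes \<sigma>: "0 < \<sigma>0" "\<sigma>0 < \<sigma>1" "\<sigma>1 < 1" and p: "p > 1" "(p - 1) * (real DIM('b) - 1) < 4"
    and P: "\<bar>fst P + 1\<bar> \<le> 1 / 8" "norm (snd P) \<le> \<sigma>0 / 2" and r: "r > 0"
  obtains \<kappa> C where "\<kappa> > 0" "C \<ge> 0"
    "\<And>\<phi> V D DV D2 L. wave_solution (cone_section \<sigma>1) \<phi> V D DV D2 p \<Longrightarrow>
       (\<And>z. z \<in> cone_section \<sigma>1 \<Longrightarrow> norm (DV z) \<le> \<kappa> * V z) \<Longrightarrow>
       compact L \<Longrightarrow> L \<subseteq> {z \<in> cone_section \<sigma>1. norm (snd z) \<le> \<sigma>0 * \<bar>fst z\<bar> \<and> r \<le> quadrance (z - P)} \<Longrightarrow>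
       (\<integral>\<^sup>+z. ennreal ((D z \<bullet> (z - P))\<^sup>2 + (\<phi> z)\<^sup>2) * indicator L z \<partial>lborel)
       \<le> ennreal C * outer_energy \<sigma>0 \<sigma>1 D \<phi>"
proof -
  define U where "U = (cone_section \<sigma>1 :: (real \<times> 'b) set)"
  \<comment> \<open>Equally spaced slopes \<sigma>0 < a < b < \<sigma>1. The cutoff \<eta> falls
    from 1 to 0 between a and b; \<zeta> is 1 there and is supported outside slope
    \<sigma>0.\<close>
  define a where "a = (2 * \<sigma>0 + \<sigma>1) / 3"
  define b where "b = (\<sigma>0 + 2 * \<sigma>1) / 3"
  have ab: "\<sigma>0 < a" "a < b" "b < \<sigma>1" "0 < a" "0 < b" using \<sigma> by (auto simp: a_def b_def)
  define T where "T = 2 / (1 - \<sigma>1)"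
  have T: "8 / (1 - \<sigma>1) > T" "(1 - \<sigma>1) / 8 < 3 / 16" using \<sigma> by (auto simp: T_def field_simps)
  define KA where "KA = {z :: real \<times> 'b. - T \<le> fst z \<and> fst z \<le> - (3 / 16) \<and> 0 * \<bar>fst z\<bar> \<le> norm (snd z) \<and> norm (snd z) \<le> a * \<bar>fst z\<bar>}"
  define UA where "UA = {z :: real \<times> 'b. - (8 / (1 - \<sigma>1)) < fst z \<and> fst z < - ((1 - \<sigma>1) / 8) \<and> norm (snd z) < b * \<bar>fst z\<bar>}"
  define KB where "KB = {z :: real \<times> 'b. - T \<le> fst z \<and> fst z \<le> - (3 / 16) \<and> a * \<bar>fst z\<bar> \<le> norm (snd z) \<and> norm (snd z) \<le> b * \<bar>fst z\<bar>}"
  define UB where "UB = {z \<in> U. \<sigma>0 * \<bar>fst z\<bar> < norm (snd z)}"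
  have scale: "\<mu> * \<bar>t\<bar> < \<nu> * \<bar>t\<bar>" if "\<mu> < \<nu>" "t \<le> - (3 / 16)" for \<mu> \<nu> t :: real
    using that by (intro mult_strict_right_mono) auto
  have compact: "compact KA" "compact KB"
    unfolding KA_def KB_def using ab by (intro compact_cone_part; simp)+
  have open_UA: "open UA"
    unfolding UA_def by (intro open_Collect_conj open_Collect_less continuous_intros)
  have "open {z :: real \<times> 'b. \<sigma>0 * \<bar>fst z\<bar> < norm (snd z)}"
    by (intro open_Collect_less continuous_intros)
  moreover have "UB = U \<inter> {z. \<sigma>0 * \<bar>fst z\<bar> < norm (snd z)}" by (auto simp: UB_def)
  ultimately have open_UB: "open UB" using open_cone_section[of \<sigma>1] by (auto simp: U_def)
  have KA: "KA \<subseteq> UA"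
  proof
    fix z assume z: "z \<in> KA"
    then have zK: "- T \<le> fst z" "fst z \<le> - (3 / 16)" "norm (snd z) \<le> a * \<bar>fst z\<bar>"
      unfolding KA_def mem_Collect_eq by blast+
    have "a * \<bar>fst z\<bar> < b * \<bar>fst z\<bar>" using zK(2) by (rule scale[OF ab(2)])
    then show "z \<in> UA" unfolding UA_def mem_Collect_eq using zK T by (intro conjI; linarith)
  qed
  have KB: "KB \<subseteq> UB"
  proof
    fix z assume z: "z \<in> KB"
    then have zK: "- T \<le> fst z" "fst z \<le> - (3 / 16)" "a * \<bar>fst z\<bar> \<le> norm (snd z)" "norm (snd z) \<le> b * \<bar>fst z\<bar>"
      unfolding KB_def mem_Collect_eq by blast+
    have "\<sigma>0 * \<bar>fst z\<bar> < a * \<bar>fst z\<bar>" "b * \<bar>fst z\<bar> < \<sigma>1 * \<bar>fst z\<bar>"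
      using zK(2) by (rule scale[OF ab(1)], rule scale[OF ab(3)])
    then show "z \<in> UB" unfolding UB_def U_def cone_section_def mem_Collect_eq using zK T by (intro conjI; linarith)
  qed
  have UA: "UA \<subseteq> U"
  proof
    fix z assume z: "z \<in> UA"
    have "b * \<bar>fst z\<bar> \<le> \<sigma>1 * \<bar>fst z\<bar>" using ab by (intro mult_right_mono) auto
    then show "z \<in> U" using z by (auto simp: UA_def U_def cone_section_def)
  qed
  obtain \<eta> D\<eta> K\<eta> M1 where \<eta>: "\<And>z. GDERIV \<eta> z :> D\<eta> z" "continuous_on UNIV D\<eta>" "\<And>z. 0 \<le> \<eta> z" "\<And>z. \<eta> z \<le> 1"
    "\<And>z. z \<in> KA \<Longrightarrow> \<eta> z = 1" "compact K\<eta>" "K\<eta> \<subseteq> UA" "\<And>z. z \<notin> K\<eta> \<Longrightarrow> \<eta> z = 0" "\<And>z. norm (D\<eta> z) \<le> M1"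
    by (rule C1_cutoff_gradient[OF compact(1) open_UA KA]) metis
  obtain \<zeta> D\<zeta> K\<zeta> M2 where \<zeta>: "\<And>z. GDERIV \<zeta> z :> D\<zeta> z" "continuous_on UNIV D\<zeta>" "\<And>z. 0 \<le> \<zeta> z" "\<And>z. \<zeta> z \<le> 1"
    "\<And>z. z \<in> KB \<Longrightarrow> \<zeta> z = 1" "compact K\<zeta>" "K\<zeta> \<subseteq> UB" "\<And>z. z \<notin> K\<zeta> \<Longrightarrow> \<zeta> z = 0" "\<And>z. norm (D\<zeta> z) \<le> M2"
    by (rule C1_cutoff_gradient[OF compact(2) open_UB KB]) metis
  have "bounded ((\<lambda>z. z - P) ` (K\<eta> \<union> K\<zeta>))"
    by (intro compact_imp_bounded compact_continuous_image continuous_intros compact_Un \<eta>(6) \<zeta>(6))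
  then obtain M3 where M3: "\<And>z. z \<in> K\<eta> \<union> K\<zeta> \<Longrightarrow> norm (z - P) \<le> M3"
    unfolding bounded_pos by blast
  define M where "M = Max {1, M1, M2, M3}"
  have M: "M \<ge> 1" "M1 \<le> M" "M2 \<le> M" "M3 \<le> M" by (auto simp: M_def)
  define \<rho> where "\<rho> = (\<sigma>0 / 8)\<^sup>2"
  have \<rho>: "\<rho> > 0" using \<sigma> by (simp add: \<rho>_def)
  \<comment> \<open>Twice \<kappa>0 is the subconformal gap 2 - (p - 1)(n - 1) / 2 with n =
    \<open>DIM('b)\<close>. The nonlinear coefficient is this gap minus (p - 1) k; the chosen k
    spends half of it and leaves \<kappa>0.\<close>
  define \<kappa>0 where "\<kappa>0 = (2 - (p - 1) * (real DIM('b) - 1) / 2) / 2"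
  define k where "k = \<kappa>0 / (p - 1)"
  have \<kappa>0: "\<kappa>0 > 0" using p by (simp add: \<kappa>0_def)
  then have k: "k > 0" using p by (simp add: k_def)
  have PU: "norm (snd P) \<le> 1 / 2" using P \<sigma> by simp
  have U_D: "fst z < 0" "norm (snd z) < \<sigma>1 * \<bar>fst z\<bar>" if "z \<in> U" for z
  proof -
    have "0 < (1 - \<sigma>1) / 8" using \<sigma> by simp
    moreover have "fst z < - ((1 - \<sigma>1) / 8)" using that by (simp add: U_def cone_section_def)
    ultimately show "fst z < 0" by linarith
    show "norm (snd z) < \<sigma>1 * \<bar>fst z\<bar>" using that by (simp add: U_def cone_section_def)
  qed
  \<comment> \<open>The gradient of \<eta> may also be nonzero near the earliest and latest times of
    its support, but there f > 0 fails, so only the transition between slopes a and b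
    matters.\<close>
  have in_KB: "\<zeta> z = 1" if z: "z \<in> U" "quadrance (z - P) > 0" "D\<eta> z \<noteq> 0" for z
  proof -
    have tb: "- T < fst z" "fst z < - (3 / 16)"
      using time_bounds[of \<sigma>1 z P] \<sigma> U_D[OF z(1)] z(2) P(1) PU by (auto simp: T_def)
    have "a * \<bar>fst z\<bar> \<le> norm (snd z)"
    proof (rule ccontr)
      assume "\<not> ?thesis"
      then have zT: "z \<in> {z. - T < fst z \<and> fst z < - (3 / 16) \<and> norm (snd z) < a * \<bar>fst z\<bar>}" using tb by auto
      have "D\<eta> z = 0"
      proof (rule GDERIV_locally_const[OF \<eta>(1) _ zT])
        show "open {z :: real \<times> 'b. - T < fst z \<and> fst z < - (3 / 16) \<and> norm (snd z) < a * \<bar>fst z\<bar>}"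
          by (intro open_Collect_conj open_Collect_less continuous_intros)
        show "\<eta> w = 1" if "w \<in> {z. - T < fst z \<and> fst z < - (3 / 16) \<and> norm (snd z) < a * \<bar>fst z\<bar>}" for w
          using that by (intro \<eta>(5)) (auto simp: KA_def)
      qed
      then show False using z by simp
    qed
    moreover have "norm (snd z) \<le> b * \<bar>fst z\<bar>"
    proof (rule ccontr)
      assume "\<not> ?thesis"
      then have zT: "z \<in> {z. b * \<bar>fst z\<bar> < norm (snd z)}" by auto
      have "D\<eta> z = 0"
      proof (rule GDERIV_locally_const[OF \<eta>(1) _ zT])
        show "open {z :: real \<times> 'b. b * \<bar>fst z\<bar> < norm (snd z)}"
          by (intro open_Collect_less continuous_intros)
        show "\<eta> w = 0" if "w \<in> {z. b * \<bar>fst z\<bar> < norm (snd z)}" for w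
          using that \<eta>(7) by (intro \<eta>(8)) (auto simp: UA_def)
      qed
      then show False using z by simp
    qed
    ultimately show ?thesis using tb by (intro \<zeta>(5)) (simp add: KB_def)
  qed
  \<comment> \<open>If |x - x_P| were below \<sigma>0 / 8, spacelike separation would give |t| \<ge>
    3/4, hence |x| > 3 \<sigma>0 / 4, against |x| < \<sigma>0 / 8 + \<sigma>0 / 2.\<close>
  have radial: "\<rho> \<le> (norm (snd (z - P)))\<^sup>2" if z: "z \<in> K\<zeta>" "quadrance (z - P) > 0" for z
  proof -
    have zB: "\<sigma>0 * \<bar>fst z\<bar> < norm (snd z)" "fst z < 0" using z(1) \<zeta>(7) U_D[of z] by (auto simp: UB_def)
    have "\<bar>fst z - fst P\<bar> < norm (snd z - snd P)" using z(2) by (rule spacelike_separation)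
    moreover have "norm (snd z) \<le> norm (snd z - snd P) + norm (snd P)"
      using norm_triangle_ineq[of "snd z - snd P" "snd P"] by simp
    ultimately have "\<sigma>0 / 8 \<le> norm (snd z - snd P)"
    proof (rule_tac ccontr)
      assume *: "\<bar>fst z - fst P\<bar> < norm (snd z - snd P)" "norm (snd z) \<le> norm (snd z - snd P) + norm (snd P)"
        "\<not> \<sigma>0 / 8 \<le> norm (snd z - snd P)"
      have "3 / 4 \<le> \<bar>fst z\<bar>" using * P(1) zB(2) \<sigma> by linarith
      then have "\<sigma>0 * (3 / 4) \<le> \<sigma>0 * \<bar>fst z\<bar>" using \<sigma> by (intro mult_left_mono) auto
      then show False using * zB(1) P(2) \<sigma> by linarith
    qed
    then show ?thesis unfolding \<rho>_def using \<sigma> by (intro power_mono) auto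
  qed
  define c where "c = (real DIM('b) - 1) / 2 + k"
  have \<kappa>0_eq: "real DIM('b) + 1 - (p + 1) * c + 2 * k = \<kappa>0"
  proof -
    have "(p - 1) * k = \<kappa>0" using p by (simp add: k_def)
    then show ?thesis by (simp add: c_def \<kappa>0_def field_simps)
  qed
  define \<kappa> where "\<kappa> = \<kappa>0 / M"
  define w where "w = (M\<^sup>2) powr k"
  define C0 where "C0 = w * M * (M + c) + M\<^sup>2 * w / 2 + k / M\<^sup>2 * (w * M\<^sup>2)
    + M\<^sup>2 * c / (2 * \<rho>) * (w * M\<^sup>2 + 2 * w * M + real DIM('b) * w) + M\<^sup>2 * w / (p + 1) * (1 + M)"
  define m where "m = k / M\<^sup>2 * (r powr k / 8) / (2 + 2 * c\<^sup>2)"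
  have "0 < 2 + 2 * c\<^sup>2" by (intro add_pos_nonneg) auto
  then have m: "m > 0" using k M(1) r unfolding m_def by (intro divide_pos_pos mult_pos_pos) auto
  have "1 \<le> real DIM('b)" using of_nat_mono[OF DIM_ge_Suc0, where 'a = real] by simp
  then have c: "c \<ge> 0" using k unfolding c_def by (intro add_nonneg_nonneg divide_nonneg_pos) auto
  have C0: "C0 \<ge> 0" using k M(1) c p \<rho> by (simp add: C0_def w_def)
  show thesis
  proof (rule that[of \<kappa> "C0 / m"])
    show "\<kappa> > 0" "C0 / m \<ge> 0" using \<kappa>0 M(1) C0 m by (auto simp: \<kappa>_def)
    fix \<phi> V :: "real \<times> 'b \<Rightarrow> real" and D DV D2 and L :: "(real \<times> 'b) set"
    assume "wave_solution (cone_section \<sigma>1) \<phi> V D DV D2 p"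
    then interpret wave_solution U \<phi> V D DV D2 p unfolding U_def .
    assume DV: "\<And>z. z \<in> cone_section \<sigma>1 \<Longrightarrow> norm (DV z) \<le> \<kappa> * V z"
    assume L: "compact L" "L \<subseteq> {z \<in> cone_section \<sigma>1. norm (snd z) \<le> \<sigma>0 * \<bar>fst z\<bar> \<and> r \<le> quadrance (z - P)}"
    have L\<eta>: "\<eta> z = 1" if "z \<in> L" for z
    proof (rule \<eta>(5))
      have z: "z \<in> U" "norm (snd z) \<le> \<sigma>0 * \<bar>fst z\<bar>" "quadrance (z - P) > 0"
        using L(2) that r by (auto simp: U_def)
      have tb: "- T < fst z" "fst z < - (3 / 16)"
        using time_bounds[of \<sigma>1 z P] \<sigma> U_D[OF z(1)] z(3) P(1) PU by (auto simp: T_def)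
      then have "\<sigma>0 * \<bar>fst z\<bar> < a * \<bar>fst z\<bar>" by (intro scale[OF ab(1)]) simp
      then show "z \<in> KA" unfolding KA_def mem_Collect_eq using z(2) tb by (intro conjI; (linarith | simp))
    qed
    have DV_small: "\<bar>DV z \<bullet> (z - P)\<bar> \<le> \<kappa>0 * V z" if "z \<in> K\<eta>" for z
    proof -
      have zU: "z \<in> U" using that \<eta>(7) UA by auto
      have "\<bar>DV z \<bullet> (z - P)\<bar> \<le> norm (DV z) * norm (z - P)" by (rule Cauchy_Schwarz_ineq2)
      also have "\<dots> \<le> (\<kappa> * V z) * M"
        using DV[of z] zU M3[of z] that M(4) V_pos[OF zU] \<open>\<kappa> > 0\<close> by (intro mult_mono) (auto simp: U_def)
      finally show ?thesis using M(1) by (simp add: \<kappa>_def)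
    qed
    have K\<zeta>U: "K\<zeta> \<subseteq> U" using \<zeta>(7) by (auto simp: UB_def)
    have K\<eta>U: "K\<eta> \<subseteq> U" using \<eta>(7) UA by auto
    have est: "m * (LINT z:L|lborel. (D z \<bullet> (z - P))\<^sup>2 + (\<phi> z)\<^sup>2)
      \<le> C0 * (LINT z:K\<zeta>|lborel. N z) + 3 * k * \<epsilon> * (LINT z:K\<eta>|lborel. N z)"
      if \<epsilon>: "\<epsilon> > 0" "2 * \<epsilon> \<le> r powr k" for \<epsilon>
    proof -
      obtain W G H r0 where W: "\<And>r. r > 0 \<Longrightarrow> (W has_real_derivative G r) (at r)"
        "\<And>r. r > 0 \<Longrightarrow> (G has_real_derivative H r) (at r)" "continuous_on {0<..} H"
        "r0 > 0" "\<And>r. 0 < r \<Longrightarrow> r < r0 \<Longrightarrow> W r = 0" "\<And>r. 0 < r \<Longrightarrow> r < r0 \<Longrightarrow> G r = 0"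
        "\<And>r. r > 0 \<Longrightarrow> 0 \<le> W r" "\<And>r. r > 0 \<Longrightarrow> W r \<le> r powr k"
        "\<And>r. r > 0 \<Longrightarrow> 0 \<le> G r" "\<And>r. r > 0 \<Longrightarrow> 0 \<le> (1 - k) * G r + r * H r"
        "\<And>r. r > 0 \<Longrightarrow> 0 \<le> r * G r - k * W r" "\<And>r. r > 0 \<Longrightarrow> r * G r - k * W r \<le> 3 * k * \<epsilon>"
        "\<And>r. r > 0 \<Longrightarrow> 2 * \<epsilon> \<le> r powr k \<Longrightarrow> r powr k / 8 \<le> W r"
        by (rule weight_exists[OF k \<epsilon>(1)]) blast
      interpret wt: weighted_wave_solution U \<phi> V D DV D2 p P k \<epsilon> r0 W G H
        by unfold_locales (use W k in auto)
      have c_eq: "weighted_wave_solution.c TYPE('b) k = c"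
        by (simp add: c_def wt.c_def)
      interpret car: carleman U \<phi> V D DV D2 p P k \<epsilon> r0 W G H \<eta> \<zeta> D\<eta> D\<zeta> K\<eta> K\<zeta> M \<rho>
      proof unfold_locales
        show "\<zeta> z = 1" if "z \<in> wt.S'" "D\<eta> z \<noteq> 0" for z
          using in_KB[of z] that by (simp add: wt.S'_def wt.f_def)
        show "\<rho> \<le> (norm (snd (z - P)))\<^sup>2" if "z \<in> K\<zeta>" "z \<in> wt.S'" for z
          using radial[of z] that by (simp add: wt.S'_def wt.f_def)
        show "norm (z - P) \<le> M" if "z \<in> K\<eta> \<union> K\<zeta>" for z using M3[OF that] M(4) by simp
        show "norm (D\<eta> z) \<le> M" "norm (D\<zeta> z) \<le> M" for z using \<eta>(9)[of z] \<zeta>(9)[of z] M by simp_all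
      qed (use W \<epsilon> \<eta> \<zeta> K\<zeta>U K\<eta>U M(1) \<rho> DV_small in \<open>auto simp: c_eq \<kappa>0_eq\<close>)
      have fL: "r \<le> wt.f z" if "z \<in> L" for z using L(2) that by (auto simp: wt.f_def)
      have "car.m r = m" by (simp add: car.m_def car.c4_def m_def c_eq)
      moreover have "car.C0 = C0"
        by (simp add: car.C0_def car.c2_def car.c3_def car.c4_def car.w_def C0_def w_def c_eq)
      ultimately show ?thesis
        using car.carleman_estimate[OF r \<epsilon>(2) L(1) fL L\<eta>] by (simp add: wt.SF_def)
    qed
    define A where "A = (LINT z:L|lborel. (D z \<bullet> (z - P))\<^sup>2 + (\<phi> z)\<^sup>2)"
    define B where "B = (LINT z:K\<zeta>|lborel. N z)"
    define E where "E = (LINT z:K\<eta>|lborel. N z)"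
    have N_nonneg: "0 \<le> N z" for z by (simp add: N_def)
    have "0 \<le> E" unfolding E_def set_lebesgue_integral_def by (intro integral_nonneg_AE) (auto simp: N_nonneg)
    \<comment> \<open>The limit \<epsilon> to 0 for a fixed solution. \<open>E\<close> is finite
      because \<open>K\<eta>\<close> is compact in the cone, but nothing else is known about it;
      \<open>E + 1\<close> keeps the divisor positive.\<close>
    have "m * A \<le> C0 * B"
    proof (rule field_le_epsilon)
      fix e :: real assume "e > 0"
      define \<epsilon> where "\<epsilon> = min (r powr k / 2) (e / (3 * k * (E + 1)))"
      have pos: "0 < 3 * k * (E + 1)" using k \<open>0 \<le> E\<close> by simp
      have "\<epsilon> > 0" "2 * \<epsilon> \<le> r powr k" using \<open>e > 0\<close> pos r by (auto simp: \<epsilon>_def)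
      from est[OF this] have "m * A \<le> C0 * B + 3 * k * \<epsilon> * E" by (simp add: A_def B_def E_def)
      also have "3 * k * \<epsilon> * E \<le> 3 * k * \<epsilon> * (E + 1)" using k \<open>\<epsilon> > 0\<close> by (intro mult_left_mono) auto
      also have "\<dots> = (3 * k * (E + 1)) * \<epsilon>" by simp
      also have "\<dots> \<le> (3 * k * (E + 1)) * (e / (3 * k * (E + 1)))" using pos by (intro mult_left_mono) (auto simp: \<epsilon>_def)
      also have "\<dots> = e" using k \<open>0 \<le> E\<close> by simp
      finally show "m * A \<le> C0 * B + e" by simp
    qed
    then have AB: "A \<le> C0 / m * B" using m by (simp add: field_simps)
    have LU: "L \<subseteq> U" using L(2) by (auto simp: U_def)
    have contL: "continuous_on L (\<lambda>z. (D z \<bullet> (z - P))\<^sup>2 + (\<phi> z)\<^sup>2)"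
      by (intro continuous_intros continuous_on_subset[OF D_cont LU] continuous_on_subset[OF C1_on_continuous[OF \<phi>_C1] LU])
    have "(\<integral>\<^sup>+z. ennreal ((D z \<bullet> (z - P))\<^sup>2 + (\<phi> z)\<^sup>2) * indicator L z \<partial>lborel) = ennreal A"
      unfolding A_def by (rule nn_integral_compact_eq[OF L(1) contL]) simp
    also have "\<dots> \<le> ennreal (C0 / m * B)" using AB by (rule ennreal_leI)
    also have "\<dots> = ennreal (C0 / m) * ennreal B" using C0 m by (intro ennreal_mult') simp
    also have "ennreal B = (\<integral>\<^sup>+z. ennreal (N z) * indicator K\<zeta> z \<partial>lborel)"
      unfolding B_def by (rule nn_integral_compact_eq[symmetric, OF \<zeta>(6) continuous_on_subset[OF N_cont K\<zeta>U] N_nonneg])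
    also have "\<dots> \<le> (\<integral>\<^sup>+z. ennreal (N z) * indicator UB z \<partial>lborel)"
      using \<zeta>(7) by (intro nn_integral_mono mult_left_mono) (auto simp: indicator_def)
    finally    show "(\<integral>\<^sup>+z. ennreal ((D z \<bullet> (z - P))\<^sup>2 + (\<phi> z)\<^sup>2) * indicator L z \<partial>lborel)
       \<le> ennreal (C0 / m) * outer_energy \<sigma>0 \<sigma>1 D \<phi>"
      by (simp add: N_def UB_def U_def mult_left_mono)
  qed
qed

section \<open>The full gradient from finitely many centres\<close>

lemma norm_sq_eq_sum_Basis: "(norm d)\<^sup>2 = (\<Sum>b\<in>Basis. (d \<bullet> b)\<^sup>2)" for d :: "'a::euclidean_space"
  by (subst power2_norm_eq_inner, subst euclidean_inner) (simp add: power2_eq_square)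

lemma norm_sq_le_directions:
  fixes d z P :: "'a::euclidean_space"
  assumes "h > 0"
  shows "(norm d)\<^sup>2 \<le> (\<Sum>b\<in>Basis. 2 / h\<^sup>2 * ((d \<bullet> (z - P))\<^sup>2 + (d \<bullet> (z - (P + h *\<^sub>R b)))\<^sup>2))"
proof -
  have "(d \<bullet> b)\<^sup>2 \<le> 2 / h\<^sup>2 * ((d \<bullet> (z - P))\<^sup>2 + (d \<bullet> (z - (P + h *\<^sub>R b)))\<^sup>2)" for b
  proof -
    define x y where "x = d \<bullet> (z - P)" and "y = d \<bullet> (z - (P + h *\<^sub>R b))"
    have "d \<bullet> b = (x - y) / h"
      using assms by (simp add: x_def y_def inner_diff_right inner_add_right)
    then have "(d \<bullet> b)\<^sup>2 = (x - y)\<^sup>2 / h\<^sup>2" by (simp add: power_divide)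
    also have "\<dots> \<le> 2 * (x\<^sup>2 + y\<^sup>2) / h\<^sup>2"
      using zero_le_power2[of "x + y"] by (intro divide_right_mono) (simp_all add: power2_sum power2_diff)
    finally show ?thesis by (simp add: x_def y_def)
  qed
  then have "(\<Sum>b\<in>Basis. (d \<bullet> b)\<^sup>2) \<le> (\<Sum>b\<in>Basis. 2 / h\<^sup>2 * ((d \<bullet> (z - P))\<^sup>2 + (d \<bullet> (z - (P + h *\<^sub>R b)))\<^sup>2))"
    by (intro sum_mono)
  then show ?thesis by (simp only: norm_sq_eq_sum_Basis)
qed

text \<open>Differences of the scaling fields about nearby centres \<open>P\<close> and \<open>P + h b\<close> recover the full gradient;
  the two choices \<open>(-1, \<plusminus> \<sigma>0 e / 4)\<close> of \<open>P\<close> cover the two halves of the slab.\<close>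

lemma local_estimate:
  fixes \<sigma>0 \<sigma>1 p :: real
  assumes \<sigma>: "0 < \<sigma>0" "\<sigma>0 < \<sigma>1" "\<sigma>1 < 1" and p: "p > 1" "(p - 1) * (real DIM('b) - 1) < 4"
  obtains h \<kappa> C where "h > 0" "h \<le> 1 / 16" "\<kappa> > 0" "C \<ge> 0"
    "\<And>\<phi> V D DV D2. wave_solution (cone_section \<sigma>1 :: (real \<times> 'b::euclidean_space) set) \<phi> V D DV D2 p \<Longrightarrow>
       (\<And>z. z \<in> cone_section \<sigma>1 \<Longrightarrow> norm (DV z) \<le> \<kappa> * V z) \<Longrightarrow>
       core_energy \<sigma>0 h D \<phi>
       \<le> ennreal C * outer_energy \<sigma>0 \<sigma>1 D \<phi>"
proof -
  \<comment> \<open>The base centres lie at spatial distance \<sigma>0 / 4 = 4 h from the axis,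
    leaving room for shifts of the centre by h and of time by h.\<close>
  define h where "h = \<sigma>0 / 16"
  have h: "h > 0" "h \<le> 1 / 16" using \<sigma> by (auto simp: h_def)
  obtain e :: 'b where e: "norm e = 1" using norm_Basis[OF SOME_Basis] by blast
  define L where "L s = {z :: real \<times> 'b. \<bar>fst z + 1\<bar> \<le> h \<and> norm (snd z) \<le> \<sigma>0 * \<bar>fst z\<bar> \<and> s * (snd z \<bullet> e) \<le> 0}" for s :: real
  define P where "P s = (- 1 :: real, (s * (\<sigma>0 / 4)) *\<^sub>R e)" for s :: real
  define Cs where "Cs s = insert (P s) ((\<lambda>b. P s + h *\<^sub>R b) ` Basis)" for s
  define Anni where "Anni = {z :: real \<times> 'b. z \<in> cone_section \<sigma>1 \<and> \<sigma>0 * \<bar>fst z\<bar> < norm (snd z)}"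
  have comp_L: "compact (L s)" for s
  proof -
    have "L s = {z. - 1 - h \<le> fst z \<and> fst z \<le> - 1 + h \<and> 0 * \<bar>fst z\<bar> \<le> norm (snd z) \<and> norm (snd z) \<le> \<sigma>0 * \<bar>fst z\<bar>}
        \<inter> {z. s * (snd z \<bullet> e) \<le> 0}"
      by (auto simp: L_def abs_le_iff)
    moreover have "closed {z :: real \<times> 'b. s * (snd z \<bullet> e) \<le> 0}" by (intro closed_Collect_le continuous_intros)
    ultimately show ?thesis using \<sigma> by (simp only:) (intro compact_Int_closed compact_cone_part less_imp_le)
  qed
  have near: "\<exists>v. Q = P s + v \<and> norm v \<le> h" if Q: "Q \<in> Cs s" for Q s
  proof -
    consider "Q = P s" | b where "b \<in> Basis" "Q = P s + h *\<^sub>R b" using Q unfolding Cs_def by blast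
    then show ?thesis
    proof cases
      case 1
      then show ?thesis using h by (intro exI[of _ 0]) simp
    next
      case 2
      then show ?thesis using h norm_Basis[OF 2(1)] by (intro exI[of _ "h *\<^sub>R b"]) simp
    qed
  qed
  have L_cone: "L s \<subseteq> cone_section \<sigma>1" for s
  proof
    show "z \<in> cone_section \<sigma>1" if "z \<in> L s" for z
      by (rule mem_cone_section[OF \<sigma>]) (use that h in \<open>auto simp: L_def\<close>)
  qed
  have center: "\<bar>fst Q + 1\<bar> \<le> 1 / 8" "norm (snd Q) \<le> \<sigma>0 / 2" if Q: "Q \<in> Cs s" and s: "\<bar>s\<bar> = 1" for Q s
  proof -
    obtain v where v: "Q = P s + v" "norm v \<le> h" using near[OF Q] by blast
    have nv: "\<bar>fst v\<bar> \<le> h" "norm (snd v) \<le> h"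
      using v(2) norm_fst_le[of "fst v" "snd v"] norm_snd_le[of "snd v" "fst v"] by auto
    then show "\<bar>fst Q + 1\<bar> \<le> 1 / 8" using h by (simp add: v P_def)
    have "snd Q = (s * (\<sigma>0 / 4)) *\<^sub>R e + snd v" by (simp add: v P_def)
    then have "norm (snd Q) \<le> norm ((s * (\<sigma>0 / 4)) *\<^sub>R e) + norm (snd v)"
      by (simp only: norm_triangle_ineq)
    also have "norm ((s * (\<sigma>0 / 4)) *\<^sub>R e) = \<sigma>0 / 4" using s e \<sigma> by (simp add: abs_mult)
    finally show "norm (snd Q) \<le> \<sigma>0 / 2" using nv \<sigma> by (simp add: h_def)
  qed
  \<comment> \<open>On \<open>L s\<close> the point x lies in the half space opposite to the base
    centre x0, so |x - x0| \<ge> |x0| = 4 h. Shifting the centre by at most h leaves 3 h in space,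
    while the time difference is at most 2 h, and 9 h^2 - 4 h^2 = 5 h^2.\<close>
  have sep: "5 * h\<^sup>2 \<le> quadrance (z - Q)" if Q: "Q \<in> Cs s" and s: "\<bar>s\<bar> = 1" and z: "z \<in> L s" for Q s z
  proof -
    obtain v where v: "Q = P s + v" "norm v \<le> h" using near[OF Q] by blast
    have nv: "\<bar>fst v\<bar> \<le> h" "norm (snd v) \<le> h"
      using v(2) norm_fst_le[of "fst v" "snd v"] norm_snd_le[of "snd v" "fst v"] by auto
    define x0 where "x0 = (s * (\<sigma>0 / 4)) *\<^sub>R e"
    have x0: "norm x0 = 4 * h" using s e \<sigma> by (simp add: x0_def abs_mult h_def)
    have "snd z \<bullet> x0 = \<sigma>0 / 4 * (s * (snd z \<bullet> e))" by (simp add: x0_def)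
    also have "\<dots> \<le> 0" by (rule mult_nonneg_nonpos) (use z \<sigma> in \<open>auto simp: L_def\<close>)
    finally have "snd z \<bullet> x0 \<le> 0" .
    moreover have "(norm (snd z - x0))\<^sup>2 = snd z \<bullet> snd z - 2 * (snd z \<bullet> x0) + (norm x0)\<^sup>2"
      unfolding power2_norm_eq_inner by (simp add: inner_diff_left inner_diff_right inner_commute)
    ultimately have "(norm x0)\<^sup>2 \<le> (norm (snd z - x0))\<^sup>2"
      using inner_ge_zero[of "snd z"] by linarith
    then have "4 * h \<le> norm (snd z - x0)" unfolding x0[symmetric] by (rule power2_le_imp_le) simp
    also have "\<dots> \<le> norm (snd (z - Q)) + norm (snd v)"
    proof -
      have "snd z - x0 = snd (z - Q) + snd v" by (simp add: v P_def x0_def)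
      then show ?thesis by (simp only: norm_triangle_ineq)
    qed
    finally have 1: "3 * h \<le> norm (snd (z - Q))" using nv by linarith
    have "fst (z - Q) = (fst z + 1) - fst v" "\<bar>fst z + 1\<bar> \<le> h" using z by (simp_all add: v P_def L_def)
    then have 2: "\<bar>fst (z - Q)\<bar> \<le> 2 * h" using nv by linarith
    have "(3 * h)\<^sup>2 \<le> (norm (snd (z - Q)))\<^sup>2" using 1 h by (intro power_mono) auto
    moreover have "(fst (z - Q))\<^sup>2 \<le> (2 * h)\<^sup>2" using power_mono[OF 2, of 2] by simp
    moreover have "(3 * h)\<^sup>2 - (2 * h)\<^sup>2 = 5 * h\<^sup>2" by (simp add: power2_eq_square)
    ultimately show ?thesis unfolding quadrance_eq by linarith
  qed
  define good where "good Q s \<kappa> C \<longleftrightarrow> (\<forall>\<phi> V D DV D2. wave_solution (cone_section \<sigma>1 :: (real \<times> 'b) set) \<phi> V D DV D2 p \<longrightarrow>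
       (\<forall>z. z \<in> cone_section \<sigma>1 \<longrightarrow> norm (DV z) \<le> \<kappa> * V z) \<longrightarrow>
       (\<integral>\<^sup>+z. ennreal ((D z \<bullet> (z - Q))\<^sup>2 + (\<phi> z)\<^sup>2) * indicator (L s) z \<partial>lborel)
       \<le> ennreal C * (\<integral>\<^sup>+z. ennreal ((norm (D z))\<^sup>2 + (\<phi> z)\<^sup>2) * indicator Anni z \<partial>lborel))" for Q s \<kappa> C
  have "\<exists>\<kappa> C. \<kappa> > 0 \<and> C \<ge> 0 \<and> good Q s \<kappa> C" if Q: "Q \<in> Cs s" and s: "\<bar>s\<bar> = 1" for Q s
  proof -
    have pos: "5 * h\<^sup>2 > 0" using h by simp
    have sub: "L s \<subseteq> {z \<in> cone_section \<sigma>1. norm (snd z) \<le> \<sigma>0 * \<bar>fst z\<bar> \<and> 5 * h\<^sup>2 \<le> quadrance (z - Q)}"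
      using L_cone[of s] sep[OF Q s] by (auto simp: L_def)
    show ?thesis
    proof (rule center_estimate[OF \<sigma> p center[OF Q s] pos])
      fix \<kappa> C :: real
      assume \<kappa>C: "\<kappa> > 0" "C \<ge> 0"
        and *: "\<And>\<phi> V D DV D2 L. wave_solution (cone_section \<sigma>1) \<phi> V D DV D2 p \<Longrightarrow>
       (\<And>z. z \<in> cone_section \<sigma>1 \<Longrightarrow> norm (DV z) \<le> \<kappa> * V z) \<Longrightarrow>
       compact L \<Longrightarrow> L \<subseteq> {z \<in> cone_section \<sigma>1. norm (snd z) \<le> \<sigma>0 * \<bar>fst z\<bar> \<and> 5 * h\<^sup>2 \<le> quadrance (z - Q)} \<Longrightarrow>
       (\<integral>\<^sup>+z. ennreal ((D z \<bullet> (z - Q))\<^sup>2 + (\<phi> z)\<^sup>2) * indicator L z \<partial>lborel)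
       \<le> ennreal C * outer_energy \<sigma>0 \<sigma>1 D \<phi>"
      have "good Q s \<kappa> C"
        unfolding good_def Anni_def by (intro allI impI, rule *[OF _ _ comp_L sub], assumption, blast)
      with \<kappa>C show ?thesis by blast
    qed
  qed
  then obtain \<kappa>f Cf where \<kappa>C: "\<And>Q s. Q \<in> Cs s \<Longrightarrow> \<bar>s\<bar> = 1 \<Longrightarrow> \<kappa>f Q s > 0 \<and> Cf Q s \<ge> (0::real) \<and> good Q s (\<kappa>f Q s) (Cf Q s)"
    by metis
  \<comment> \<open>Only finitely many centres occur, so a smallest \<kappa> and a largest C serve
    all of them.\<close>
  define I where "I = (Cs 1 \<times> {1::real}) \<union> (Cs (- 1) \<times> {- 1})"
  have I: "finite I" "I \<noteq> {}" by (auto simp: I_def Cs_def)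
  define \<kappa> where "\<kappa> = Min ((\<lambda>(Q, s). \<kappa>f Q s) ` I)"
  define C where "C = Max ((\<lambda>(Q, s). Cf Q s) ` I)"
  have \<kappa>: "\<kappa> > 0" unfolding \<kappa>_def using I \<kappa>C by (subst Min_gr_iff) (auto simp: I_def)
  have in_I: "\<kappa> \<le> \<kappa>f Q s" "Cf Q s \<le> C" if "Q \<in> Cs s" "s = 1 \<or> s = - 1" for Q s
    using I(1) that unfolding \<kappa>_def C_def by (force intro!: Min_le Max_ge simp: I_def)+
  have C: "C \<ge> 0" using in_I(2)[of "P 1" 1] \<kappa>C[of "P 1" 1] by (simp add: Cs_def)
  \<comment> \<open>The first summand accounts for \<phi>^2 at the base centre; each basis direction
    then needs two centres and the factor 2 / h^2.\<close>
  define C' where "C' = C + real DIM(real \<times> 'b) * (2 / h\<^sup>2 * (C + C))"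
  have C': "C' \<ge> 0" using C by (simp add: C'_def)
  show thesis
  proof (rule that[of h \<kappa> "C' + C'"])
    show "h > 0" "h \<le> 1 / 16" "\<kappa> > 0" "C' + C' \<ge> 0" by (use h \<kappa> C' in auto)
    fix \<phi> V :: "real \<times> 'b \<Rightarrow> real" and D DV D2
    assume sol: "wave_solution (cone_section \<sigma>1) \<phi> V D DV D2 p"
      and DV: "\<And>z. z \<in> cone_section \<sigma>1 \<Longrightarrow> norm (DV z) \<le> \<kappa> * V z"
    interpret wave_solution "cone_section \<sigma>1" \<phi> V D DV D2 p by (rule sol)
    define A where "A = (\<integral>\<^sup>+z. ennreal ((norm (D z))\<^sup>2 + (\<phi> z)\<^sup>2) * indicator Anni z \<partial>lborel)"
    define g where "g Q z = (D z \<bullet> (z - Q))\<^sup>2 + (\<phi> z)\<^sup>2" for Q z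
    have g_nonneg: "0 \<le> g Q z" for Q z by (simp add: g_def)
    have gA: "(\<integral>\<^sup>+z. ennreal (g Q z) * indicator (L s) z \<partial>lborel) \<le> ennreal C * A"
      if "Q \<in> Cs s" "s = 1 \<or> s = - 1" for Q s
    proof -
      have "norm (DV z) \<le> \<kappa>f Q s * V z" if z: "z \<in> cone_section \<sigma>1" for z
        using DV[OF z] mult_right_mono[OF in_I(1)[OF \<open>Q \<in> Cs s\<close> \<open>s = 1 \<or> s = - 1\<close>], of "V z"] V_pos[OF z] by linarith
      moreover have good: "good Q s (\<kappa>f Q s) (Cf Q s)" using \<kappa>C[OF that(1)] that(2) by auto
      ultimately have "(\<integral>\<^sup>+z. ennreal (g Q z) * indicator (L s) z \<partial>lborel) \<le> ennreal (Cf Q s) * A"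
        using good[unfolded good_def, rule_format, OF sol] by (simp only: g_def A_def)
      also have "\<dots> \<le> ennreal C * A" using in_I(2)[OF that] by (intro mult_right_mono ennreal_leI) auto
      finally show ?thesis .
    qed
    have meas: "(\<lambda>z. ennreal (g Q z) * indicator (L s) z) \<in> borel_measurable lborel" for Q s
    proof -
      have "continuous_on (L s) (g Q)"
        unfolding g_def using L_cone[of s]
        by (intro continuous_intros continuous_on_subset[OF D_cont] continuous_on_subset[OF C1_on_continuous[OF \<phi>_C1]])
      from borel_measurable_ennreal_indicator[OF borel_compact[OF comp_L] this] show ?thesis by simp
    qed
    have half: "(\<integral>\<^sup>+z. ennreal (N z) * indicator (L s) z \<partial>lborel) \<le> ennreal C' * A" if s: "s = 1 \<or> s = - 1" for s
    proof -
      have PC: "P s \<in> Cs s" "\<And>b. b \<in> Basis \<Longrightarrow> P s + h *\<^sub>R b \<in> Cs s" by (auto simp: Cs_def)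
      define gi where "gi Q z = ennreal (g Q z) * indicator (L s) z" for Q z
      have "(\<integral>\<^sup>+z. ennreal (N z) * indicator (L s) z \<partial>lborel)
          \<le> (\<integral>\<^sup>+z. gi (P s) z + (\<Sum>b\<in>Basis. ennreal (2 / h\<^sup>2) * (gi (P s) z + gi (P s + h *\<^sub>R b) z)) \<partial>lborel)"
      proof (rule nn_integral_mono)
        fix z
        show "ennreal (N z) * indicator (L s) z \<le> gi (P s) z + (\<Sum>b\<in>Basis. ennreal (2 / h\<^sup>2) * (gi (P s) z + gi (P s + h *\<^sub>R b) z))"
        proof (cases "z \<in> L s")
          case True
          have "(norm (D z))\<^sup>2 \<le> (\<Sum>b\<in>Basis. 2 / h\<^sup>2 * ((D z \<bullet> (z - P s))\<^sup>2 + (D z \<bullet> (z - (P s + h *\<^sub>R b)))\<^sup>2))"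
            by (rule norm_sq_le_directions[OF h(1)])
          also have "\<dots> \<le> (\<Sum>b\<in>Basis. 2 / h\<^sup>2 * (g (P s) z + g (P s + h *\<^sub>R b) z))"
            by (intro sum_mono mult_left_mono add_mono) (auto simp: g_def)
          finally have "(norm (D z))\<^sup>2 \<le> (\<Sum>b\<in>Basis. 2 / h\<^sup>2 * (g (P s) z + g (P s + h *\<^sub>R b) z))" .
          moreover have "(\<phi> z)\<^sup>2 \<le> g (P s) z" by (simp add: g_def)
          ultimately have "N z \<le> g (P s) z + (\<Sum>b\<in>Basis. 2 / h\<^sup>2 * (g (P s) z + g (P s + h *\<^sub>R b) z))"
            unfolding N_def by linarith
          then have "ennreal (N z) \<le> ennreal (g (P s) z + (\<Sum>b\<in>Basis. 2 / h\<^sup>2 * (g (P s) z + g (P s + h *\<^sub>R b) z)))"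
            by (rule ennreal_leI)
          also have "\<dots> = ennreal (g (P s) z) + (\<Sum>b\<in>Basis. ennreal (2 / h\<^sup>2) * (ennreal (g (P s) z) + ennreal (g (P s + h *\<^sub>R b) z)))"
          proof -
            have h2: "0 \<le> 2 / h\<^sup>2" by simp
            have "ennreal (2 / h\<^sup>2 * (g (P s) z + g Q z)) = ennreal (2 / h\<^sup>2) * (ennreal (g (P s) z) + ennreal (g Q z))" for Q
              unfolding ennreal_mult[OF h2 add_nonneg_nonneg[OF g_nonneg g_nonneg]] ennreal_plus[OF g_nonneg g_nonneg] ..
            moreover have "0 \<le> 2 / h\<^sup>2 * (g (P s) z + g Q z)" for Q using h2 g_nonneg by (intro mult_nonneg_nonneg add_nonneg_nonneg)
            ultimately show ?thesis by (simp only: ennreal_plus[OF g_nonneg sum_nonneg] sum_ennreal[symmetric])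
          qed
          finally show ?thesis using True by (simp add: gi_def)
        qed (simp add: gi_def)
      qed
      also have "\<dots> = (\<integral>\<^sup>+z. gi (P s) z \<partial>lborel)
          + (\<Sum>b\<in>Basis. ennreal (2 / h\<^sup>2) * ((\<integral>\<^sup>+z. gi (P s) z \<partial>lborel) + (\<integral>\<^sup>+z. gi (P s + h *\<^sub>R b) z \<partial>lborel)))"
        using meas unfolding gi_def[abs_def]
        by (simp add: nn_integral_add nn_integral_sum nn_integral_cmult)
      also have "\<dots> \<le> ennreal C * A + (\<Sum>b\<in>(Basis :: (real \<times> 'b) set). ennreal (2 / h\<^sup>2) * (ennreal C * A + ennreal C * A))"
        unfolding gi_def using gA[OF PC(1) s] gA[OF PC(2) s]
        by (intro add_mono sum_mono mult_left_mono) auto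
      also have "\<dots> = ennreal C' * A"
      proof -
        define d h2 where "d = real DIM(real \<times> 'b)" and "h2 = 2 / h\<^sup>2"
        have d: "0 \<le> d" and h2: "0 \<le> h2" by (simp_all add: d_def h2_def)
        have "ennreal C' = ennreal C + ennreal d * (ennreal h2 * (ennreal C + ennreal C))"
          unfolding C'_def d_def[symmetric] h2_def[symmetric]
            ennreal_plus[OF C mult_nonneg_nonneg[OF d mult_nonneg_nonneg[OF h2 add_nonneg_nonneg[OF C C]]]]
            ennreal_mult[OF d mult_nonneg_nonneg[OF h2 add_nonneg_nonneg[OF C C]]]
            ennreal_mult[OF h2 add_nonneg_nonneg[OF C C]] ennreal_plus[OF C C] ..
        then show ?thesis
          unfolding sum_constant ennreal_of_nat_eq_real_of_nat d_def[symmetric] h2_def[symmetric]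
          by (simp only: distrib_right distrib_left mult.assoc)
      qed
      finally show ?thesis .
    qed
    define R where "R = {z :: real \<times> 'b. \<bar>fst z + 1\<bar> \<le> h \<and> norm (snd z) \<le> \<sigma>0 * \<bar>fst z\<bar>}"
    have measN: "(\<lambda>z. ennreal (N z) * indicator (L s) z) \<in> borel_measurable lborel" for s
      using borel_measurable_ennreal_indicator[OF borel_compact[OF comp_L] continuous_on_subset[OF N_cont L_cone]] by simp
    have "(\<integral>\<^sup>+z. ennreal (N z) * indicator R z \<partial>lborel)
        \<le> (\<integral>\<^sup>+z. ennreal (N z) * indicator (L 1) z + ennreal (N z) * indicator (L (- 1)) z \<partial>lborel)"
      by (intro nn_integral_mono) (auto simp: R_def L_def indicator_def)
    also have "\<dots> = (\<integral>\<^sup>+z. ennreal (N z) * indicator (L 1) z \<partial>lborel) + (\<integral>\<^sup>+z. ennreal (N z) * indicator (L (- 1)) z \<partial>lborel)"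
      by (intro nn_integral_add measN)
    also have "\<dots> \<le> ennreal C' * A + ennreal C' * A" by (intro add_mono half) auto
    also have "\<dots> = ennreal (C' + C') * A" by (simp only: ennreal_plus[OF C' C'] distrib_right)
    finally show "core_energy \<sigma>0 h D \<phi>
       \<le> ennreal (C' + C') * outer_energy \<sigma>0 \<sigma>1 D \<phi>"
      by (simp add: N_def R_def A_def Anni_def)
  qed
qed

section \<open>Rescaling and the main theorem\<close>

lemma C1_on_closureE:
  fixes V :: "'a::euclidean_space \<Rightarrow> real"
  assumes "C1_on_closure S V" "bounded S"
  obtains DV M where "\<And>z. z \<in> S \<Longrightarrow> GDERIV V z :> DV z" "continuous_on S DV" "M > 0" "\<And>z. z \<in> S \<Longrightarrow> norm (DV z) \<le> M"
proof -
  obtain V' :: "'a \<Rightarrow> 'a \<Rightarrow>\<^sub>L real" where V': "\<And>z. z \<in> S \<Longrightarrow> (V has_derivative blinfun_apply (V' z)) (at z)"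
    "continuous_on (closure S) V'"
    using assms(1) unfolding C1_on_closure_def by blast
  have cont: "continuous_on S V'" by (rule continuous_on_subset[OF V'(2) closure_subset])
  then have "C1_on S V" using V'(1) unfolding C1_on_def by blast
  then obtain DV where DV: "\<And>z. z \<in> S \<Longrightarrow> GDERIV V z :> DV z" "continuous_on S DV"
    by (rule C1_on_gradientE) metis
  have "bounded (V' ` closure S)"
    using assms(2) by (intro compact_imp_bounded compact_continuous_image V'(2)) (simp add: compact_closure)
  then obtain M where M: "M > 0" "\<And>z. z \<in> closure S \<Longrightarrow> norm (V' z) \<le> M" by (auto simp: bounded_pos)
  have "norm (DV z) \<le> M" if "z \<in> S" for z
  proof -
    have "blinfun_apply (V' z) = (\<lambda>h. h \<bullet> DV z)"
      using has_derivative_unique[OF V'(1)[OF that] DV(1)[OF that, unfolded gderiv_def]] .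
    then have "norm (DV z) * norm (DV z) \<le> norm (V' z) * norm (DV z)"
      using norm_blinfun[of "V' z" "DV z"] by (simp add: power2_norm_eq_inner[symmetric] power2_eq_square)
    then have "norm (DV z) \<le> norm (V' z)" by (cases "DV z = 0") auto
    also have "\<dots> \<le> M" using M(2)[of z] closure_subset that by auto
    finally show ?thesis .
  qed
  with DV M(1) that show thesis by blast
qed

lemma C2_on_gradientE:
  fixes \<phi> :: "'a::euclidean_space \<Rightarrow> real"
  assumes "C2_on S \<phi>"
  obtains D D2 where "\<And>z. z \<in> S \<Longrightarrow> GDERIV \<phi> z :> D z" "\<And>z. z \<in> S \<Longrightarrow> (D has_derivative D2 z) (at z)"
    "\<And>h. continuous_on S (\<lambda>z. D2 z h)"
proof -
  obtain f' :: "'a \<Rightarrow> 'a \<Rightarrow>\<^sub>L real" where f': "\<And>z. z \<in> S \<Longrightarrow> (\<phi> has_derivative blinfun_apply (f' z)) (at z)"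
    "C1_on S f'"
    using assms unfolding C2_on_def by blast
  obtain f'' where f'': "\<And>z. z \<in> S \<Longrightarrow> (f' has_derivative f'' z) (at z)" "\<And>h. continuous_on S (\<lambda>z. f'' z h)"
    using C1_onE[OF f'(2)] by metis
  define D where "D z = (\<Sum>b\<in>Basis. blinfun_apply (f' z) b *\<^sub>R b)" for z
  define D2 where "D2 z h = (\<Sum>b\<in>Basis. blinfun_apply (f'' z h) b *\<^sub>R b)" for z h
  have "GDERIV \<phi> z :> D z" if "z \<in> S" for z
    unfolding gderiv_def D_def
    by (rule has_derivative_eq_rhs[OF f'(1)[OF that] bounded_linear_functional_inner])
       (rule blinfun.bounded_linear_right)
  moreover have "(D has_derivative D2 z) (at z)" if "z \<in> S" for z
    unfolding D_def D2_def
    by (intro has_derivative_sum has_derivative_scaleR_left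
        bounded_linear.has_derivative[OF blinfun.bounded_linear_left f''(1)[OF that]])
  moreover have "continuous_on S (\<lambda>z. D2 z h)" for h
    unfolding D2_def by (intro continuous_intros f''(2))
  ultimately show thesis by (rule that)
qed

lemma partial_deriv_eq:
  assumes "(f has_derivative f') (at z)"
  shows "partial_deriv v f z = f' v"
proof -
  interpret bounded_linear f' using assms by (rule has_derivative_bounded_linear)
  have "((\<lambda>s. z + s *\<^sub>R v) has_derivative (\<lambda>s. s *\<^sub>R v)) (at 0)" by (auto intro!: derivative_eq_intros)
  from has_derivative_compose[OF this, of f f'] assms
  have "((\<lambda>s. f (z + s *\<^sub>R v)) has_derivative (\<lambda>s. f' (s *\<^sub>R v))) (at 0)" by simp
  then have "((\<lambda>s. f (z + s *\<^sub>R v)) has_real_derivative f' v) (at 0)"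
    unfolding has_field_derivative_def by (rule has_derivative_eq_rhs) (auto simp: scaleR fun_eq_iff)
  then show ?thesis unfolding partial_deriv_def by (rule DERIV_imp_deriv)
qed

lemma second_partial_deriv_eq:
  assumes "open S" "z \<in> S" "\<And>w. w \<in> S \<Longrightarrow> GDERIV f w :> D w" "(D has_derivative D2) (at z)"
  shows "partial_deriv v (partial_deriv v f) z = D2 v \<bullet> v"
proof -
  have "((\<lambda>w. v \<bullet> D w) has_derivative (\<lambda>h. v \<bullet> D2 h)) (at z)"
    using assms(4) by (auto intro!: derivative_eq_intros)
  then have "((\<lambda>w. v \<bullet> D w) has_derivative (\<lambda>h. D2 h \<bullet> v)) (at z)" by (simp add: inner_commute)
  then have "(partial_deriv v f has_derivative (\<lambda>h. D2 h \<bullet> v)) (at z)"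
  proof (rule has_derivative_transform_within_open[OF _ assms(1,2)])
    show "v \<bullet> D w = partial_deriv v f w" if "w \<in> S" for w
      using partial_deriv_eq[OF assms(3)[OF that, unfolded gderiv_def]] by simp
  qed
  then show ?thesis by (rule partial_deriv_eq)
qed

lemma sum_Basis_spacetime:
  fixes g :: "real \<times> (real ^ 'n) \<Rightarrow> real"
  shows "(\<Sum>b\<in>Basis. g b) = g (1, 0) + (\<Sum>i\<in>UNIV. g (0, axis i 1))"
proof -
  have B: "(Basis :: (real ^ 'n) set) = range (\<lambda>i. axis i 1)" by (auto simp: Basis_vec_def)
  have "inj (\<lambda>i::'n. axis i (1::real))" by (auto simp: inj_on_def axis_eq_axis)
  then have "(\<Sum>i\<in>(Basis :: (real ^ 'n) set). g (0, i)) = (\<Sum>i\<in>UNIV. g (0, axis i 1))"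
    unfolding B by (simp add: sum.reindex)
  then show ?thesis by (simp add: sum_Basis_prod)
qed

lemma grad_sq_eq:
  assumes "GDERIV \<phi> z :> d"
  shows "grad_sq \<phi> z = (norm d)\<^sup>2"
proof -
  have "partial_deriv v \<phi> z = d \<bullet> v" for v
    using partial_deriv_eq[OF assms[unfolded gderiv_def]] by (simp add: inner_commute)
  then show ?thesis
    by (simp add: norm_sq_eq_sum_Basis grad_sq_def time_deriv_def space_deriv_def sum_Basis_spacetime)
qed

lemma wave_op_eq:
  assumes "open S" "z \<in> S" "\<And>w. w \<in> S \<Longrightarrow> GDERIV \<phi> w :> D w" "(D has_derivative D2) (at z)"
  shows "wave_op \<phi> z = (\<Sum>b\<in>Basis. time_reflection (D2 b) \<bullet> b)"
proof -
  have "time_reflection (D2 (1, 0)) \<bullet> (1, 0) = - (D2 (1, 0) \<bullet> (1, 0))"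
    "\<And>i. time_reflection (D2 (0, axis i 1)) \<bullet> (0, axis i 1) = D2 (0, axis i 1) \<bullet> (0, axis i 1)"
    by (simp_all add: time_reflection_def inner_prod_def)
  moreover have "partial_deriv v (partial_deriv v \<phi>) z = D2 v \<bullet> v" for v
    by (rule second_partial_deriv_eq[OF assms])
  ultimately show ?thesis
    unfolding wave_op_def time_deriv_def space_deriv_def sum_Basis_spacetime by simp
qed

section \<open>Scaling of solutions and of integrals\<close>

lemma GDERIV_scale:
  assumes "GDERIV f (c *\<^sub>R z) :> d"
  shows "GDERIV (\<lambda>w. f (c *\<^sub>R w)) z :> c *\<^sub>R d"
proof -
  have "((\<lambda>w. c *\<^sub>R w) has_derivative (\<lambda>h. c *\<^sub>R h)) (at z)" by (auto intro!: derivative_eq_intros)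
  from has_derivative_compose[OF this assms[unfolded gderiv_def]] show ?thesis
    by (simp add: gderiv_def)
qed

text \<open>Replacing \<phi> by l^a \<phi>(l z) multiplies the wave operator by l^(a+2) and the
  nonlinearity by l^(a p), and these agree exactly when a (p - 1) = 2. The gradient of V(l z)
  acquires a factor l, which makes the variation of \<open>V\<close> small near the tip.\<close>

lemma wave_solution_rescale:
  assumes "wave_solution S \<phi> V D DV D2 p" and l: "l > 0" and U: "open U" "\<And>z. z \<in> U \<Longrightarrow> l *\<^sub>R z \<in> S"
    and a: "a * (p - 1) = 2"
  shows "wave_solution U (\<lambda>z. l powr a * \<phi> (l *\<^sub>R z)) (\<lambda>z. V (l *\<^sub>R z)) (\<lambda>z. l powr (a + 1) *\<^sub>R D (l *\<^sub>R z))
    (\<lambda>z. l *\<^sub>R DV (l *\<^sub>R z)) (\<lambda>z h. l powr (a + 2) *\<^sub>R D2 (l *\<^sub>R z) h) p"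
proof -
  interpret wave_solution S \<phi> V D DV D2 p by fact
  have cont: "continuous_on U (\<lambda>z. g (l *\<^sub>R z))" if "continuous_on S g" for g :: "real \<times> 'a \<Rightarrow> real \<times> 'a"
    by (rule continuous_on_compose2[OF that]) (use U in \<open>auto intro!: continuous_intros\<close>)
  have pw: "l powr (a + 1) = l powr a * l" "l powr (a + 2) = l powr a * l\<^sup>2" "l powr (a + 2) = l powr (a + 1) * l"
    using l by (simp_all add: powr_add power2_eq_square)
  show ?thesis
  proof unfold_locales
    fix z assume z: "z \<in> U"
    note zS = U(2)[OF z]
    show "GDERIV (\<lambda>z. l powr a * \<phi> (l *\<^sub>R z)) z :> l powr (a + 1) *\<^sub>R D (l *\<^sub>R z)"
      using GDERIV_mult[OF GDERIV_const[of "l powr a"] GDERIV_scale[OF \<phi>_deriv[OF zS]]] by (simp add: pw)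
    show "GDERIV (\<lambda>z. V (l *\<^sub>R z)) z :> l *\<^sub>R DV (l *\<^sub>R z)" by (rule GDERIV_scale[OF V_deriv[OF zS]])
    have lin: "D2 (l *\<^sub>R z) (l *\<^sub>R h) = l *\<^sub>R D2 (l *\<^sub>R z) h" for h
      using D_deriv[OF zS] by (intro linear_scale has_derivative_linear)
    have "((\<lambda>w. l *\<^sub>R w) has_derivative (\<lambda>h. l *\<^sub>R h)) (at z)" by (auto intro!: derivative_eq_intros)
    from has_derivative_scaleR_right[OF has_derivative_compose[OF this D_deriv[OF zS]], of "l powr (a + 1)"]
    show "((\<lambda>z. l powr (a + 1) *\<^sub>R D (l *\<^sub>R z)) has_derivative (\<lambda>h. l powr (a + 2) *\<^sub>R D2 (l *\<^sub>R z) h)) (at z)"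
      by (simp add: lin pw(3))
    show "0 < V (l *\<^sub>R z)" by (rule V_pos[OF zS])
    have "(l powr a) powr (p - 1) = l\<^sup>2" using l a by (simp add: powr_powr)
    then have nonlin: "\<bar>l powr a * \<phi> (l *\<^sub>R z)\<bar> powr (p - 1) * (l powr a * \<phi> (l *\<^sub>R z))
        = l powr (a + 2) * (\<bar>\<phi> (l *\<^sub>R z)\<bar> powr (p - 1) * \<phi> (l *\<^sub>R z))"
      using l by (simp add: abs_mult powr_mult pw(2))
    have box: "(\<Sum>b\<in>Basis. time_reflection (l powr (a + 2) *\<^sub>R D2 (l *\<^sub>R z) b) \<bullet> b)
       = l powr (a + 2) * (\<Sum>b\<in>Basis. time_reflection (D2 (l *\<^sub>R z) b) \<bullet> b)"
      by (simp add: linear_scale[OF bounded_linear.linear[OF bounded_linear_time_reflection]] sum_distrib_left)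
    show "(\<Sum>b\<in>Basis. time_reflection (l powr (a + 2) *\<^sub>R D2 (l *\<^sub>R z) b) \<bullet> b)
        + V (l *\<^sub>R z) * (\<bar>l powr a * \<phi> (l *\<^sub>R z)\<bar> powr (p - 1) * (l powr a * \<phi> (l *\<^sub>R z))) = 0"
      unfolding nonlin box mult.left_commute[of "V (l *\<^sub>R z)"] distrib_left[symmetric]
      using wave_eq[OF zS] by (simp only: mult.left_commute[of "V (l *\<^sub>R z)"] mult_zero_right)
  qed (use U(1) p in \<open>auto intro!: continuous_intros cont D2_cont DV_cont\<close>)
qed

lemma nn_integral_lborel_scaleR:
  fixes f :: "'a::euclidean_space \<Rightarrow> ennreal"
  assumes [measurable]: "f \<in> borel_measurable borel" and "l > 0"
  shows "(\<integral>\<^sup>+z. f z \<partial>lborel) = ennreal (l ^ DIM('a)) * (\<integral>\<^sup>+z. f (l *\<^sub>R z) \<partial>lborel)"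
proof -
  have "(\<integral>\<^sup>+z. f z \<partial>lborel) = (\<integral>\<^sup>+z. f z \<partial>density (distr lborel borel (\<lambda>x. 0 + l *\<^sub>R x)) (\<lambda>_. ennreal (\<bar>l\<bar> ^ DIM('a))))"
    using lborel_affine[of l "0::'a"] assms(2) by simp
  also have "\<dots> = ennreal (l ^ DIM('a)) * (\<integral>\<^sup>+z. f (l *\<^sub>R z) \<partial>lborel)"
    using assms(2) by (simp add: nn_integral_density nn_integral_distr nn_integral_cmult)
  finally show ?thesis .
qed

lemma cone_section_D:
  assumes "0 < \<sigma>" "\<sigma> < 1" "y \<in> cone_section \<sigma>"
  shows "fst y < 0" "- (8 / (1 - \<sigma>)) < fst y" "\<bar>fst y\<bar> > (1 - \<sigma>) / 8" "norm (snd y) < \<sigma> * \<bar>fst y\<bar>"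
proof -
  have "0 < (1 - \<sigma>) / 8" using assms by simp
  then show "fst y < 0" "\<bar>fst y\<bar> > (1 - \<sigma>) / 8" using assms(3) unfolding cone_section_def mem_Collect_eq by linarith+
qed (use assms(3) in \<open>auto simp: cone_section_def\<close>)

lemma scale_cone_section:
  assumes "0 < \<sigma>" "\<sigma> < 1" "0 < l" "l * (8 / (1 - \<sigma>)) \<le> 1" "y \<in> cone_section \<sigma>"
  shows "l *\<^sub>R y \<in> past_cone \<sigma>"
proof -
  note y = cone_section_D[OF assms(1,2,5)]
  have "- 1 \<le> l * - (8 / (1 - \<sigma>))" using assms(4) by simp
  also have "\<dots> < l * fst y" using y(2) assms(3) by (rule mult_strict_left_mono)
  finally have "- 1 < l * fst y" .
  moreover have "l * fst y < 0" using y(1) assms(3) by (simp add: mult_pos_neg)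
  moreover have "l * norm (snd y) < \<sigma> * \<bar>l * fst y\<bar>"
    using mult_strict_left_mono[OF y(4) assms(3)] assms(3) by (simp add: abs_mult mult_ac)
  ultimately show ?thesis using assms(3) by (auto simp: past_cone_def split_beta)
qed

text \<open>The slab estimate carries the weight l^(-2), the annulus energy |t|^(-2). With |t| \<le>
  l T the first is at most T^2 times the second, and T \<ge> 1 covers the gradient term.\<close>

lemma annulus_slice_bound:
  fixes \<phi> :: "real \<times> (real ^ 'n) \<Rightarrow> real"
  assumes sol: "wave_solution (past_cone \<sigma>1) \<phi> V D DV D2 p"
    and t: "- 1 < t" "t < 0" and T: "T \<ge> 1" "\<bar>t\<bar> \<le> l * T" and l: "l > 0"
  shows "(\<integral>\<^sup>+x. ennreal ((norm (D (t, x)))\<^sup>2 + (\<phi> (t, x))\<^sup>2 / l\<^sup>2) * indicator (annulus \<sigma>0 \<sigma>1 t) (t, x) \<partial>lborel)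
    \<le> ennreal (T\<^sup>2) * annulus_energy \<sigma>0 \<sigma>1 \<phi> t"
proof -
  interpret wave_solution "past_cone \<sigma>1" \<phi> V D DV D2 p by (rule sol)
  define S where "S = {x :: real ^ 'n. \<sigma>0 * \<bar>t\<bar> < norm x \<and> norm x < \<sigma>1 * \<bar>t\<bar>}"
  define u where "u x = (norm (D (t, x)))\<^sup>2 + (\<phi> (t, x))\<^sup>2 / t\<^sup>2" for x
  have S: "(t, x) \<in> past_cone \<sigma>1" if "x \<in> S" for x using that t by (simp add: past_cone_def S_def)
  have ind: "indicator (annulus \<sigma>0 \<sigma>1 t) (t, x) = (indicator S x :: ennreal)" for x
    by (simp add: indicator_def annulus_def S_def)
  have "open S" unfolding S_def by (intro open_Collect_conj open_Collect_less continuous_intros)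
  moreover have "continuous_on S u"
    unfolding u_def using t S
    by (intro continuous_intros continuous_on_compose2[OF D_cont] continuous_on_compose2[OF C1_on_continuous[OF \<phi>_C1]]) auto
  ultimately have meas: "(\<lambda>x. ennreal (u x) * indicator S x) \<in> borel_measurable borel"
    by (intro borel_measurable_ennreal_indicator) auto
  have AE: "annulus_energy \<sigma>0 \<sigma>1 \<phi> t = (\<integral>\<^sup>+x. ennreal (u x) * indicator S x \<partial>lborel)"
    unfolding annulus_energy_def ind
  proof (rule nn_integral_cong)
    fix x
    show "ennreal (grad_sq \<phi> (t, x) + \<bar>t\<bar> powi (- 2) * \<bar>\<phi> (t, x)\<bar>\<^sup>2) * indicator S x = ennreal (u x) * indicator S x"
    proof (cases "x \<in> S")
      case True
      show ?thesis
        unfolding u_def grad_sq_eq[OF \<phi>_deriv[OF S[OF True]]] by (simp add: power_int_minus divide_inverse mult.commute)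
    qed simp
  qed
  have T2: "0 \<le> T\<^sup>2" by simp
  have "(\<integral>\<^sup>+x. ennreal ((norm (D (t, x)))\<^sup>2 + (\<phi> (t, x))\<^sup>2 / l\<^sup>2) * indicator (annulus \<sigma>0 \<sigma>1 t) (t, x) \<partial>lborel)
    \<le> (\<integral>\<^sup>+x. ennreal (T\<^sup>2) * (ennreal (u x) * indicator S x) \<partial>lborel)"
    unfolding ind
  proof (rule nn_integral_mono)
    fix x
    have "1 / l\<^sup>2 \<le> T\<^sup>2 / t\<^sup>2"
    proof -
      have "t\<^sup>2 \<le> (l * T)\<^sup>2" using T(2) by (simp add: abs_le_square_iff[symmetric])
      then show ?thesis using l t by (simp add: field_simps power_mult_distrib)
    qed
    then have "(\<phi> (t, x))\<^sup>2 * (1 / l\<^sup>2) \<le> (\<phi> (t, x))\<^sup>2 * (T\<^sup>2 / t\<^sup>2)" by (intro mult_left_mono) auto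
    moreover have "1 * (norm (D (t, x)))\<^sup>2 \<le> T\<^sup>2 * (norm (D (t, x)))\<^sup>2"
      using T(1) by (intro mult_right_mono) auto
    ultimately have "(norm (D (t, x)))\<^sup>2 + (\<phi> (t, x))\<^sup>2 / l\<^sup>2 \<le> T\<^sup>2 * u x"
      by (simp add: u_def distrib_left mult.commute)
    then have "ennreal ((norm (D (t, x)))\<^sup>2 + (\<phi> (t, x))\<^sup>2 / l\<^sup>2) \<le> ennreal (T\<^sup>2) * ennreal (u x)"
      by (subst ennreal_mult'[OF T2, symmetric]) (rule ennreal_leI)
    then show "ennreal ((norm (D (t, x)))\<^sup>2 + (\<phi> (t, x))\<^sup>2 / l\<^sup>2) * indicator S x \<le> ennreal (T\<^sup>2) * (ennreal (u x) * indicator S x)"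
      by (simp add: indicator_def)
  qed
  also have "\<dots> = ennreal (T\<^sup>2) * annulus_energy \<sigma>0 \<sigma>1 \<phi> t"
    unfolding AE by (rule nn_integral_cmult) (use meas in simp)
  finally show ?thesis .
qed

text \<open>The unit-scale estimate transported to scale l. The Jacobian l^(n+1) and the amplitude
  factor \<open>s\<close> of the rescaled energy density occur on both sides, so \<open>C\<close> is
  independent of l.\<close>

lemma slab_bound:
  fixes \<phi> :: "real \<times> (real ^ 'n) \<Rightarrow> real"
  assumes \<sigma>: "0 < \<sigma>0" "\<sigma>0 < \<sigma>1" "\<sigma>1 < 1" and p: "p > 1" and h: "0 < h" "h \<le> 1 / 16"
    and sol: "wave_solution (past_cone \<sigma>1) \<phi> V D DV D2 p"
    and l: "0 < l" "l * (8 / (1 - \<sigma>1)) \<le> 1"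
    and DV: "\<And>z. z \<in> past_cone \<sigma>1 \<Longrightarrow> l * norm (DV z) \<le> \<kappa> * V z"
    and est: "\<And>\<phi> V D DV D2. wave_solution (cone_section \<sigma>1 :: (real \<times> (real ^ 'n)) set) \<phi> V D DV D2 p \<Longrightarrow>
       (\<And>z. z \<in> cone_section \<sigma>1 \<Longrightarrow> norm (DV z) \<le> \<kappa> * V z) \<Longrightarrow>
       core_energy \<sigma>0 h D \<phi>
       \<le> ennreal C * outer_energy \<sigma>0 \<sigma>1 D \<phi>"
  shows "slab_energy \<sigma>0 (1 + h) \<phi> (- l) \<le> ennreal C * (\<integral>\<^sup>+z. ennreal ((norm (D z))\<^sup>2 + (\<phi> z)\<^sup>2 / l\<^sup>2)
    * indicator {z. (1 / l) *\<^sub>R z \<in> cone_section \<sigma>1 \<and> \<sigma>0 * \<bar>fst z\<bar> < norm (snd z)} z \<partial>lborel)"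
proof -
  interpret wave_solution "past_cone \<sigma>1" \<phi> V D DV D2 p by (rule sol)
  define U where "U = (cone_section \<sigma>1 :: (real \<times> (real ^ 'n)) set)"
  define B where "B = slab \<sigma>0 (1 + h) (- l) \<inter> (UNIV :: (real \<times> (real ^ 'n)) set)"
  define R where "R = {z :: real \<times> (real ^ 'n). \<bar>fst z + 1\<bar> \<le> h \<and> norm (snd z) \<le> \<sigma>0 * \<bar>fst z\<bar>}"
  define A where "A = {z \<in> U. \<sigma>0 * \<bar>fst z\<bar> < norm (snd z)}"
  define A' where "A' = {z :: real \<times> (real ^ 'n). (1 / l) *\<^sub>R z \<in> cone_section \<sigma>1 \<and> \<sigma>0 * \<bar>fst z\<bar> < norm (snd z)}"
  define g where "g z = (norm (D z))\<^sup>2 + (\<phi> z)\<^sup>2 / l\<^sup>2" for z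
  define a where "a = 2 / (p - 1)"
  define s where "s = (l powr a)\<^sup>2 * l\<^sup>2"
  have s: "s > 0" using l by (simp add: s_def)
  have g_cont: "continuous_on (past_cone \<sigma>1) g"
    unfolding g_def using l by (intro continuous_intros D_cont C1_on_continuous[OF \<phi>_C1]) auto
  have scale: "l *\<^sub>R y \<in> past_cone \<sigma>1" if "y \<in> U" for y
    using scale_cone_section[OF _ _ l] \<sigma> that by (simp add: U_def)
  have gl_cont: "continuous_on U (\<lambda>y. g (l *\<^sub>R y))"
    by (rule continuous_on_compose2[OF g_cont]) (use scale in \<open>auto intro!: continuous_intros\<close>)
  have R_U: "R \<subseteq> U"
  proof
    show "z \<in> U" if "z \<in> R" for z
      unfolding U_def by (rule mem_cone_section[OF \<sigma>]) (use that h in \<open>auto simp: R_def\<close>)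
  qed
  have A_U: "A \<subseteq> U" by (auto simp: A_def)
  have "closed R" unfolding R_def by (intro closed_Collect_conj closed_Collect_le continuous_intros)
  then have measR: "(\<lambda>y. ennreal (g (l *\<^sub>R y)) * indicator R y) \<in> borel_measurable borel"
    by (intro borel_measurable_ennreal_indicator continuous_on_subset[OF gl_cont R_U]) auto
  have "open {z :: real \<times> (real ^ 'n). \<sigma>0 * \<bar>fst z\<bar> < norm (snd z)}"
    by (intro open_Collect_less continuous_intros)
  moreover have "A = U \<inter> {z. \<sigma>0 * \<bar>fst z\<bar> < norm (snd z)}" by (auto simp: A_def)
  ultimately have "open A" using open_cone_section[of \<sigma>1] by (auto simp: U_def)
  then have measA: "(\<lambda>y. ennreal (g (l *\<^sub>R y)) * indicator A y) \<in> borel_measurable borel"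
    by (intro borel_measurable_ennreal_indicator continuous_on_subset[OF gl_cont A_U]) auto
  have A'_eq: "l *\<^sub>R y \<in> A' \<longleftrightarrow> y \<in> A" for y
    using l by (simp add: A'_def A_def U_def abs_mult mult.left_commute[of \<sigma>0])
  have A'_cone: "A' \<subseteq> past_cone \<sigma>1"
  proof
    fix z assume "z \<in> A'"
    then have "l *\<^sub>R ((1 / l) *\<^sub>R z) \<in> past_cone \<sigma>1" by (intro scale) (simp add: A'_def U_def)
    then show "z \<in> past_cone \<sigma>1" using l by simp
  qed
  have "A' = (\<lambda>z. (1 / l) *\<^sub>R z) -` A" using l A'_eq[of "(1 / l) *\<^sub>R z" for z] by (auto simp: A'_def A_def U_def abs_mult field_simps)
  moreover have "open ((\<lambda>z. (1 / l) *\<^sub>R z) -` A)" by (intro open_vimage \<open>open A\<close> continuous_intros)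
  ultimately have "open A'" by simp
  then have measA': "(\<lambda>z. ennreal (g z) * indicator A' z) \<in> borel_measurable borel"
    by (intro borel_measurable_ennreal_indicator continuous_on_subset[OF g_cont A'_cone]) auto
  have B: "z \<in> past_cone \<sigma>1 \<and> (\<forall>y. z = l *\<^sub>R y \<longrightarrow> y \<in> R)" if "z \<in> B" for z
  proof -
    define y where "y = (1 / l) *\<^sub>R z"
    have zy: "z = l *\<^sub>R y" using l by (simp add: y_def)
    have z: "(1 + h) * (- l) < l * fst y" "l * fst y < inverse (1 + h) * (- l)" "norm (l *\<^sub>R snd y) < \<sigma>0 * \<bar>l * fst y\<bar>"
      using that by (auto simp: B_def slab_def zy split_beta)
    have "l * - (1 + h) < l * fst y" using z(1) by (simp add: algebra_simps)
    then have 1: "- (1 + h) < fst y" using l by (simp only: mult_less_cancel_left_pos)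
    have "l * fst y < l * - inverse (1 + h)" using z(2) by (simp add: algebra_simps)
    then have 2: "fst y < - inverse (1 + h)" using l by (simp only: mult_less_cancel_left_pos)
    \<comment> \<open>This is why the slab parameter is 1 + h: after rescaling, both ends -(1 + h)
      and -1 / (1 + h) of the slab lie within h of -1.\<close>
    have "1 - h \<le> inverse (1 + h)" using h by (simp add: field_simps)
    then have "\<bar>fst y + 1\<bar> \<le> h" using 1 2 by linarith
    moreover have "l * norm (snd y) < l * (\<sigma>0 * \<bar>fst y\<bar>)" using z(3) l by (simp add: abs_mult mult.left_commute)
    then have "norm (snd y) < \<sigma>0 * \<bar>fst y\<bar>" using l by simp
    ultimately have yR: "y \<in> R" by (simp add: R_def)
    then have "z \<in> past_cone \<sigma>1" unfolding zy by (intro scale subsetD[OF R_U])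
    moreover have "y' = y" if "z = l *\<^sub>R y'" for y' using that zy l by simp
    ultimately show ?thesis using yR by blast
  qed
  have "B = {z. (1 + h) * (- l) < fst z \<and> fst z < inverse (1 + h) * (- l) \<and> norm (snd z) < \<sigma>0 * \<bar>fst z\<bar>}"
    by (auto simp: B_def slab_def)
  then have "open B" by (simp only:) (intro open_Collect_conj open_Collect_less continuous_intros)
  then have measB: "(\<lambda>z. ennreal (g z) * indicator B z) \<in> borel_measurable borel"
    using B by (intro borel_measurable_ennreal_indicator continuous_on_subset[OF g_cont]) auto
  have "slab_energy \<sigma>0 (1 + h) \<phi> (- l) = (\<integral>\<^sup>+z. ennreal (g z) * indicator B z \<partial>lborel)"
    unfolding slab_energy_def
  proof (rule nn_integral_cong)
    fix z
    show "ennreal (grad_sq \<phi> z + \<bar>- l\<bar> powi (- 2) * (\<phi> z)\<^sup>2) * indicator (slab \<sigma>0 (1 + h) (- l)) z = ennreal (g z) * indicator B z"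
    proof (cases "z \<in> B")
      case True
      then have "z \<in> past_cone \<sigma>1" using B by blast
      then show ?thesis
        unfolding g_def using grad_sq_eq[OF \<phi>_deriv] l by (simp add: B_def power_int_minus divide_inverse mult.commute)
    qed (simp add: B_def)
  qed
  also have "\<dots> = ennreal (l ^ DIM(real \<times> (real ^ 'n))) * (\<integral>\<^sup>+y. ennreal (g (l *\<^sub>R y)) * indicator B (l *\<^sub>R y) \<partial>lborel)"
    by (rule nn_integral_lborel_scaleR[OF measB l(1)])
  also have "\<dots> \<le> ennreal (l ^ DIM(real \<times> (real ^ 'n))) * (\<integral>\<^sup>+y. ennreal (g (l *\<^sub>R y)) * indicator R y \<partial>lborel)"
    using B by (intro mult_left_mono nn_integral_mono) (auto simp: indicator_def)
  also have "(\<integral>\<^sup>+y. ennreal (g (l *\<^sub>R y)) * indicator R y \<partial>lborel) \<le> ennreal C * (\<integral>\<^sup>+y. ennreal (g (l *\<^sub>R y)) * indicator A y \<partial>lborel)"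
  proof -
    have a: "a * (p - 1) = 2" using p by (simp add: a_def field_simps)
    note sol' = wave_solution_rescale[OF sol l(1) open_cone_section scale[unfolded U_def] a]
    \<comment> \<open>The unit-scale density of the rescaled solution is a constant multiple of the
      density with weight l^(-2); \<open>s\<close> is positive and finite and cancels below.\<close>
    have N: "(norm (l powr (a + 1) *\<^sub>R D (l *\<^sub>R y)))\<^sup>2 + (l powr a * \<phi> (l *\<^sub>R y))\<^sup>2 = s * g (l *\<^sub>R y)" for y
      using l by (simp add: s_def g_def powr_add power_mult_distrib field_simps)
    have ms: "ennreal (s * g (l *\<^sub>R y)) * indicator X y = ennreal s * (ennreal (g (l *\<^sub>R y)) * indicator X y)" for X y
      using s by (simp add: ennreal_mult' mult.assoc)
    have "norm (l *\<^sub>R DV (l *\<^sub>R z)) \<le> \<kappa> * V (l *\<^sub>R z)" if "z \<in> cone_section \<sigma>1" for z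
      using DV[OF scale[of z]] that l by (simp add: U_def)
    from est[OF sol' this] \<sigma>
    have "(\<integral>\<^sup>+y. ennreal s * (ennreal (g (l *\<^sub>R y)) * indicator R y) \<partial>lborel)
        \<le> ennreal C * (\<integral>\<^sup>+y. ennreal s * (ennreal (g (l *\<^sub>R y)) * indicator A y) \<partial>lborel)"
      unfolding N ms R_def[symmetric] U_def[symmetric] A_def[symmetric] by simp
    then have "ennreal s * (\<integral>\<^sup>+y. ennreal (g (l *\<^sub>R y)) * indicator R y \<partial>lborel)
        \<le> ennreal s * (ennreal C * (\<integral>\<^sup>+y. ennreal (g (l *\<^sub>R y)) * indicator A y \<partial>lborel))"
      using measR measA by (simp add: nn_integral_cmult mult.left_commute)
    then show ?thesis using s by (subst (asm) ennreal_mult_le_mult_iff) auto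
  qed
  also have "ennreal (l ^ DIM(real \<times> (real ^ 'n))) * (ennreal C * (\<integral>\<^sup>+y. ennreal (g (l *\<^sub>R y)) * indicator A y \<partial>lborel))
      = ennreal C * (ennreal (l ^ DIM(real \<times> (real ^ 'n))) * (\<integral>\<^sup>+y. ennreal (g (l *\<^sub>R y)) * indicator A' (l *\<^sub>R y) \<partial>lborel))"
    by (simp add: indicator_def A'_eq mult.left_commute del: DIM_prod)
  also have "ennreal (l ^ DIM(real \<times> (real ^ 'n))) * (\<integral>\<^sup>+y. ennreal (g (l *\<^sub>R y)) * indicator A' (l *\<^sub>R y) \<partial>lborel)
      = (\<integral>\<^sup>+z. ennreal (g z) * indicator A' z \<partial>lborel)"
    by (rule nn_integral_lborel_scaleR[OF measA' l(1), symmetric])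
  finally show ?thesis by (simp add: g_def A'_def mult_left_mono)
qed

text \<open>The sign of the exponent depends on dimension and power, so the bound is symmetric in
  it.\<close>

lemma powr_neg_le:
  fixes q \<tau> T :: real
  assumes "T \<ge> 1" "1 / T \<le> \<tau>" "\<tau> \<le> T"
  shows "\<tau> powr (- q) \<le> T powr \<bar>q\<bar>"
proof (cases "q \<ge> 0")
  case True
  have "0 < 1 / T" using assms by simp
  then have "\<tau> powr (- q) \<le> (1 / T) powr (- q)" using assms True by (intro powr_mono2') auto
  also have "\<dots> = T powr \<bar>q\<bar>" using assms True by (simp add: powr_divide powr_minus)
  finally show ?thesis .
next
  case False
  have "0 < 1 / T" using assms by simp
  then have "0 < \<tau>" using assms by linarith
  then have "\<tau> powr (- q) \<le> T powr (- q)" using assms False by (intro powr_mono2) auto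
  then show ?thesis using False by simp
qed

text \<open>Integration over time slices by Tonelli. On the region l / T < |t| < l T, so |t|^(-q) is
  l^(-q) up to T^|q|. Each slice is thus bounded by one constant, and the time interval contributes
  its length l T.\<close>

lemma annulus_spacetime_bound:
  fixes \<phi> :: "real \<times> (real ^ 'n) \<Rightarrow> real"
  assumes \<sigma>: "0 < \<sigma>1" "\<sigma>1 < 1" and T: "T = 8 / (1 - \<sigma>1)" and l: "0 < l" "l * T \<le> 1"
    and sol: "wave_solution (past_cone \<sigma>1) \<phi> V D DV D2 p" and \<delta>: "\<delta> > 0"
    and AE: "\<And>t. - (l * T) < t \<Longrightarrow> t < 0 \<Longrightarrow> ennreal (\<bar>t\<bar> powr q) * annulus_energy \<sigma>0 \<sigma>1 \<phi> t < ennreal \<delta>"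
  shows "(\<integral>\<^sup>+z. ennreal ((norm (D z))\<^sup>2 + (\<phi> z)\<^sup>2 / l\<^sup>2)
      * indicator {z. (1 / l) *\<^sub>R z \<in> cone_section \<sigma>1 \<and> \<sigma>0 * \<bar>fst z\<bar> < norm (snd z)} z \<partial>lborel)
    \<le> ennreal (T\<^sup>2 * (\<delta> * (l powr (- q) * T powr \<bar>q\<bar>)) * (l * T))"
proof -
  interpret wave_solution "past_cone \<sigma>1" \<phi> V D DV D2 p by (rule sol)
  define A' where "A' = {z :: real \<times> (real ^ 'n). (1 / l) *\<^sub>R z \<in> cone_section \<sigma>1 \<and> \<sigma>0 * \<bar>fst z\<bar> < norm (snd z)}"
  define g where "g z = (norm (D z))\<^sup>2 + (\<phi> z)\<^sup>2 / l\<^sup>2" for z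
  define b where "b = T\<^sup>2 * (\<delta> * (l powr (- q) * T powr \<bar>q\<bar>))"
  have T1: "T \<ge> 1" unfolding T using \<sigma> by (simp add: field_simps)
  have b: "b \<ge> 0" using \<delta> by (simp add: b_def)
  have A': "z \<in> past_cone \<sigma>1" "- (l * T) < fst z" "fst z < 0" "l / T < \<bar>fst z\<bar>"
    "z \<in> annulus \<sigma>0 \<sigma>1 (fst z)" if "z \<in> A'" for z
  proof -
    have y: "(1 / l) *\<^sub>R z \<in> cone_section \<sigma>1" using that by (simp add: A'_def)
    have "l *\<^sub>R ((1 / l) *\<^sub>R z) \<in> past_cone \<sigma>1"
      by (rule scale_cone_section[OF \<sigma> l(1) _ y]) (use l T in simp)
    then show z: "z \<in> past_cone \<sigma>1" using l by simp
    have "- T < fst z / l" "(1 - \<sigma>1) / 8 < \<bar>fst z / l\<bar>" using cone_section_D(2,3)[OF \<sigma> y] by (simp_all add: T)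
    moreover have "(1 - \<sigma>1) / 8 = 1 / T" by (simp add: T)
    ultimately show "- (l * T) < fst z" "l / T < \<bar>fst z\<bar>" using l by (simp_all add: field_simps)
    show "fst z < 0" "z \<in> annulus \<sigma>0 \<sigma>1 (fst z)"
      using z that by (cases z; auto simp: past_cone_def annulus_def A'_def)+
  qed
  have g_cont: "continuous_on (past_cone \<sigma>1) g"
    unfolding g_def using l by (intro continuous_intros D_cont C1_on_continuous[OF \<phi>_C1]) auto
  have "open {z :: real \<times> (real ^ 'n). \<sigma>0 * \<bar>fst z\<bar> < norm (snd z)}"
    by (intro open_Collect_less continuous_intros)
  moreover have "open ((\<lambda>z :: real \<times> (real ^ 'n). (1 / l) *\<^sub>R z) -` cone_section \<sigma>1)"
    by (intro open_vimage open_cone_section continuous_intros)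
  moreover have "A' = ((\<lambda>z. (1 / l) *\<^sub>R z) -` cone_section \<sigma>1) \<inter> {z. \<sigma>0 * \<bar>fst z\<bar> < norm (snd z)}"
    by (auto simp: A'_def)
  ultimately have "open A'" by auto
  then have meas: "(\<lambda>z. ennreal (g z) * indicator A' z) \<in> borel_measurable borel"
    using A'(1) by (intro borel_measurable_ennreal_indicator continuous_on_subset[OF g_cont]) auto
  have slice: "(\<integral>\<^sup>+x. ennreal (g (t, x)) * indicator A' (t, x) \<partial>lborel) \<le> ennreal b * indicator {- (l * T)..0} t" for t
  proof (cases "- (l * T) < t \<and> t < 0 \<and> l / T < \<bar>t\<bar>")
    case True
    have lt: "0 < \<bar>t\<bar>" using True by simp
    have "- 1 < t" using True l by linarith
    have tq: "\<bar>t\<bar> powr (- q) \<le> l powr (- q) * T powr \<bar>q\<bar>"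
    proof -
      have "\<bar>t\<bar> powr (- q) = l powr (- q) * (\<bar>t\<bar> / l) powr (- q)"
        using l lt by (simp add: powr_divide)
      also have "\<dots> \<le> l powr (- q) * T powr \<bar>q\<bar>"
        using True l T1 by (intro mult_left_mono powr_neg_le) (auto simp: field_simps)
      finally show ?thesis .
    qed
    have "annulus_energy \<sigma>0 \<sigma>1 \<phi> t = ennreal (\<bar>t\<bar> powr (- q)) * (ennreal (\<bar>t\<bar> powr q) * annulus_energy \<sigma>0 \<sigma>1 \<phi> t)"
      using lt by (simp flip: mult.assoc ennreal_mult powr_add)
    also have "\<dots> \<le> ennreal (\<bar>t\<bar> powr (- q)) * ennreal \<delta>"
      using AE[of t] True by (intro mult_left_mono) (auto intro: less_imp_le)
    also have "\<dots> = ennreal (\<delta> * \<bar>t\<bar> powr (- q))" using \<delta> by (simp add: ennreal_mult mult.commute)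
    also have "\<dots> \<le> ennreal (\<delta> * (l powr (- q) * T powr \<bar>q\<bar>))"
      using tq \<delta> by (intro ennreal_leI mult_left_mono) auto
    finally have E: "annulus_energy \<sigma>0 \<sigma>1 \<phi> t \<le> ennreal (\<delta> * (l powr (- q) * T powr \<bar>q\<bar>))" .
    have "(\<integral>\<^sup>+x. ennreal (g (t, x)) * indicator A' (t, x) \<partial>lborel)
        \<le> (\<integral>\<^sup>+x. ennreal ((norm (D (t, x)))\<^sup>2 + (\<phi> (t, x))\<^sup>2 / l\<^sup>2) * indicator (annulus \<sigma>0 \<sigma>1 t) (t, x) \<partial>lborel)"
      using A'(5) by (intro nn_integral_mono) (auto simp: g_def indicator_def)
    also have "\<dots> \<le> ennreal (T\<^sup>2) * annulus_energy \<sigma>0 \<sigma>1 \<phi> t"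
      using True by (intro annulus_slice_bound[OF sol \<open>- 1 < t\<close> _ T1 _ l(1)]) auto
    also have "\<dots> \<le> ennreal (T\<^sup>2) * ennreal (\<delta> * (l powr (- q) * T powr \<bar>q\<bar>))"
      using E by (intro mult_left_mono) auto
    also have "\<dots> = ennreal b" using \<delta> by (simp add: b_def ennreal_mult)
    finally show ?thesis using True by simp
  next
    case False
    then have "(t, x) \<notin> A'" for x using A'(2-4)[of "(t, x)"] by auto
    then show ?thesis by simp
  qed
  have "(\<integral>\<^sup>+z. ennreal (g z) * indicator A' z \<partial>lborel) = (\<integral>\<^sup>+t. \<integral>\<^sup>+x. ennreal (g (t, x)) * indicator A' (t, x) \<partial>lborel \<partial>lborel)"
    using meas by (subst lborel.nn_integral_fst) (simp_all add: lborel_prod)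
  also have "\<dots> \<le> (\<integral>\<^sup>+t. ennreal b * indicator {- (l * T)..0} t \<partial>lborel)"
    by (intro nn_integral_mono slice)
  also have "\<dots> = ennreal b * ennreal (l * T)"
    using l T1 by (simp add: nn_integral_cmult)
  also have "\<dots> = ennreal (b * (l * T))" using b by (simp add: ennreal_mult')
  finally show ?thesis by (simp add: g_def A'_def b_def)
qed

section \<open>Conclusion near the tip of the cone\<close>

lemma subconformal_exponent:
  fixes p :: real
  assumes "1 < p" "CARD('n) = 1 \<or> p < 1 + 4 / (real CARD('n) - 1)"
  shows "(p - 1) * (real DIM(real ^ 'n) - 1) < 4"
proof (cases "CARD('n) = 1")
  case False
  then have "1 < CARD('n)" using zero_less_card_finite[where 'a='n] by linarith
  then have "1 < real CARD('n)" by simp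
  then show ?thesis using assms(2) False by (simp add: field_simps)
qed simp

theorem theorem1p5:
  fixes \<sigma>0 \<sigma>1 p :: real
    and V :: "real \<times> (real ^ 'n) \<Rightarrow> real"
  assumes "0 < \<sigma>0" and "\<sigma>0 < \<sigma>1" and "\<sigma>1 < 1"
    and "1 < p" and "CARD('n) = 1 \<or> p < 1 + 4 / (real CARD('n) - 1)"
    and "C1_on_closure (past_cone \<sigma>1) V"
    and "\<exists>\<epsilon>>0. \<forall>z\<in>closure (past_cone \<sigma>1). V z \<ge> \<epsilon>"
  shows "\<exists>\<gamma>>1. \<exists>K>0. \<forall>\<delta>>0. \<forall>\<phi> :: real \<times> (real ^ 'n) \<Rightarrow> real.
    C2_on (past_cone \<sigma>1) \<phi> \<longrightarrow>
    (\<forall>z\<in>past_cone \<sigma>1. wave_op \<phi> z + V z * \<bar>\<phi> z\<bar> powr (p - 1) * \<phi> z = 0) \<longrightarrow>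
    0 \<le> Limsup (at_left 0) (\<lambda>t. ennreal (\<bar>t\<bar> powr (2 - real CARD('n) + 4 / (p - 1)))
            * annulus_energy \<sigma>0 \<sigma>1 \<phi> t) \<longrightarrow>
    Limsup (at_left 0) (\<lambda>t. ennreal (\<bar>t\<bar> powr (2 - real CARD('n) + 4 / (p - 1)))
            * annulus_energy \<sigma>0 \<sigma>1 \<phi> t) < ennreal \<delta> \<longrightarrow>
    Limsup (at_left 0) (\<lambda>t. ennreal (\<bar>t\<bar> powr (1 - real CARD('n) + 4 / (p - 1)))
            * slab_energy \<sigma>0 \<gamma> \<phi> t) \<le> ennreal (K * \<delta>)"
proof (rule local_estimate[OF assms(1-4) subconformal_exponent[OF assms(4,5)]])
  fix h \<kappa> C :: real
  assume h: "h > 0" "h \<le> 1 / 16" and \<kappa>: "\<kappa> > 0" and C: "C \<ge> 0"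
    and est: "\<And>\<phi> V D DV D2. wave_solution (cone_section \<sigma>1 :: (real \<times> (real ^ 'n)) set) \<phi> V D DV D2 p \<Longrightarrow>
       (\<And>z. z \<in> cone_section \<sigma>1 \<Longrightarrow> norm (DV z) \<le> \<kappa> * V z) \<Longrightarrow>
       core_energy \<sigma>0 h D \<phi>
       \<le> ennreal C * outer_energy \<sigma>0 \<sigma>1 D \<phi>"
  note \<sigma> = assms(1-3)
  define S where "S = (past_cone \<sigma>1 :: (real \<times> (real ^ 'n)) set)"
  have "S = {z. - 1 < fst z \<and> fst z < 0 \<and> norm (snd z) < \<sigma>1 * \<bar>fst z\<bar>}"
    by (auto simp: S_def past_cone_def)
  then have open_S: "open S" by (simp only:) (intro open_Collect_conj open_Collect_less continuous_intros)
  have "bounded S"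
  proof (rule bounded_subset)
    show "bounded (cball (0::real) 1 \<times> cball (0::real ^ 'n) 1)" by (intro bounded_Times) auto
    show "S \<subseteq> cball (0::real) 1 \<times> cball (0::real ^ 'n) 1"
    proof
      fix z assume "z \<in> S"
      then have z: "- 1 < fst z" "fst z < 0" "norm (snd z) < \<sigma>1 * \<bar>fst z\<bar>" by (auto simp: S_def past_cone_def)
      have "\<sigma>1 * \<bar>fst z\<bar> \<le> 1 * 1" using z \<sigma> by (intro mult_mono) auto
      then show "z \<in> cball (0::real) 1 \<times> cball (0::real ^ 'n) 1" using z by (cases z) auto
    qed
  qed
  then obtain DV M where V: "\<And>z. z \<in> S \<Longrightarrow> GDERIV V z :> DV z" "continuous_on S DV" "M > 0"
    "\<And>z. z \<in> S \<Longrightarrow> norm (DV z) \<le> M"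
    using C1_on_closureE[OF assms(6)[folded S_def]] by metis
  obtain \<epsilon> where \<epsilon>: "\<epsilon> > 0" "\<And>z. z \<in> S \<Longrightarrow> V z \<ge> \<epsilon>"
    using assms(7) closure_subset unfolding S_def by blast
  define T where "T = 8 / (1 - \<sigma>1)"
  have T: "T > 0" using \<sigma> by (simp add: T_def)
  define q where "q = 2 - real CARD('n) + 4 / (p - 1)"
  \<comment> \<open>T^3 consists of T^2 from comparing the weights on a slice and T from the length
    of the time interval. The summand 1 makes \<open>K\<close> positive even if \<open>C\<close> is
    0.\<close>
  define K where "K = C * T ^ 3 * T powr \<bar>q\<bar> + 1"
  have K: "K > 0" using C T unfolding K_def by (intro add_nonneg_pos mult_nonneg_nonneg) auto
  have "Limsup (at_left 0) (\<lambda>t. ennreal (\<bar>t\<bar> powr (q - 1)) * slab_energy \<sigma>0 (1 + h) \<phi> t) \<le> ennreal (K * \<delta>)"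
    if \<delta>: "\<delta> > 0" and \<phi>: "C2_on S \<phi>"
      and eq: "\<And>z. z \<in> S \<Longrightarrow> wave_op \<phi> z + V z * \<bar>\<phi> z\<bar> powr (p - 1) * \<phi> z = 0"
      and lim: "Limsup (at_left 0) (\<lambda>t. ennreal (\<bar>t\<bar> powr q) * annulus_energy \<sigma>0 \<sigma>1 \<phi> t) < ennreal \<delta>"
    for \<delta> and \<phi> :: "real \<times> (real ^ 'n) \<Rightarrow> real"
  proof -
    obtain D D2 where D: "\<And>z. z \<in> S \<Longrightarrow> GDERIV \<phi> z :> D z" "\<And>z. z \<in> S \<Longrightarrow> (D has_derivative D2 z) (at z)"
      "\<And>h. continuous_on S (\<lambda>z. D2 z h)"
      by (rule C2_on_gradientE[OF \<phi>]) metis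
    have sol: "wave_solution S \<phi> V D DV D2 p"
    proof unfold_locales
      show "0 < V z" if "z \<in> S" for z using \<epsilon>(1) \<epsilon>(2)[OF that] by linarith
      show "(\<Sum>b\<in>Basis. time_reflection (D2 z b) \<bullet> b) + V z * (\<bar>\<phi> z\<bar> powr (p - 1) * \<phi> z) = 0" if "z \<in> S" for z
        using eq[OF that] wave_op_eq[OF open_S that D(1) D(2)[OF that]] by (simp add: mult.assoc)
    qed (use open_S D V assms(4) in auto)
    obtain d where d: "d < 0" "\<And>t. d < t \<Longrightarrow> t < 0 \<Longrightarrow> ennreal (\<bar>t\<bar> powr q) * annulus_energy \<sigma>0 \<sigma>1 \<phi> t < ennreal \<delta>"
      using Limsup_lessD[OF lim] unfolding eventually_at_left_field by blast
    \<comment> \<open>Three smallness conditions on |t|: below 1 / T the rescaled section fits into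
      the cone; below \<kappa> \<epsilon> / M the rescaled gradient of V is at most \<kappa> V;
      below - d / T every time entering the outer energy lies where the annulus bound holds.\<close>
    have "ennreal (\<bar>t\<bar> powr (q - 1)) * slab_energy \<sigma>0 (1 + h) \<phi> t \<le> ennreal (K * \<delta>)"
      if t: "t < 0" "- min (1 / T) (min (\<kappa> * \<epsilon> / M) (- d / T)) < t" for t
    proof -
      define l where "l = - t"
      have l: "0 < l" using t by (simp add: l_def)
      have "l < 1 / T" "l < \<kappa> * \<epsilon> / M" "l < - d / T" using t(2) by (simp_all add: l_def)
      then have lT: "l * T \<le> 1" and lM: "l * M \<le> \<kappa> * \<epsilon>" and ld: "l * T < - d"
        using T V(3) by (simp_all add: field_simps)
      have DVl: "l * norm (DV z) \<le> \<kappa> * V z" if "z \<in> past_cone \<sigma>1" for z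
      proof -
        have "l * norm (DV z) \<le> l * M" using V(4)[of z] that l by (intro mult_left_mono) (auto simp: S_def)
        also have "\<dots> \<le> \<kappa> * \<epsilon>" by (rule lM)
        also have "\<dots> \<le> \<kappa> * V z" using \<epsilon>(2)[of z] that \<kappa> by (intro mult_left_mono) (auto simp: S_def)
        finally show ?thesis .
      qed
      define b where "b = T\<^sup>2 * (\<delta> * (l powr (- q) * T powr \<bar>q\<bar>)) * (l * T)"
      have b: "b \<ge> 0" using \<delta> l T by (simp add: b_def)
      have "slab_energy \<sigma>0 (1 + h) \<phi> (- l) \<le> ennreal C * (\<integral>\<^sup>+z. ennreal ((norm (D z))\<^sup>2 + (\<phi> z)\<^sup>2 / l\<^sup>2)
        * indicator {z. (1 / l) *\<^sub>R z \<in> cone_section \<sigma>1 \<and> \<sigma>0 * \<bar>fst z\<bar> < norm (snd z)} z \<partial>lborel)"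
        by (rule slab_bound[OF \<sigma> assms(4) h sol[unfolded S_def] l lT[unfolded T_def] DVl est])
      also have "\<dots> \<le> ennreal C * ennreal b"
        unfolding b_def using \<sigma> d(2) ld
        by (intro mult_left_mono annulus_spacetime_bound[OF _ _ T_def l lT sol[unfolded S_def] \<delta>]) auto
      finally have "ennreal (l powr (q - 1)) * slab_energy \<sigma>0 (1 + h) \<phi> (- l) \<le> ennreal (l powr (q - 1)) * (ennreal C * ennreal b)"
        by (rule mult_left_mono) simp
      also have "\<dots> = ennreal (l powr (q - 1) * (C * b))" using C b by (simp add: ennreal_mult)
      \<comment> \<open>The powers of l cancel: q - 1 from the slab weight, - q from the annulus
        bound, and 1 from the length of the time interval.\<close>
      also have "l powr (q - 1) * (C * b) = (l powr (q - 1) * l powr (- q) * l) * (C * T ^ 3 * T powr \<bar>q\<bar>) * \<delta>"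
        by (simp add: b_def power2_eq_square power3_eq_cube)
      also have "l powr (q - 1) * l powr (- q) * l = 1" using l by (simp add: powr_minus powr_diff)
      also have "ennreal (1 * (C * T ^ 3 * T powr \<bar>q\<bar>) * \<delta>) \<le> ennreal (K * \<delta>)"
        using \<delta> by (intro ennreal_leI) (simp add: K_def)
      finally show ?thesis using l by (simp add: l_def)
    qed
    moreover have "- min (1 / T) (min (\<kappa> * \<epsilon> / M) (- d / T)) < 0" using T V(3) \<kappa> \<epsilon>(1) d(1) by (simp add: divide_neg_pos)
    ultimately have "\<forall>\<^sub>F t in at_left 0. ennreal (\<bar>t\<bar> powr (q - 1)) * slab_energy \<sigma>0 (1 + h) \<phi> t \<le> ennreal (K * \<delta>)"
      unfolding eventually_at_left_field by blast
    then show ?thesis by (rule Limsup_bounded)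
  qed
  moreover have "q - 1 = 1 - real CARD('n) + 4 / (p - 1)" by (simp add: q_def)
  ultimately show ?thesis
    using h(1) K unfolding S_def q_def by (intro exI[of _ "1 + h"] exI[of _ K]) auto
qed

end
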